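(* Let $p\ge 2$, $\alpha\in(0,1)$, $n>p\alpha$, $0\le \mu<C_{n,\alpha,p}$, let $\Omega\subset\mathbb{R}^n$ be a domain (possibly unbounded, possibly $\Omega=\mathbb{R}^n$) with Lipschitz boundary and $0\in\Omega$, and let $V$ satisfy assumption $(A_p)$ on $\Omega$. Let $$\lambda_1:=\inf\Big\{J_\mu(u): u\in X_0,\ \int_\Omega V|u|^p\,dx=1\Big\}.$$ Then $\lambda_1$ is simple, in the sense that any two eigenfunctions associated to $\lambda_1$ are constant multiples of each other.
   Context: $V^\pm=\max\{\pm V,0\}$. Assumption $(A_p)$ on $V:\Omega\to\mathbb{R}$: $V\in L^1_{loc}(\Omega)$, and $V^+=V_1+V_2\neq 0$ with $V_1\in L^{n/(p\alpha)}(\Omega)$ and $V_2$ such that $\lim_{x\to y,\,x\in\Omega}|x-y|^{p\alpha}V_2(x)=0$ for all $y\in\overline\Omega$ and $\lim_{|x|\to\infty,\,x\in\Omega}|x|^{p\alpha}V_2(x)=0$. $C_{n,\alpha,p}>0$ is the optimal constant in the fractional Hardy inequality $\iint_{\mathbb{R}^n\times\mathbb{R}^n}\frac{|u(x)-u(y)|^p}{|x-y|^{n+p\alpha}}dxdy\ge C_{n,\alpha,p}\int_{\mathbb{R}^n}\frac{|u(x)|^p}{|x|^{p\alpha}}dx$; explicitly $C_{n,\alpha,p}=2\int_0^1 r^{p\alpha-1}|1-r^{(n-p\alpha)/p}|^p\Phi_{n,\alpha,p}(r)\,dr$, with $\Phi_{n,\alpha,p}(r)=|\mathbb{S}^{n-2}|\int_{-1}^1\frac{(1-t^2)^{(n-3)/2}}{(1-2rt+r^2)^{(n+p\alpha)/2}}dt$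 for $n\ge2$ and $\Phi_{1,\alpha,p}(r)=(1-r)^{-1-p\alpha}+(1+r)^{-1-p\alpha}$. $X_0$ is the completion of $\{u\in C_c^\infty(\mathbb{R}^n): u=0\text{ in }\mathbb{R}^n\setminus\Omega\}$ with respect to the norm $\|u\|_{X_0}=\big(\int_{Q}\frac{|u(x)-u(y)|^p}{|x-y|^{n+p\alpha}}dxdy\big)^{1/p}$, $Q=\mathbb{R}^{2n}\setminus\big((\mathbb{R}^n\setminus\Omega)\times(\mathbb{R}^n\setminus\Omega)\big)$; since $n>p\alpha$, it is a space of functions on $\mathbb{R}^n$ vanishing a.e. outside $\Omega$. $J_\mu(u)=\int_Q\frac{|u(x)-u(y)|^p}{|x-y|^{n+p\alpha}}dxdy-\mu\int_\Omega\frac{|u|^p}{|x|^{p\alpha}}dx$ for $u\in X_0$. The constraint $\int_\Omega V|u|^p\,dx=1$ includes the requirement that $V|u|^p$ be integrable on $\Omega$. Eigenfunctions: $u\in X_0\setminus\{0\}$ with $\int_\Omega|V||u|^p\,dx<\infty$ is an eigenfunction associated to the eigenvalue $\lambda\in\mathbb{R}$ if it solves $(-\Delta)_p^\alpha u-\mu\frac{|u|^{p-2}u}{|x|^{p\alpha}}=\lambda V|u|^{p-2}u$ in $\Omega$, $u=0$ in $\mathbb{R}^n\setminus\Omega$, in the distributional sense: for all $\varphi\in C_c^\infty(\Omega)$, $$\int_Q\frac{|u(x)-u(y)|^{p-2}(u(x)-u(y))(\varphi(x)-\varphi(y))}{|x-y|^{n+p\alpha}}dxdy-\mu\int_\Omega\frac{|u|^{p-2}u\varphi}{|x|^{p\alpha}}dx=\lambda\int_\Omega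 V|u|^{p-2}u\varphi\,dx.$$ *)

theory Defs
  imports "HOL-Analysis.Analysis"
begin

text \<open>
  The Euclidean space \<open>\<real>\<^sup>n\<close> is a type of class \<open>euclidean_space\<close>, with \<open>n = DIM('a)\<close>.  Functions
  are real valued and total; elements of function spaces are represented by Lebesgue measurable
  functions, and equality of such elements is equality almost everywhere.
  A function on \<open>\<Omega>\<close> is a total function whose values outside \<open>\<Omega>\<close> are never used.
\<close>

section \<open>Domains with Lipschitz boundary\<close>

text \<open>
  Near each boundary point, \<open>\<Omega>\<close> is the part of a ball lying strictly above the graph of a
  Lipschitz function \<open>g\<close> over the hyperplane orthogonal to some direction \<open>e\<close>; for unbounded
  \<open>\<Omega>\<close> no uniformity in the boundary point is required.
\<close>

definition lipschitz_boundary :: "'a::euclidean_space set \<Rightarrow> bool" where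
  "lipschitz_boundary \<Omega> \<longleftrightarrow>
     (\<forall>z\<in>frontier \<Omega>. \<exists>r>0. \<exists>e. norm e = 1 \<and>
        (\<exists>L g. L-lipschitz_on {y. y \<bullet> e = 0} g \<and>
           \<Omega> \<inter> ball z r = {x \<in> ball z r. x \<bullet> e > g (x - (x \<bullet> e) *\<^sub>R e)}))"

definition lipschitz_domain :: "'a::euclidean_space set \<Rightarrow> bool" where
  "lipschitz_domain \<Omega> \<longleftrightarrow> open \<Omega> \<and> connected \<Omega> \<and> \<Omega> \<noteq> {} \<and> lipschitz_boundary \<Omega>"

section \<open>Smooth functions with compact support\<close>

primrec C_k :: "nat \<Rightarrow> ('a::euclidean_space \<Rightarrow> real) \<Rightarrow> bool" where
  "C_k 0 f \<longleftrightarrow> continuous_on UNIV f"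
| "C_k (Suc k) f \<longleftrightarrow>
     (\<forall>x. f differentiable (at x)) \<and>
     (\<forall>b\<in>Basis. C_k k (\<lambda>x. frechet_derivative f (at x) b))"

text \<open>Elements of \<open>C_c_inf U\<close> are extended by zero to the whole space.\<close>

definition C_c_inf :: "'a::euclidean_space set \<Rightarrow> ('a \<Rightarrow> real) set" where
  "C_c_inf U = {f. (\<forall>k. C_k k f) \<and> compact (closure {x. f x \<noteq> 0}) \<and> closure {x. f x \<noteq> 0} \<subseteq> U}"

section \<open>The fractional Sobolev space\<close>

definition Q_set :: "'a set \<Rightarrow> ('a \<times> 'a) set" where
  "Q_set \<Omega> = UNIV - (UNIV - \<Omega>) \<times> (UNIV - \<Omega>)"

text \<open>
  The Bochner integrals below are \<open>0\<close> for non-integrable integrands, but on \<open>C_c_inf UNIV\<close>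
  and on \<open>X0 p \<alpha> \<Omega>\<close> the integrands are integrable (when \<open>0 < \<alpha> < 1 < p\<close> and \<open>DIM('a) > p * \<alpha>\<close>,
  in the second case by Fatou's lemma and the fractional Hardy inequality).
  The convention \<open>t / 0 = 0\<close> only affects the null sets \<open>x = y\<close> and \<open>x = 0\<close>.
\<close>

definition frac_energy :: "real \<Rightarrow> real \<Rightarrow> 'a::euclidean_space set \<Rightarrow> ('a \<Rightarrow> real) \<Rightarrow> real" where
  "frac_energy p \<alpha> \<Omega> u =
     (LINT (x, y):Q_set \<Omega>|lebesgue.
        \<bar>u x - u y\<bar> powr p / norm (x - y) powr (real DIM('a) + p * \<alpha>))"

definition hardy_integral :: "real \<Rightarrow> real \<Rightarrow> 'a::euclidean_space set \<Rightarrow> ('a \<Rightarrow> real) \<Rightarrow> real" where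
  "hardy_integral p \<alpha> \<Omega> u = (LINT x:\<Omega>|lebesgue. \<bar>u x\<bar> powr p / norm x powr (p * \<alpha>))"

definition X0_norm :: "real \<Rightarrow> real \<Rightarrow> 'a::euclidean_space set \<Rightarrow> ('a \<Rightarrow> real) \<Rightarrow> real" where
  "X0_norm p \<alpha> \<Omega> u = frac_energy p \<alpha> \<Omega> u powr (1 / p)"

definition X0_core :: "'a::euclidean_space set \<Rightarrow> ('a \<Rightarrow> real) set" where
  "X0_core \<Omega> = {\<phi> \<in> C_c_inf UNIV. \<forall>x. x \<notin> \<Omega> \<longrightarrow> \<phi> x = 0}"

text \<open>
  The completion of \<open>X0_core \<Omega>\<close>, realised as a space of functions: its elements are the
  almost everywhere limits of Cauchy sequences.  Since \<open>DIM('a) > p * \<alpha>\<close>, the fractional Sobolev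
  inequality makes every Cauchy sequence converge in \<open>L\<^sup>q\<close>, \<open>q = n p / (n - p \<alpha>)\<close>, hence a
  subsequence converges a.e., and the a.e. limit is zero if and only if the
  Cauchy sequence is a null sequence.
\<close>

definition X0 :: "real \<Rightarrow> real \<Rightarrow> 'a::euclidean_space set \<Rightarrow> ('a \<Rightarrow> real) set" where
  "X0 p \<alpha> \<Omega> =
     {u \<in> borel_measurable lebesgue.
        \<exists>\<phi>. (\<forall>k::nat. \<phi> k \<in> X0_core \<Omega>) \<and>
            (\<forall>\<epsilon>>0. \<exists>N. \<forall>j\<ge>N. \<forall>k\<ge>N. X0_norm p \<alpha> \<Omega> (\<lambda>x. \<phi> j x - \<phi> k x) < \<epsilon>) \<and>
            (AE x in lebesgue. (\<lambda>k. \<phi> k x) \<longlonglongrightarrow> u x)}"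

section \<open>The optimal constant in the fractional Hardy inequality\<close>

text \<open>The dimension enters through the type argument.\<close>

definition hardy_const :: "'a::euclidean_space itself \<Rightarrow> real \<Rightarrow> real \<Rightarrow> real" where
  "hardy_const (_ :: 'a itself) p \<alpha> =
     Sup {C. \<forall>u \<in> C_c_inf (UNIV :: 'a set).
               frac_energy p \<alpha> UNIV u \<ge> C * hardy_integral p \<alpha> UNIV u}"

section \<open>The assumption on the weight\<close>

definition L1_loc :: "'a::euclidean_space set \<Rightarrow> ('a \<Rightarrow> real) \<Rightarrow> bool" where
  "L1_loc \<Omega> V \<longleftrightarrow> (\<forall>K. compact K \<and> K \<subseteq> \<Omega> \<longrightarrow> set_integrable lebesgue K V)"

definition in_Lp :: "real \<Rightarrow> 'a::euclidean_space set \<Rightarrow> ('a \<Rightarrow> real) \<Rightarrow> bool" where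
  "in_Lp q \<Omega> f \<longleftrightarrow> set_borel_measurable lebesgue \<Omega> f \<and>
     set_integrable lebesgue \<Omega> (\<lambda>x. \<bar>f x\<bar> powr q)"

definition assumption_A :: "real \<Rightarrow> real \<Rightarrow> 'a::euclidean_space set \<Rightarrow> ('a \<Rightarrow> real) \<Rightarrow> bool" where
  "assumption_A p \<alpha> \<Omega> V \<longleftrightarrow>
     L1_loc \<Omega> V \<and>
     \<not> (AE x in lebesgue. x \<in> \<Omega> \<longrightarrow> max (V x) 0 = 0) \<and>
     (\<exists>V1 V2.
        (AE x in lebesgue. x \<in> \<Omega> \<longrightarrow> max (V x) 0 = V1 x + V2 x) \<and>
        in_Lp (real DIM('a) / (p * \<alpha>)) \<Omega> V1 \<and>
        (\<forall>y\<in>closure \<Omega>. ((\<lambda>x. norm (x - y) powr (p * \<alpha>) * V2 x) \<longlongrightarrow> 0) (at y within \<Omega>)) \<and>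
        ((\<lambda>x. norm x powr (p * \<alpha>) * V2 x) \<longlongrightarrow> 0) (inf at_infinity (principal \<Omega>)))"

section \<open>The functional, the first eigenvalue and eigenfunctions\<close>

definition J :: "real \<Rightarrow> real \<Rightarrow> real \<Rightarrow> 'a::euclidean_space set \<Rightarrow> ('a \<Rightarrow> real) \<Rightarrow> real" where
  "J p \<alpha> \<mu> \<Omega> u = frac_energy p \<alpha> \<Omega> u - \<mu> * hardy_integral p \<alpha> \<Omega> u"

text \<open>
  For \<open>\<mu> < hardy_const TYPE('a) p \<alpha>\<close> and \<open>V\<close> satisfying \<open>assumption_A\<close>, the infimum is over a
  nonempty set of nonnegative reals.
\<close>

definition lambda1 ::
    "real \<Rightarrow> real \<Rightarrow> real \<Rightarrow> 'a::euclidean_space set \<Rightarrow> ('a \<Rightarrow> real) \<Rightarrow> real" where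
  "lambda1 p \<alpha> \<mu> \<Omega> V =
     Inf {J p \<alpha> \<mu> \<Omega> u | u. u \<in> X0 p \<alpha> \<Omega> \<and>
            set_integrable lebesgue \<Omega> (\<lambda>x. V x * \<bar>u x\<bar> powr p) \<and>
            (LINT x:\<Omega>|lebesgue. V x * \<bar>u x\<bar> powr p) = 1}"

text \<open>
  Each integrand is integrable by Hoelder's inequality for \<open>u \<in> X0 p \<alpha> \<Omega>\<close> with
  \<open>V * \<bar>u\<bar> powr p\<close> integrable on \<open>\<Omega>\<close>, \<open>V\<close> locally integrable and \<open>\<phi>\<close> in \<open>C_c_inf \<Omega>\<close>.
\<close>

definition weak_solution ::
    "real \<Rightarrow> real \<Rightarrow> real \<Rightarrow> 'a::euclidean_space set \<Rightarrow> ('a \<Rightarrow> real) \<Rightarrow> real \<Rightarrow> ('a \<Rightarrow> real) \<Rightarrow> bool" where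
  "weak_solution p \<alpha> \<mu> \<Omega> V \<kappa> u \<longleftrightarrow>
     (\<forall>\<phi> \<in> C_c_inf \<Omega>.
        (LINT (x, y):Q_set \<Omega>|lebesgue.
           \<bar>u x - u y\<bar> powr (p - 2) * (u x - u y) * (\<phi> x - \<phi> y)
             / norm (x - y) powr (real DIM('a) + p * \<alpha>))
        - \<mu> * (LINT x:\<Omega>|lebesgue. \<bar>u x\<bar> powr (p - 2) * u x * \<phi> x / norm x powr (p * \<alpha>))
        = \<kappa> * (LINT x:\<Omega>|lebesgue. V x * \<bar>u x\<bar> powr (p - 2) * u x * \<phi> x))"

definition eigenfunction ::
    "real \<Rightarrow> real \<Rightarrow> real \<Rightarrow> 'a::euclidean_space set \<Rightarrow> ('a \<Rightarrow> real) \<Rightarrow> real \<Rightarrow> ('a \<Rightarrow> real) \<Rightarrow> bool" where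
  "eigenfunction p \<alpha> \<mu> \<Omega> V \<kappa> u \<longleftrightarrow>
     u \<in> X0 p \<alpha> \<Omega> \<and>
     \<not> (AE x in lebesgue. u x = 0) \<and>
     set_integrable lebesgue \<Omega> (\<lambda>x. \<bar>V x\<bar> * \<bar>u x\<bar> powr p) \<and>
     weak_solution p \<alpha> \<mu> \<Omega> V \<kappa> u"

end

theory Submission
  imports Defs
begin

text \<open>
  Let \<open>u\<close> and \<open>v\<close> be eigenfunctions for \<open>\<lambda>\<^sub>1\<close> and put \<open>w = (\<bar>u\<bar>\<^sup>p + \<bar>v\<bar>\<^sup>p)\<close> to the power \<open>1/p\<close>.  By
  Minkowski's inequality in the plane,
  \<open>\<bar>w x - w y\<bar>\<^sup>p \<le> \<bar>u x - u y\<bar>\<^sup>p + \<bar>v x - v y\<bar>\<^sup>p\<close>, strictly unless \<open>u x * v y = u y * v x\<close>, while the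
  Hardy term and the constraint are additive: \<open>\<bar>w\<bar>\<^sup>p = \<bar>u\<bar>\<^sup>p + \<bar>v\<bar>\<^sup>p\<close>.  Testing the equations with
  \<open>u\<close> and \<open>v\<close> gives \<open>J u + J v = \<lambda>\<^sub>1 \<integral> V \<bar>w\<bar>\<^sup>p \<le> J w\<close>, so equality holds for almost every pair
  \<open>(x, y)\<close> and \<open>u\<close>, \<open>v\<close> are proportional.  Neither a sign nor the positivity of \<open>u\<close> and \<open>v\<close> enters.
\<close>

text \<open>The delicate step is testing the equation with its own solution. Test functions are
  smooth with compact support in \<Omega>, whereas \<open>X0\<close> is built from functions that
  merely vanish outside \<Omega>, and V is only locally integrable with an arbitrary negative part.
  The approximants must have compact support in \<Omega>, converge in energy, and be dominated first
  by a bounded function of compact support and then by |u|. One principle drives the limits: a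
  sequence that converges a.e. and is dominated pointwise by sequences converging in L^p converges
  in L^p. It replaces compactness and embeddings, so that mainly Lipschitz bounds of scalar
  functions have to be computed. The comparison of J w with lambda1 must hold for either sign of the
  weighted integral: if it is not positive, lambda1 >= 0 is used, and this needs a competitor, since
  the infimum of the empty set says nothing. Finally, the relation between almost all pairs is read
  off at one point x with u x nonzero; v x is then nonzero too, and u x / v x is the factor.\<close>

section \<open>Smooth functions\<close>

lemma C_k_SucI:
  assumes "\<And>x. (f has_derivative f' x) (at x)" and "\<And>b. b \<in> Basis \<Longrightarrow> C_k k (\<lambda>x. f' x b)"
  shows "C_k (Suc k) f"
proof -
  have "frechet_derivative f (at x) = f' x" for x
    using assms(1) frechet_derivative_at by metis
  then show ?thesis using assms by (auto simp: differentiable_def)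
qed

lemma C_k_SucD:
  assumes "C_k (Suc k) f"
  shows "(f has_derivative frechet_derivative f (at x)) (at x)"
    and "b \<in> Basis \<Longrightarrow> C_k k (\<lambda>x. frechet_derivative f (at x) b)"
  using assms by (auto simp: frechet_derivative_works)

lemma C_k_Suc_imp: "C_k (Suc k) f \<Longrightarrow> C_k k f"
proof (induction k arbitrary: f)
  case 0
  then show ?case
    by (auto simp: continuous_on_eq_continuous_at intro: differentiable_imp_continuous_within)
next
  case (Suc k)
  then show ?case by (metis C_k.simps(2))
qed

lemma C_k_const: "C_k k (\<lambda>x. c)"
proof (induction k arbitrary: c)
  case (Suc k)
  show ?case by (rule C_k_SucI[where f' = "\<lambda>x h. 0"]) (auto intro: Suc)
qed auto

lemma C_k_add: "C_k k f \<Longrightarrow> C_k k g \<Longrightarrow> C_k k (\<lambda>x. f x + g x)"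
proof (induction k arbitrary: f g)
  case 0
  then show ?case by (auto intro!: continuous_intros)
next
  case (Suc k)
  note D = C_k_SucD[OF Suc.prems(1)] C_k_SucD[OF Suc.prems(2)]
  show ?case
    by (rule C_k_SucI, rule has_derivative_add[OF D(1) D(3)]) (auto intro: Suc.IH D)
qed

lemma C_k_mult: "C_k k f \<Longrightarrow> C_k k g \<Longrightarrow> C_k k (\<lambda>x. f x * g x)"
proof (induction k arbitrary: f g)
  case 0
  then show ?case by (auto intro!: continuous_intros)
next
  case (Suc k)
  note D = C_k_SucD[OF Suc.prems(1)] C_k_SucD[OF Suc.prems(2)]
  show ?case
    by (rule C_k_SucI, rule has_derivative_mult[OF D(1) D(3)])
      (auto intro!: C_k_add Suc.IH D Suc.prems[THEN C_k_Suc_imp])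
qed

lemma C_k_cmult: "C_k k f \<Longrightarrow> C_k k (\<lambda>x. c * f x)"
  using C_k_mult[OF C_k_const] .

lemma C_k_diff: "C_k k f \<Longrightarrow> C_k k g \<Longrightarrow> C_k k (\<lambda>x. f x - g x)"
  using C_k_add[of k f "\<lambda>x. (-1) * g x"] C_k_cmult[of k g "-1"] by simp

lemma C_k_power2: "C_k k f \<Longrightarrow> C_k k (\<lambda>x. (f x)\<^sup>2)"
  unfolding power2_eq_square by (rule C_k_mult)

lemma C_k_inner: "C_k k (\<lambda>x. x \<bullet> c)"
proof (induction k)
  case 0
  then show ?case by (auto intro!: continuous_intros)
next
  case (Suc k)
  show ?case
    by (rule C_k_SucI[where f' = "\<lambda>x h. h \<bullet> c"])
      (auto intro!: C_k_const bounded_linear_imp_has_derivative bounded_linear_inner_left)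
qed

lemma C_k_norm_diff_square: "C_k k (\<lambda>x. (x - c) \<bullet> (x - c))"
proof -
  have eq: "(x - c) \<bullet> (x - c) = (\<Sum>b\<in>Basis. (x \<bullet> b - c \<bullet> b)\<^sup>2)" for x
    by (subst euclidean_inner) (simp add: inner_diff_left power2_eq_square)
  have "finite A \<Longrightarrow> C_k k (\<lambda>x. \<Sum>b\<in>A. (x \<bullet> b - c \<bullet> b)\<^sup>2)" for A
    by (induction A rule: finite_induct)
      (auto intro!: C_k_const C_k_add C_k_power2 C_k_diff C_k_inner)
  then show ?thesis by (simp add: eq)
qed

text \<open>Differentiation lowers the exponent by one, so the induction generalises over q.\<close>

lemma C_k_powr:
  assumes "\<And>x. f x > 0" and "C_k k f"
  shows "C_k k (\<lambda>x. f x powr q)"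
  using assms(2)
proof (induction k arbitrary: q)
  case 0
  then show ?case using assms(1)
    by (auto intro!: continuous_intros simp: less_imp_neq[OF assms(1), symmetric])
next
  case (Suc k)
  note D = C_k_SucD[OF Suc.prems]
  have "((\<lambda>x. f x powr q) has_derivative (\<lambda>h. q * f x powr (q - 1) * frechet_derivative f (at x) h)) (at x)" for x
  proof -
    have "((\<lambda>t. t powr q) has_real_derivative q * f x powr (q - 1)) (at (f x))"
      using assms(1)[of x] by (rule has_real_derivative_powr)
    then have "((\<lambda>t. t powr q) has_derivative (*) (q * f x powr (q - 1))) (at (f x))"
      by (simp add: has_field_derivative_def)
    from has_derivative_compose[OF D(1) this] show ?thesis .
  qed
  then show ?case
    by (rule C_k_SucI) (auto intro!: C_k_mult C_k_const Suc.IH D Suc.prems[THEN C_k_Suc_imp])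
qed

section \<open>Functions vanishing to infinite order at the origin, and smooth truncations\<close>

definition flat :: "nat \<Rightarrow> real \<Rightarrow> real" where
  "flat m t = (if t > 0 then exp (- inverse t) * inverse t ^ m else 0)"

lemma flat_nonneg: "flat m t \<ge> 0"
  by (simp add: flat_def)

lemma flat_pos_iff: "flat m t > 0 \<longleftrightarrow> t > 0"
  by (simp add: flat_def)

text \<open>One term of the exponential series is bounded by the whole series, whose terms are
  nonnegative for x >= 0.\<close>

lemma exp_minus_power_le:
  assumes "x \<ge> (0::real)"
  shows "exp (- x) * x ^ m \<le> fact m"
proof -
  have "x ^ m / fact m \<le> exp x"
  proof -
    have "(\<Sum>n\<in>{m}. x ^ n /\<^sub>R fact n) \<le> (\<Sum>n. x ^ n /\<^sub>R fact n)"
      using assms exp_converges[of x] by (intro sum_le_suminf) (auto simp: sums_iff)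
    then show ?thesis using exp_converges[of x] by (simp add: sums_iff divide_inverse mult.commute)
  qed
  then show ?thesis by (simp add: exp_minus field_simps)
qed

lemma flat_le: "flat m t \<le> fact m"
  unfolding flat_def using exp_minus_power_le[of "inverse t" m] by auto

text \<open>Powers of t can be traded for the index. With j = 2 this shows the quadratic smallness
  at 0 that makes the derivative there vanish; with j = 1 it turns s * flat 2 s into flat 1
  s.\<close>

lemma flat_shift: "t \<ge> 0 \<Longrightarrow> flat m t = t ^ j * flat (m + j) t"
  by (auto simp: flat_def power_add field_simps)

text \<open>Differentiating exp (-1/t) produces powers of 1/t. Indexing by that power keeps the
  family closed under differentiation up to linear combinations, so one induction generalised over
  the index yields smoothness.\<close>

lemma DERIV_flat: "(flat m has_real_derivative flat (m + 2) t - real m * flat (m + 1) t) (at t)"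
proof -
  consider "t > 0" | "t < 0" | "t = 0" by linarith
  then show ?thesis
  proof cases
    case 1
    have "((\<lambda>t. exp (- inverse t) * inverse t ^ m) has_real_derivative
        exp (- inverse t) * (inverse t)\<^sup>2 * inverse t ^ m -
        exp (- inverse t) * (real m * (inverse t ^ (m - 1) * (inverse t)\<^sup>2))) (at t)"
      using 1 by (auto intro!: derivative_eq_intros simp: power2_eq_square algebra_simps)
    moreover have "exp (- inverse t) * (inverse t)\<^sup>2 * inverse t ^ m -
        exp (- inverse t) * (real m * (inverse t ^ (m - 1) * (inverse t)\<^sup>2))
      = flat (m + 2) t - real m * flat (m + 1) t"
    proof -
      \<comment> \<open>For m = 0 the truncated exponent m - 1 is harmless, because the factor
        \<open>real m\<close> vanishes.\<close>
      have "real m * (inverse t ^ (m - 1) * (inverse t)\<^sup>2) = real m * inverse t ^ (m + 1)"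
        by (cases m) (auto simp: power2_eq_square)
      then have "exp (- inverse t) * (real m * (inverse t ^ (m - 1) * (inverse t)\<^sup>2)) = real m * flat (m + 1) t"
        using 1 by (simp only: flat_def if_True mult.left_commute)
      moreover have "exp (- inverse t) * (inverse t)\<^sup>2 * inverse t ^ m = flat (m + 2) t"
        using 1 by (simp add: flat_def power2_eq_square)
      ultimately show ?thesis by simp
    qed
    ultimately have "((\<lambda>t. exp (- inverse t) * inverse t ^ m) has_real_derivative
        flat (m + 2) t - real m * flat (m + 1) t) (at t)" by simp
    then show ?thesis
      by (rule has_field_derivative_transform_within_open[where S = "{0<..}"])
        (use 1 in \<open>auto simp: flat_def\<close>)
  next
    case 2
    have "((\<lambda>t. 0) has_real_derivative flat (m + 2) t - real m * flat (m + 1) t) (at t)"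
      using 2 by (simp add: flat_def)
    then show ?thesis
      by (rule has_field_derivative_transform_within_open[where S = "{..<0}"])
        (use 2 in \<open>auto simp: flat_def\<close>)
  next
    case 3
    \<comment> \<open>For h > 0, flat m h = h^2 * flat (m + 2) h, so the difference quotient at 0 is
      at most C * |h|.\<close>
    define C :: real where "C = fact (m + 2)"
    have C: "C \<ge> 0" "flat (m + 2) h \<le> C" for h using flat_le[of "m + 2" h] by (auto simp: C_def)
    have b1: "\<bar>(flat m h - flat m 0) / h\<bar> \<le> C * \<bar>h\<bar>" for h
    proof (cases "h > 0")
      case True
      then have "\<bar>(flat m h - flat m 0) / h\<bar> = h * flat (m + 2) h"
        using flat_shift[of h m 2] flat_nonneg[of "m+2" h]
        by (simp add: flat_def[of _ 0] power2_eq_square)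
      then show ?thesis using True C(2)[of h] by (simp add: mult.commute)
    next
      case False
      then have "\<bar>(flat m h - flat m 0) / h\<bar> = 0" by (simp add: flat_def)
      also have "0 \<le> C * \<bar>h\<bar>" using C(1) by (intro mult_nonneg_nonneg) auto
      finally show ?thesis .
    qed
    have b2: "((\<lambda>h. C * \<bar>h\<bar>) \<longlongrightarrow> (0::real)) (at 0)"
      by (auto intro!: tendsto_eq_intros)
    have "((\<lambda>h. (flat m h - flat m 0) / h) \<longlongrightarrow> 0) (at 0)"
    proof (rule Lim_null_comparison[OF always_eventually b2], rule allI)
      show "norm ((flat m h - flat m 0) / h) \<le> C * \<bar>h\<bar>" for h
        using b1[of h] by (simp only: real_norm_def)
    qed
    moreover have "flat j 0 = 0" for j by (simp add: flat_def)
    ultimately show ?thesis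
      unfolding 3 has_field_derivative_iff by simp
  qed
qed

lemma C_k_flat:
  assumes "C_k k f"
  shows "C_k k (\<lambda>x. flat m (f x))"
  using assms
proof (induction k arbitrary: m)
  case 0
  have "continuous_on UNIV (flat m)"
    using DERIV_flat by (intro continuous_at_imp_continuous_on) (auto intro: DERIV_isCont)
  then show ?case using 0 continuous_on_compose2[of UNIV "flat m" UNIV f] by auto
next
  case (Suc k)
  note D = C_k_SucD[OF Suc.prems]
  have "((\<lambda>x. flat m (f x)) has_derivative
      (\<lambda>h. (flat (m + 2) (f x) - real m * flat (m + 1) (f x)) * frechet_derivative f (at x) h)) (at x)" for x
    using has_derivative_compose[OF D(1) DERIV_flat[unfolded has_field_derivative_def]] .
  then show ?case
    by (rule C_k_SucI)
      (auto intro!: C_k_mult C_k_diff C_k_const Suc.IH D Suc.prems[THEN C_k_Suc_imp])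
qed

lemma flat_0_le_1: "flat 0 t \<le> 1"
  using flat_le[of 0 t] by simp

text \<open>Vanishing near \<open>0\<close> turns functions that are zero outside \<open>\<Omega>\<close> into functions with
  compact support in \<open>\<Omega>\<close>; the Lipschitz constant does not depend on \<open>N\<close>.\<close>

definition cutoff :: "real \<Rightarrow> real \<Rightarrow> real" where
  "cutoff N t = t * flat 0 (N\<^sup>2 * t\<^sup>2 - 1)"

lemma abs_cutoff_le: "\<bar>cutoff N t\<bar> \<le> \<bar>t\<bar>"
  unfolding cutoff_def abs_mult using flat_0_le_1 flat_nonneg[of 0]
  by (simp add: mult_left_le)

lemma cutoff_eq_0: "N \<ge> 0 \<Longrightarrow> N * \<bar>t\<bar> \<le> 1 \<Longrightarrow> cutoff N t = 0"
  using power_mono[of "N * \<bar>t\<bar>" 1 2] by (simp add: cutoff_def flat_def power_mult_distrib)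

lemma C_k_cutoff: "C_k k f \<Longrightarrow> C_k k (\<lambda>x. cutoff N (f x))"
  unfolding cutoff_def by (intro C_k_mult C_k_flat C_k_diff C_k_const C_k_power2)

text \<open>The derivative depends on N and t only through s = N^2 t^2 - 1, hence the uniform bound.
  It equals flat 0 s + 2 s flat 2 s + 2 flat 2 s, and flat 0 <= 1, s flat 2 s <= 1, flat 2 <= 2 give
  7 = 1 + 2 + 4.\<close>

lemma cutoff_lipschitz: "\<bar>cutoff N s - cutoff N t\<bar> \<le> 7 * \<bar>s - t\<bar>"
proof -
  define D where "D t = flat 0 (N\<^sup>2 * t\<^sup>2 - 1) + t * (flat 2 (N\<^sup>2 * t\<^sup>2 - 1) * (N\<^sup>2 * (2 * t)))" for t
  have der: "(cutoff N has_real_derivative D t) (at t)" for t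
  proof -
    have "((\<lambda>t. flat 0 (N\<^sup>2 * t\<^sup>2 - 1)) has_real_derivative
        flat 2 (N\<^sup>2 * t\<^sup>2 - 1) * (N\<^sup>2 * (2 * t))) (at t)"
    proof (rule DERIV_chain2[where f = "flat 0"])
      show "(flat 0 has_real_derivative flat 2 (N\<^sup>2 * t\<^sup>2 - 1)) (at (N\<^sup>2 * t\<^sup>2 - 1))"
        using DERIV_flat[of 0 "N\<^sup>2 * t\<^sup>2 - 1"] by (simp add: numeral_2_eq_2)
    qed (auto intro!: derivative_eq_intros)
    from DERIV_mult[OF DERIV_ident this] show ?thesis
      by (simp add: cutoff_def[abs_def] D_def mult.commute add.commute)
  qed
  have bnd: "\<bar>D t\<bar> \<le> 7" for t
  proof -
    define s where "s = N\<^sup>2 * t\<^sup>2 - 1"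
    have "D t = flat 0 s + 2 * (s * flat 2 s) + 2 * flat 2 s"
      by (simp add: D_def s_def algebra_simps power2_eq_square)
    moreover have "0 \<le> s * flat 2 s \<and> s * flat 2 s \<le> 1"
    proof (cases "s > 0")
      case True
      then have "s * flat 2 s = flat 1 s" using flat_shift[of s 1 1] by (simp add: numeral_2_eq_2)
      then show ?thesis using flat_nonneg[of 1 s] flat_le[of 1 s] by simp
    qed (simp add: flat_def)
    ultimately show ?thesis
      using flat_nonneg[of 0 s] flat_nonneg[of 2 s] flat_0_le_1[of s] flat_le[of 2 s]
      by (simp add: numeral_2_eq_2)
  qed
  have "norm (cutoff N s - cutoff N t) \<le> 7 * norm (s - t)"
    by (rule field_differentiable_bound[of UNIV "cutoff N" D])
      (use der bnd in auto)
  then show ?thesis by simp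
qed

text \<open>At t = 0 the bound |cutoff N s| <= |s| suffices. Otherwise the argument of
  \<open>flat 0\<close> tends to infinity, where exp (-1/s) tends to 1.\<close>

lemma cutoff_tendsto:
  assumes "f \<longlonglongrightarrow> t"
  shows "(\<lambda>k. cutoff (real (Suc k)) (f k)) \<longlonglongrightarrow> t"
proof (cases "t = 0")
  case True
  show ?thesis
    unfolding True by (rule Lim_null_comparison[of _ "\<lambda>k. \<bar>f k\<bar>"])
      (use tendsto_rabs[OF assms] abs_cutoff_le True in \<open>auto intro!: always_eventually\<close>)
next
  case False
  have f2: "(\<lambda>k. (f k)\<^sup>2) \<longlonglongrightarrow> t\<^sup>2" by (intro tendsto_intros assms)
  have N2: "filterlim (\<lambda>k. (real (Suc k))\<^sup>2) at_top sequentially"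
    by (intro filterlim_pow_at_top filterlim_compose[OF filterlim_real_sequentially filterlim_Suc]) auto
  have "filterlim (\<lambda>k. (f k)\<^sup>2 * (real (Suc k))\<^sup>2) at_top sequentially"
    using False by (intro filterlim_tendsto_pos_mult_at_top[OF f2 _ N2]) auto
  then have lim: "filterlim (\<lambda>k. - 1 + (real (Suc k))\<^sup>2 * (f k)\<^sup>2) at_top sequentially"
    by (intro filterlim_tendsto_add_at_top[OF tendsto_const]) (simp add: mult.commute)
  have "(\<lambda>k. exp (- inverse (- 1 + (real (Suc k))\<^sup>2 * (f k)\<^sup>2))) \<longlonglongrightarrow> exp (- 0)"
    by (intro tendsto_intros filterlim_compose[OF tendsto_inverse_0 filterlim_at_top_imp_at_infinity[OF lim]])
  moreover have "eventually (\<lambda>k. exp (- inverse (- 1 + (real (Suc k))\<^sup>2 * (f k)\<^sup>2)) =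
      flat 0 ((real (Suc k))\<^sup>2 * (f k)\<^sup>2 - 1)) sequentially"
    using lim[unfolded filterlim_at_top_dense, rule_format, of 0]
    by eventually_elim (auto simp: flat_def)
  ultimately have "(\<lambda>k. flat 0 ((real (Suc k))\<^sup>2 * (f k)\<^sup>2 - 1)) \<longlonglongrightarrow> 1"
    by (simp add: tendsto_cong)
  from tendsto_mult[OF assms this] show ?thesis by (simp add: cutoff_def)
qed

text \<open>
  With \<open>a\<close> a cut-off of an approximant \<open>\<phi> k\<close> and \<open>b\<close> a further approximant \<open>\<phi> j\<close> of a solution
  \<open>u\<close>, this gives test functions.  It is homogeneous of degree one up to \<open>\<delta>\<close>, hence
  Lipschitz uniformly in \<open>\<delta>\<close>; it is bounded by \<open>\<bar>b\<bar>\<close>, which is what the weight \<open>V\<close> (only locally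
  integrable) requires; and it tends to \<open>u / 2\<close> when \<open>a\<close> and \<open>b\<close> tend to \<open>u\<close> and \<open>\<delta>\<close> to \<open>0\<close>.
\<close>

definition damp :: "real \<Rightarrow> real \<Rightarrow> real \<Rightarrow> real" where
  "damp \<delta> a b = a\<^sup>2 * b / (a\<^sup>2 + b\<^sup>2 + \<delta>)"

lemma abs_damp_le1:
  assumes "\<delta> > 0" shows "\<bar>damp \<delta> a b\<bar> \<le> \<bar>a\<bar>"
proof -
  have "2 * (\<bar>a\<bar> * \<bar>b\<bar>) \<le> a\<^sup>2 + b\<^sup>2"
    using sum_squares_bound[of "\<bar>a\<bar>" "\<bar>b\<bar>"] by simp
  then have "\<bar>a\<bar> * \<bar>b\<bar> \<le> a\<^sup>2 + b\<^sup>2 + \<delta>" using assms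
    using mult_nonneg_nonneg[of "\<bar>a\<bar>" "\<bar>b\<bar>"] by linarith
  then have "\<bar>a\<bar> * (\<bar>a\<bar> * \<bar>b\<bar>) \<le> \<bar>a\<bar> * (a\<^sup>2 + b\<^sup>2 + \<delta>)" by (intro mult_left_mono) auto
  moreover have "a\<^sup>2 + b\<^sup>2 + \<delta> > 0" using assms by (simp add: add_nonneg_pos)
  ultimately show ?thesis unfolding damp_def
    by (simp add: abs_mult field_simps power2_eq_square)
qed

lemma abs_damp_le2:
  assumes "\<delta> > 0" shows "\<bar>damp \<delta> a b\<bar> \<le> \<bar>b\<bar>"
proof -
  have *: "a\<^sup>2 + b\<^sup>2 + \<delta> > 0" using assms by (simp add: add_nonneg_pos)
  have "a\<^sup>2 * \<bar>b\<bar> \<le> (a\<^sup>2 + b\<^sup>2 + \<delta>) * \<bar>b\<bar>" using assms by (intro mult_right_mono) auto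
  then show ?thesis unfolding damp_def using * by (simp add: abs_mult field_simps)
qed

text \<open>One argument moves at a time. Over the common denominator the increment a - a' or b - b'
  factors out, and the inequality 2xy <= x^2 + y^2 bounds the cofactor by the product of the two
  denominators. The bound is therefore uniform in \<delta>.\<close>

lemma damp_lipschitz:
  assumes "\<delta> > 0"
  shows "\<bar>damp \<delta> a b - damp \<delta> a' b'\<bar> \<le> \<bar>a - a'\<bar> + \<bar>b - b'\<bar>"
proof -
  have pos: "a\<^sup>2 + b\<^sup>2 + \<delta> > 0" for a b :: real using assms by (simp add: add_nonneg_pos)
  have frac: "\<bar>x * y / Z\<bar> \<le> \<bar>x\<bar>" if "Z > 0" "\<bar>y\<bar> \<le> Z" for x y Z :: real
    using that by (simp add: abs_mult pos_divide_le_eq mult_left_mono)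
  have "\<bar>damp \<delta> a b - damp \<delta> a' b\<bar> \<le> \<bar>a - a'\<bar>"
  proof -
    have "a\<^sup>2 * b * (a'\<^sup>2 + b\<^sup>2 + \<delta>) - a'\<^sup>2 * b * (a\<^sup>2 + b\<^sup>2 + \<delta>) =
        (a - a') * ((b * a + b * a') * (b\<^sup>2 + \<delta>))"
      by algebra
    moreover have "damp \<delta> a b - damp \<delta> a' b = (a\<^sup>2 * b * (a'\<^sup>2 + b\<^sup>2 + \<delta>) - a'\<^sup>2 * b * (a\<^sup>2 + b\<^sup>2 + \<delta>)) /
        ((a\<^sup>2 + b\<^sup>2 + \<delta>) * (a'\<^sup>2 + b\<^sup>2 + \<delta>))"
      unfolding damp_def by (rule diff_frac_eq) (use pos[of a b] pos[of a' b] in auto)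
    moreover have "\<bar>(b * a + b * a') * (b\<^sup>2 + \<delta>)\<bar> \<le> (a\<^sup>2 + b\<^sup>2 + \<delta>) * (a'\<^sup>2 + b\<^sup>2 + \<delta>)"
    proof -
      define E where "E = b\<^sup>2 + \<delta>"
      have E: "E > 0" using pos[of 0 b] by (simp add: E_def)
      have double: "2 * x \<le> (2 * y) * E + (2 * z) * E" if "x \<le> (y + z) * E" for x y z
        using that by (simp add: algebra_simps)
      have half: "(2 * \<bar>b * t\<bar>) * E \<le> (t\<^sup>2 + E) * E" for t
        using sum_squares_bound[of "\<bar>b\<bar>" "\<bar>t\<bar>"] assms E
        by (intro mult_right_mono) (auto simp: E_def abs_mult)
      have "\<bar>(b * a + b * a') * E\<bar> = \<bar>b * a + b * a'\<bar> * E" using E by (simp only: abs_mult abs_of_pos)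
      also have "\<dots> \<le> (\<bar>b * a\<bar> + \<bar>b * a'\<bar>) * E"
        using E by (intro mult_right_mono abs_triangle_ineq) auto
      finally have "2 * \<bar>(b * a + b * a') * E\<bar> \<le> (2 * \<bar>b * a\<bar>) * E + (2 * \<bar>b * a'\<bar>) * E"
        by (rule double)
      also have "\<dots> \<le> (a\<^sup>2 + E) * E + (a'\<^sup>2 + E) * E"
        by (intro add_mono half)
      also have "\<dots> \<le> (a\<^sup>2 + E) * (a'\<^sup>2 + E) + (a'\<^sup>2 + E) * (a\<^sup>2 + E)"
        using E by (intro add_mono mult_left_mono) auto
      also have "\<dots> = 2 * ((a\<^sup>2 + E) * (a'\<^sup>2 + E))" by algebra
      finally have "\<bar>(b * a + b * a') * E\<bar> \<le> (a\<^sup>2 + E) * (a'\<^sup>2 + E)"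
        by (rule mult_left_le_imp_le) simp
      then show ?thesis by (simp only: E_def add.assoc)
    qed
    ultimately show ?thesis using frac[OF mult_pos_pos[OF pos pos]] by (simp only:)
  qed
  moreover have "\<bar>damp \<delta> a' b - damp \<delta> a' b'\<bar> \<le> \<bar>b - b'\<bar>"
  proof -
    have "a'\<^sup>2 * b * (a'\<^sup>2 + b'\<^sup>2 + \<delta>) - a'\<^sup>2 * b' * (a'\<^sup>2 + b\<^sup>2 + \<delta>) =
        (b - b') * (a'\<^sup>2 * (a'\<^sup>2 + \<delta> - b * b'))"
      by algebra
    moreover have "damp \<delta> a' b - damp \<delta> a' b' = (a'\<^sup>2 * b * (a'\<^sup>2 + b'\<^sup>2 + \<delta>) - a'\<^sup>2 * b' * (a'\<^sup>2 + b\<^sup>2 + \<delta>)) /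
        ((a'\<^sup>2 + b\<^sup>2 + \<delta>) * (a'\<^sup>2 + b'\<^sup>2 + \<delta>))"
      unfolding damp_def by (rule diff_frac_eq) (use pos[of a' b] pos[of a' b'] in auto)
    moreover have "\<bar>a'\<^sup>2 * (a'\<^sup>2 + \<delta> - b * b')\<bar> \<le> (a'\<^sup>2 + b\<^sup>2 + \<delta>) * (a'\<^sup>2 + b'\<^sup>2 + \<delta>)"
    proof -
      define A where "A = a'\<^sup>2 + \<delta>"
      have A: "A > 0" "a'\<^sup>2 \<le> A" using pos[of a' 0] assms by (auto simp: A_def)
      have m: "\<bar>A - b * b'\<bar> \<le> A + (b\<^sup>2 + b'\<^sup>2)"
      proof -
        have "2 * (b * b') \<le> b\<^sup>2 + b'\<^sup>2" using sum_squares_bound[of b b'] by (simp only: mult.assoc)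
        moreover have "2 * (- b * b') \<le> b\<^sup>2 + b'\<^sup>2" using sum_squares_bound[of "- b" b'] by (simp add: mult.assoc)
        moreover have "b\<^sup>2 \<ge> 0" "b'\<^sup>2 \<ge> 0" by auto
        ultimately show ?thesis using A(1) unfolding abs_le_iff by (intro conjI) linarith+
      qed
      have "\<bar>a'\<^sup>2 * (A - b * b')\<bar> = a'\<^sup>2 * \<bar>A - b * b'\<bar>" by (simp only: abs_mult abs_power2)
      also have "\<dots> \<le> A * (A + (b\<^sup>2 + b'\<^sup>2))"
        using A m by (intro mult_mono) auto
      also have "\<dots> \<le> A * (A + (b\<^sup>2 + b'\<^sup>2)) + b\<^sup>2 * b'\<^sup>2" by simp
      also have "\<dots> = (A + b\<^sup>2) * (A + b'\<^sup>2)" by algebra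
      finally show ?thesis by (simp only: A_def add_ac)
    qed
    ultimately show ?thesis using frac[OF mult_pos_pos[OF pos pos]] by (simp only:)
  qed
  ultimately show ?thesis by linarith
qed

lemma C_k_inverse:
  assumes "\<And>x. f x > 0" and "C_k k f"
  shows "C_k k (\<lambda>x. inverse (f x))"
  using C_k_powr[OF assms, of "-1"] by (simp add: powr_minus assms(1) less_imp_le)

lemma C_k_damp:
  assumes "\<delta> > 0" "C_k k f" "C_k k g"
  shows "C_k k (\<lambda>x. damp \<delta> (f x) (g x))"
  unfolding damp_def divide_inverse
  using assms by (intro C_k_mult C_k_inverse C_k_add C_k_power2 C_k_const)
    (auto intro!: add_nonneg_pos)

section \<open>Convergence in mean\<close>

text \<open>The majorant g + r i varies with i, but its varying part vanishes in mean. Clipping F i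
  to [-g, g] gives a sequence for ordinary dominated convergence, and the part cut away is at most r
  i.\<close>

lemma integral_tendsto_dominated_perturbation:
  fixes f :: "'b \<Rightarrow> real" and F r :: "nat \<Rightarrow> 'b \<Rightarrow> real"
  assumes [measurable]: "f \<in> borel_measurable M" "\<And>i. F i \<in> borel_measurable M"
    and g: "integrable M g" and r: "\<And>i. integrable M (r i)"
    and r0: "(\<lambda>i. \<integral>x. r i x \<partial>M) \<longlonglongrightarrow> 0"
    and lim: "AE x in M. (\<lambda>i. F i x) \<longlonglongrightarrow> f x" and rlim: "AE x in M. (\<lambda>i. r i x) \<longlonglongrightarrow> 0"
    and bound: "\<And>i. AE x in M. \<bar>F i x\<bar> \<le> g x + r i x"
    and nonneg: "\<And>x. g x \<ge> 0" "\<And>i x. r i x \<ge> 0"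
  shows "integrable M f" and "\<And>i. integrable M (F i)"
    and "(\<lambda>i. \<integral>x. F i x \<partial>M) \<longlonglongrightarrow> (\<integral>x. f x \<partial>M)"
proof -
  have [measurable]: "g \<in> borel_measurable M" "\<And>i. r i \<in> borel_measurable M" using g r by auto
  define c where "c i x = max (- g x) (min (g x) (F i x))" for i x
  have [measurable]: "\<And>i. c i \<in> borel_measurable M" unfolding c_def by measurable
  have AEb: "AE x in M. \<forall>i. \<bar>F i x\<bar> \<le> g x + r i x" using bound by (simp add: AE_all_countable)
  \<comment> \<open>In the limit r drops out of the bound, so clipping to [-g, g] leaves f
    unchanged.\<close>
  have fg: "AE x in M. \<bar>f x\<bar> \<le> g x" using AEb lim rlim
  proof eventually_elim
    case (elim x)
    have "(\<lambda>i. g x + r i x) \<longlonglongrightarrow> g x + 0" using elim by (intro tendsto_intros)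
    moreover have "(\<lambda>i. \<bar>F i x\<bar>) \<longlonglongrightarrow> \<bar>f x\<bar>" using elim by (intro tendsto_intros)
    ultimately show ?case using elim(1) by (intro LIMSEQ_le[of "\<lambda>i. \<bar>F i x\<bar>"]) auto
  qed
  show intf: "integrable M f"
    using fg by (intro Bochner_Integration.integrable_bound[OF g]) (auto elim!: eventually_mono)
  show intF: "integrable M (F i)" for i
    using bound[of i]
    by (intro Bochner_Integration.integrable_bound[OF Bochner_Integration.integrable_add[OF g r[of i]]])
      (auto elim!: eventually_mono)
  have cb: "\<bar>c i x\<bar> \<le> g x" for i x using nonneg(1)[of x] by (auto simp: c_def)
  have intc: "integrable M (c i)" for i
    by (intro Bochner_Integration.integrable_bound[OF g])
      (auto intro!: always_eventually order_trans[OF cb abs_ge_self])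
  have clim: "AE x in M. (\<lambda>i. c i x) \<longlonglongrightarrow> f x" using lim fg
  proof eventually_elim
    case (elim x)
    have "(\<lambda>i. c i x) \<longlonglongrightarrow> max (- g x) (min (g x) (f x))"
      unfolding c_def using elim by (intro tendsto_intros)
    then show ?case using elim by (simp add: min_def max_def abs_le_iff split: if_splits)
  qed
  have c: "(\<lambda>i. \<integral>x. c i x \<partial>M) \<longlonglongrightarrow> (\<integral>x. f x \<partial>M)"
    by (rule integral_dominated_convergence[OF _ _ g clim]) (use cb in auto)
  have "(\<lambda>i. \<integral>x. F i x - c i x \<partial>M) \<longlonglongrightarrow> 0"
  proof (rule Lim_null_comparison[OF always_eventually r0], intro allI)
    fix i
    have "\<bar>\<integral>x. F i x - c i x \<partial>M\<bar> \<le> (\<integral>x. \<bar>F i x - c i x\<bar> \<partial>M)" by (rule integral_abs_bound)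
    also have "\<dots> \<le> (\<integral>x. r i x \<partial>M)"
    proof (rule integral_mono_AE)
      show "AE x in M. \<bar>F i x - c i x\<bar> \<le> r i x" using bound[of i]
      proof eventually_elim
        case (elim x)
        then show ?case using nonneg(1)[of x] nonneg(2)[of i x] unfolding c_def by linarith
      qed
    qed (use intF[of i] intc[of i] r[of i] in auto)
    finally show "norm (\<integral>x. F i x - c i x \<partial>M) \<le> (\<integral>x. r i x \<partial>M)" by simp
  qed
  from tendsto_add[OF this c] show "(\<lambda>i. \<integral>x. F i x \<partial>M) \<longlonglongrightarrow> (\<integral>x. f x \<partial>M)"
    using intF intc by simp
qed

section \<open>Power inequalities and L^p convergence\<close>

lemma powr_add_le:
  assumes "x \<ge> 0" "y \<ge> 0" "p \<ge> (0::real)"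
  shows "(x + y) powr p \<le> 2 powr p * (x powr p + y powr p)"
proof -
  have "(x + y) powr p \<le> (2 * max x y) powr p" using assms by (intro powr_mono2) auto
  also have "\<dots> = 2 powr p * max x y powr p" using assms by (subst powr_mult) auto
  also have "\<dots> \<le> 2 powr p * (x powr p + y powr p)" by (intro mult_left_mono) (auto simp: max_def)
  finally show ?thesis .
qed

lemma powr_tendsto_0:
  assumes "(\<lambda>i. a i - b) \<longlonglongrightarrow> (0::real)" "p > 0"
  shows "(\<lambda>i. \<bar>a i - b\<bar> powr p) \<longlonglongrightarrow> 0"
  using tendsto_rabs[OF assms(1)] assms(2)
  by (intro tendsto_zero_powrI) (auto intro!: tendsto_eq_intros)

text \<open>Either b <= \<eta> a or a <= b / \<eta>, and each case yields one summand. The free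
  \<eta> makes the first term small against a fixed quantity while the second carries a quantity
  tending to 0; this does the work of Hoelder's inequality.\<close>

lemma young_scaled:
  assumes "a \<ge> 0" "b \<ge> 0" "\<eta> > 0" "p \<ge> (1::real)"
  shows "a powr (p - 1) * b \<le> \<eta> * a powr p + \<eta> powr (1 - p) * b powr p"
proof (cases "b \<le> \<eta> * a")
  case True
  have "a powr (p - 1) * b \<le> a powr (p - 1) * (\<eta> * a)" using True by (intro mult_left_mono) auto
  also have "\<dots> = \<eta> * a powr p" using assms by (cases "a = 0") (auto simp: powr_diff)
  also have "\<dots> \<le> \<eta> * a powr p + \<eta> powr (1 - p) * b powr p" by simp
  finally show ?thesis .
next
  case False
  then have "a \<le> b / \<eta>" using assms by (simp add: field_simps)
  then have "a powr (p - 1) \<le> (b / \<eta>) powr (p - 1)" using assms by (intro powr_mono2) auto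
  then have "a powr (p - 1) * b \<le> (b / \<eta>) powr (p - 1) * b" using assms by (intro mult_right_mono) auto
  also have "\<dots> = \<eta> powr (1 - p) * b powr p"
    using assms by (cases "b = 0") (auto simp: powr_divide powr_diff field_simps)
  also have "\<dots> \<le> \<eta> * a powr p + \<eta> powr (1 - p) * b powr p" using assms by simp
  finally show ?thesis .
qed

text \<open>Convergence in L^p is combined with convergence a.e., so no subsequences have to be
  extracted later. Integrability is included because the Bochner integral of a non-integrable
  function is 0, which would make the last clause empty.\<close>

definition Lp_tendsto :: "real \<Rightarrow> 'b measure \<Rightarrow> (nat \<Rightarrow> 'b \<Rightarrow> real) \<Rightarrow> ('b \<Rightarrow> real) \<Rightarrow> bool" where
  "Lp_tendsto p M a \<alpha> \<longleftrightarrow>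
     \<alpha> \<in> borel_measurable M \<and> (\<forall>i. a i \<in> borel_measurable M) \<and>
     integrable M (\<lambda>x. \<bar>\<alpha> x\<bar> powr p) \<and> (\<forall>i. integrable M (\<lambda>x. \<bar>a i x - \<alpha> x\<bar> powr p)) \<and>
     (AE x in M. (\<lambda>i. a i x) \<longlonglongrightarrow> \<alpha> x) \<and> (\<lambda>i. \<integral>x. \<bar>a i x - \<alpha> x\<bar> powr p \<partial>M) \<longlonglongrightarrow> 0"

lemma Lp_tendsto_const:
  assumes "\<alpha> \<in> borel_measurable M" "integrable M (\<lambda>x. \<bar>\<alpha> x\<bar> powr p)"
  shows "Lp_tendsto p M (\<lambda>i. \<alpha>) \<alpha>"
  using assms by (simp add: Lp_tendsto_def)

lemma integrable_powr_add:
  fixes \<alpha> \<beta> :: "'b \<Rightarrow> real"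
  assumes "\<alpha> \<in> borel_measurable M" "\<beta> \<in> borel_measurable M" "p \<ge> 0"
    and "integrable M (\<lambda>x. \<bar>\<alpha> x\<bar> powr p)" "integrable M (\<lambda>x. \<bar>\<beta> x\<bar> powr p)"
  shows "integrable M (\<lambda>x. \<bar>\<alpha> x + \<beta> x\<bar> powr p)"
proof (rule Bochner_Integration.integrable_bound)
  show "integrable M (\<lambda>x. 2 powr p * (\<bar>\<alpha> x\<bar> powr p + \<bar>\<beta> x\<bar> powr p))"
    using assms by simp
  have "\<bar>s + t\<bar> powr p \<le> 2 powr p * (\<bar>s\<bar> powr p + \<bar>t\<bar> powr p)" for s t :: real
  proof -
    have "\<bar>s + t\<bar> powr p \<le> (\<bar>s\<bar> + \<bar>t\<bar>) powr p" using assms(3) by (intro powr_mono2) auto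
    also have "\<dots> \<le> 2 powr p * (\<bar>s\<bar> powr p + \<bar>t\<bar> powr p)" using assms(3) by (intro powr_add_le) auto
    finally show ?thesis .
  qed
  then show "AE x in M. norm (\<bar>\<alpha> x + \<beta> x\<bar> powr p) \<le> norm (2 powr p * (\<bar>\<alpha> x\<bar> powr p + \<bar>\<beta> x\<bar> powr p))"
    by auto
qed (use assms in measurable)

text \<open>The bound |a|^p <= 2^p |\<alpha>|^p + 2^p |a - \<alpha>|^p consists of a fixed majorant
  and a part that vanishes in mean.\<close>

lemma Lp_tendsto_integral:
  assumes "Lp_tendsto p M a \<alpha>" "p > 0"
  shows "integrable M (\<lambda>x. \<bar>a i x\<bar> powr p)"
    and "(\<lambda>i. \<integral>x. \<bar>a i x\<bar> powr p \<partial>M) \<longlonglongrightarrow> (\<integral>x. \<bar>\<alpha> x\<bar> powr p \<partial>M)"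
proof -
  note A = assms(1)[unfolded Lp_tendsto_def]
  have [measurable]: "\<alpha> \<in> borel_measurable M" "\<And>i. a i \<in> borel_measurable M" using A by auto
  note * = integral_tendsto_dominated_perturbation[where M = M and F = "\<lambda>i x. \<bar>a i x\<bar> powr p" and f = "\<lambda>x. \<bar>\<alpha> x\<bar> powr p"
      and g = "\<lambda>x. 2 powr p * \<bar>\<alpha> x\<bar> powr p" and r = "\<lambda>i x. 2 powr p * \<bar>a i x - \<alpha> x\<bar> powr p"]
  have b: "\<bar>\<bar>s\<bar> powr p\<bar> \<le> 2 powr p * \<bar>t\<bar> powr p + 2 powr p * \<bar>s - t\<bar> powr p" for s t :: real
  proof -
    have "\<bar>s\<bar> powr p \<le> (\<bar>t\<bar> + \<bar>s - t\<bar>) powr p" using assms(2) by (intro powr_mono2) auto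
    also have "\<dots> \<le> 2 powr p * (\<bar>t\<bar> powr p + \<bar>s - t\<bar> powr p)" using assms(2) by (intro powr_add_le) auto
    finally show ?thesis by (simp add: distrib_left)
  qed
  have l1: "AE x in M. (\<lambda>i. \<bar>a i x\<bar> powr p) \<longlonglongrightarrow> \<bar>\<alpha> x\<bar> powr p"
    using A assms(2) by (auto elim!: eventually_mono intro!: tendsto_powr' tendsto_intros)
  have l2: "AE x in M. (\<lambda>i. 2 powr p * \<bar>a i x - \<alpha> x\<bar> powr p) \<longlonglongrightarrow> 0"
    using A assms(2)
    by (auto elim!: eventually_mono intro!: tendsto_mult_right_zero powr_tendsto_0 simp: LIM_zero_iff)
  have l3: "(\<lambda>i. \<integral>x. 2 powr p * \<bar>a i x - \<alpha> x\<bar> powr p \<partial>M) \<longlonglongrightarrow> 0"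
    using A by (auto intro!: tendsto_mult_right_zero)
  show "integrable M (\<lambda>x. \<bar>a i x\<bar> powr p)"
    by (rule *(2)) (use A b l1 l2 l3 in auto)
  show "(\<lambda>i. \<integral>x. \<bar>a i x\<bar> powr p \<partial>M) \<longlonglongrightarrow> (\<integral>x. \<bar>\<alpha> x\<bar> powr p \<partial>M)"
    by (rule *(3)) (use A b l1 l2 l3 in auto)
qed

text \<open>The factor 8 is 2 * 2 * 2: one 2 from replacing a, a' by b, b' plus increments, and two
  from splitting the power of a sum of four terms by \<open>powr_add_le\<close>.\<close>

lemma powr_abs_diff_le:
  fixes s t a a' b b' :: real
  assumes "\<bar>s\<bar> \<le> c * (\<bar>a\<bar> + \<bar>a'\<bar>)" "\<bar>t\<bar> \<le> c * (\<bar>b\<bar> + \<bar>b'\<bar>)" "c \<ge> 0" "p > 0"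
  shows "\<bar>s - t\<bar> powr p \<le> (8 * c) powr p * (\<bar>b\<bar> powr p + \<bar>b'\<bar> powr p) +
     (8 * c) powr p * (\<bar>a - b\<bar> powr p + \<bar>a' - b'\<bar> powr p)"
proof -
  have gen: "r powr p \<le> (8 * c) powr p * (s1 powr p + s2 powr p) + (8 * c) powr p * (s3 powr p + s4 powr p)"
    if "r \<le> 2 * c * (s1 + s2 + s3 + s4)" "s1 \<ge> 0" "s2 \<ge> 0" "s3 \<ge> 0" "s4 \<ge> 0" "r \<ge> 0"
    for r s1 s2 s3 s4 :: real
  proof -
    have "(s1 + s2 + (s3 + s4)) powr p \<le> 2 powr p * ((s1 + s2) powr p + (s3 + s4) powr p)"
      using that assms(4) by (intro powr_add_le) auto
    also have "\<dots> \<le> 2 powr p * (2 powr p * (s1 powr p + s2 powr p) + 2 powr p * (s3 powr p + s4 powr p))"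
      using that assms(4) by (intro mult_left_mono add_mono powr_add_le) auto
    finally have *: "(s1 + s2 + (s3 + s4)) powr p \<le>
      2 powr p * (2 powr p * (s1 powr p + s2 powr p) + 2 powr p * (s3 powr p + s4 powr p))" .
    have "r powr p \<le> (2 * c * (s1 + s2 + (s3 + s4))) powr p"
      using that assms(4) by (intro powr_mono2) (auto simp: add.assoc)
    also have "\<dots> = (2 * c) powr p * (s1 + s2 + (s3 + s4)) powr p"
      using that assms(3) by (intro powr_mult)
    also have "\<dots> \<le> (2 * c) powr p *
        (2 powr p * (2 powr p * (s1 powr p + s2 powr p) + 2 powr p * (s3 powr p + s4 powr p)))"
      by (intro mult_left_mono *) simp
    also have "\<dots> = ((2 * c) powr p * (2 powr p * 2 powr p)) * (s1 powr p + s2 powr p) +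
        ((2 * c) powr p * (2 powr p * 2 powr p)) * (s3 powr p + s4 powr p)"
      by (simp add: algebra_simps)
    also have "(2 * c) powr p * (2 powr p * 2 powr p) = (8 * c) powr p"
      using assms(3) by (simp add: powr_mult[symmetric])
    finally show ?thesis .
  qed
  have split: "s1 + s2 + (t1 + t2) \<le> 2 * (t1 + t2 + d1 + d2)"
    if "s1 \<le> t1 + d1" "s2 \<le> t2 + d2" "0 \<le> t1" "0 \<le> t2" "0 \<le> d1" "0 \<le> d2"
    for s1 s2 t1 t2 d1 d2 :: real
    using that by (simp add: algebra_simps)
  have "\<bar>s - t\<bar> \<le> c * (\<bar>a\<bar> + \<bar>a'\<bar>) + c * (\<bar>b\<bar> + \<bar>b'\<bar>)"
    using abs_triangle_ineq4[of s t] assms(1,2) by simp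
  also have "\<dots> = c * (\<bar>a\<bar> + \<bar>a'\<bar> + (\<bar>b\<bar> + \<bar>b'\<bar>))" by (simp add: distrib_left)
  also have "\<dots> \<le> c * (2 * (\<bar>b\<bar> + \<bar>b'\<bar> + \<bar>a - b\<bar> + \<bar>a' - b'\<bar>))"
    by (intro mult_left_mono[OF _ \<open>c \<ge> 0\<close>] split) auto
  also have "\<dots> = 2 * c * (\<bar>b\<bar> + \<bar>b'\<bar> + \<bar>a - b\<bar> + \<bar>a' - b'\<bar>)" by (simp only: mult_ac)
  finally show ?thesis by (intro gen) auto
qed

text \<open>This lets a Lipschitz function of approximants inherit their convergence: the increments
  of the composition are dominated by increments that already converge in L^p, and only pointwise
  convergence is left to check. Two dominating sequences are allowed because the functions applied
  have two arguments.\<close>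

lemma Lp_tendsto_dominated:
  assumes a: "Lp_tendsto p M a \<alpha>" and a': "Lp_tendsto p M a' \<alpha>'" and "p > 0"
    and [measurable]: "\<beta> \<in> borel_measurable M" "\<And>i. b i \<in> borel_measurable M"
    and lim: "AE x in M. (\<lambda>i. b i x) \<longlonglongrightarrow> \<beta> x"
    and bound: "\<And>i. AE x in M. \<bar>b i x\<bar> \<le> c * (\<bar>a i x\<bar> + \<bar>a' i x\<bar>)" and "c \<ge> 0"
  shows "Lp_tendsto p M b \<beta>"
proof -
  note A = a[unfolded Lp_tendsto_def] and A' = a'[unfolded Lp_tendsto_def]
  have [measurable]: "\<alpha> \<in> borel_measurable M" "\<And>i. a i \<in> borel_measurable M"
    "\<alpha>' \<in> borel_measurable M" "\<And>i. a' i \<in> borel_measurable M" using A A' by auto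
  define K where "K = (8 * c) powr p"
  have K: "K \<ge> 0" by (simp add: K_def)
  have \<beta>_bound: "AE x in M. \<bar>\<beta> x\<bar> \<le> c * (\<bar>\<alpha> x\<bar> + \<bar>\<alpha>' x\<bar>)"
  proof -
    have "AE x in M. \<forall>i. \<bar>b i x\<bar> \<le> c * (\<bar>a i x\<bar> + \<bar>a' i x\<bar>)" using bound by (simp add: AE_all_countable)
    moreover have "AE x in M. (\<lambda>i. a i x) \<longlonglongrightarrow> \<alpha> x" "AE x in M. (\<lambda>i. a' i x) \<longlonglongrightarrow> \<alpha>' x" using A A' by auto
    ultimately show ?thesis using lim
    proof eventually_elim
      case (elim x)
      show ?case
        using elim by (intro LIMSEQ_le[of "\<lambda>i. \<bar>b i x\<bar>" _ "\<lambda>i. c * (\<bar>a i x\<bar> + \<bar>a' i x\<bar>)"] tendsto_intros) auto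
    qed
  qed
  have dom: "AE x in M. \<bar>b i x - \<beta> x\<bar> powr p \<le>
     K * (\<bar>\<alpha> x\<bar> powr p + \<bar>\<alpha>' x\<bar> powr p) + K * (\<bar>a i x - \<alpha> x\<bar> powr p + \<bar>a' i x - \<alpha>' x\<bar> powr p)" for i
    using bound[of i] \<beta>_bound
  proof eventually_elim
    case (elim x)
    show ?case unfolding K_def by (rule powr_abs_diff_le[OF elim \<open>c \<ge> 0\<close> \<open>p > 0\<close>])
  qed
  note * = integral_tendsto_dominated_perturbation[where M = M and F = "\<lambda>i x. \<bar>b i x - \<beta> x\<bar> powr p" and f = "\<lambda>x. 0"
      and g = "\<lambda>x. K * (\<bar>\<alpha> x\<bar> powr p + \<bar>\<alpha>' x\<bar> powr p)"
      and r = "\<lambda>i x. K * (\<bar>a i x - \<alpha> x\<bar> powr p + \<bar>a' i x - \<alpha>' x\<bar> powr p)"]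
  have l1: "AE x in M. (\<lambda>i. \<bar>b i x - \<beta> x\<bar> powr p) \<longlonglongrightarrow> 0"
    using lim assms(3) by (auto elim!: eventually_mono intro!: powr_tendsto_0 simp: LIM_zero_iff)
  have l2: "AE x in M. (\<lambda>i. K * (\<bar>a i x - \<alpha> x\<bar> powr p + \<bar>a' i x - \<alpha>' x\<bar> powr p)) \<longlonglongrightarrow> 0"
  proof -
    have "AE x in M. (\<lambda>i. a i x) \<longlonglongrightarrow> \<alpha> x" "AE x in M. (\<lambda>i. a' i x) \<longlonglongrightarrow> \<alpha>' x" using A A' by auto
    then show ?thesis
      by eventually_elim
        (intro tendsto_mult_right_zero tendsto_add_zero powr_tendsto_0 assms(3); simp add: LIM_zero_iff)
  qed
  have l3: "(\<lambda>i. \<integral>x. K * (\<bar>a i x - \<alpha> x\<bar> powr p + \<bar>a' i x - \<alpha>' x\<bar> powr p) \<partial>M) \<longlonglongrightarrow> 0"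
    using A A' by (auto intro!: tendsto_mult_right_zero tendsto_add_zero)
  have int: "integrable M (\<lambda>x. \<bar>b i x - \<beta> x\<bar> powr p)" for i
    by (rule *(2)) (use A A' dom l1 l2 l3 K in auto)
  moreover have "(\<lambda>i. \<integral>x. \<bar>b i x - \<beta> x\<bar> powr p \<partial>M) \<longlonglongrightarrow> (\<integral>x. 0 \<partial>M)"
    by (rule *(3)) (use A A' dom l1 l2 l3 K in auto)
  moreover have "integrable M (\<lambda>x. \<bar>\<beta> x\<bar> powr p)"
  proof (rule Bochner_Integration.integrable_bound[OF _ _ ])
    show "integrable M (\<lambda>x. K * (\<bar>\<alpha> x\<bar> powr p + \<bar>\<alpha>' x\<bar> powr p))" using A A' by simp
    show "AE x in M. norm (\<bar>\<beta> x\<bar> powr p) \<le> norm (K * (\<bar>\<alpha> x\<bar> powr p + \<bar>\<alpha>' x\<bar> powr p))" using \<beta>_bound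
    proof eventually_elim
      case (elim x)
      have "\<bar>0 - \<beta> x\<bar> powr p \<le> K * (\<bar>\<alpha> x\<bar> powr p + \<bar>\<alpha>' x\<bar> powr p) +
          K * (\<bar>\<alpha> x - \<alpha> x\<bar> powr p + \<bar>\<alpha>' x - \<alpha>' x\<bar> powr p)"
        unfolding K_def
        using \<open>c \<ge> 0\<close> \<open>p > 0\<close> elim by (intro powr_abs_diff_le) auto
      then show ?case by simp
    qed
  qed simp
  ultimately show ?thesis using lim by (simp add: Lp_tendsto_def)
qed

lemma abs_powr_minus_two: "\<bar>\<bar>s\<bar> powr (p - 2) * s\<bar> = \<bar>s\<bar> powr (p - 1)" for s p :: real
  by (cases "s = 0") (auto simp: abs_mult powr_diff power2_eq_square)

text \<open>The factor |\<sigma>|^(p - 1) belongs to the dual exponent, so pairing with it is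
  continuous in L^p. The error |\<sigma>|^(p - 1) |b i - \<beta>| vanishes in mean by
  \<open>young_scaled\<close>: first \<eta> is fixed, then i grows.\<close>

lemma Lp_tendsto_weak:
  assumes b: "Lp_tendsto p M b \<beta>" and "p > 1"
    and [measurable]: "\<sigma> \<in> borel_measurable M" and \<sigma>: "integrable M (\<lambda>x. \<bar>\<sigma> x\<bar> powr p)"
  shows "integrable M (\<lambda>x. \<bar>\<sigma> x\<bar> powr (p - 2) * \<sigma> x * \<beta> x)"
    and "integrable M (\<lambda>x. \<bar>\<sigma> x\<bar> powr (p - 2) * \<sigma> x * b i x)"
    and "(\<lambda>i. \<integral>x. \<bar>\<sigma> x\<bar> powr (p - 2) * \<sigma> x * b i x \<partial>M) \<longlonglongrightarrow> (\<integral>x. \<bar>\<sigma> x\<bar> powr (p - 2) * \<sigma> x * \<beta> x \<partial>M)"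
proof -
  note B = b[unfolded Lp_tendsto_def]
  have [measurable]: "\<beta> \<in> borel_measurable M" "\<And>i. b i \<in> borel_measurable M" using B by auto
  have young_int: "integrable M (\<lambda>x. \<bar>\<sigma> x\<bar> powr (p - 1) * \<bar>\<tau> x\<bar>)"
    if [measurable]: "\<tau> \<in> borel_measurable M" and "integrable M (\<lambda>x. \<bar>\<tau> x\<bar> powr p)" for \<tau>
  proof (rule Bochner_Integration.integrable_bound[OF Bochner_Integration.integrable_add[OF \<sigma> that(2)]])
    have "\<bar>s\<bar> powr (p - 1) * \<bar>t\<bar> \<le> \<bar>s\<bar> powr p + \<bar>t\<bar> powr p" for s t :: real
      using young_scaled[of "\<bar>s\<bar>" "\<bar>t\<bar>" 1 p] \<open>p > 1\<close> by simp
    then show "AE x in M. norm (\<bar>\<sigma> x\<bar> powr (p - 1) * \<bar>\<tau> x\<bar>) \<le> norm (\<bar>\<sigma> x\<bar> powr p + \<bar>\<tau> x\<bar> powr p)"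
      by (intro always_eventually allI) (simp add: abs_mult)
  qed measurable
  define r where "r i x = \<bar>\<sigma> x\<bar> powr (p - 1) * \<bar>b i x - \<beta> x\<bar>" for i x
  have rint: "integrable M (r i)" for i unfolding r_def using B by (intro young_int) auto
  have r0: "(\<lambda>i. \<integral>x. r i x \<partial>M) \<longlonglongrightarrow> 0"
  proof (rule LIMSEQ_I)
    fix e :: real assume "e > 0"
    define S where "S = (\<integral>x. \<bar>\<sigma> x\<bar> powr p \<partial>M)"
    have S: "S \<ge> 0" by (simp add: S_def)
    \<comment> \<open>The summand 1 keeps the denominator positive when \<sigma> vanishes
      a.e.\<close>
    define \<eta> where "\<eta> = e / (2 * (S + 1))"
    have \<eta>: "\<eta> > 0" using S \<open>e > 0\<close> by (simp add: \<eta>_def)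
    have \<eta>S: "\<eta> * S < e / 2" using S \<open>e > 0\<close> unfolding \<eta>_def by (simp add: field_simps)
    have "(\<lambda>i. \<eta> powr (1 - p) * (\<integral>x. \<bar>b i x - \<beta> x\<bar> powr p \<partial>M)) \<longlonglongrightarrow> 0"
      using B by (intro tendsto_mult_right_zero) auto
    from LIMSEQ_D[OF this, of "e / 2"] \<open>e > 0\<close> obtain N where
      N: "\<And>i. i \<ge> N \<Longrightarrow> \<bar>\<eta> powr (1 - p) * (\<integral>x. \<bar>b i x - \<beta> x\<bar> powr p \<partial>M)\<bar> < e / 2" by auto
    have "norm ((\<integral>x. r i x \<partial>M) - 0) < e" if "i \<ge> N" for i
    proof -
      have "(\<integral>x. r i x \<partial>M) \<le> (\<integral>x. \<eta> * \<bar>\<sigma> x\<bar> powr p + \<eta> powr (1 - p) * \<bar>b i x - \<beta> x\<bar> powr p \<partial>M)"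
        using rint[unfolded r_def] B \<sigma> young_scaled[OF abs_ge_zero abs_ge_zero \<eta>, of p] \<open>p > 1\<close>
        by (intro integral_mono) (auto simp: r_def)
      also have "\<dots> = \<eta> * S + \<eta> powr (1 - p) * (\<integral>x. \<bar>b i x - \<beta> x\<bar> powr p \<partial>M)"
        using B \<sigma> by (simp add: S_def)
      also have "\<dots> < e" using N[OF that] \<eta>S by linarith
      finally show ?thesis using Bochner_Integration.integral_nonneg[of M "r i"] by (simp add: r_def)
    qed
    then show "\<exists>N. \<forall>i\<ge>N. norm ((\<integral>x. r i x \<partial>M) - 0) < e" by blast
  qed
  have l1: "AE x in M. (\<lambda>i. \<bar>\<sigma> x\<bar> powr (p - 2) * \<sigma> x * b i x) \<longlonglongrightarrow> \<bar>\<sigma> x\<bar> powr (p - 2) * \<sigma> x * \<beta> x"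
    using B by (auto elim!: eventually_mono intro!: tendsto_intros)
  have l2: "AE x in M. (\<lambda>i. r i x) \<longlonglongrightarrow> 0"
    using B by (auto elim!: eventually_mono intro!: tendsto_mult_right_zero tendsto_rabs_zero simp: r_def LIM_zero_iff)
  have dom: "\<bar>\<bar>s\<bar> powr (p - 2) * s * t\<bar> \<le> \<bar>s\<bar> powr (p - 1) * \<bar>t'\<bar> + \<bar>s\<bar> powr (p - 1) * \<bar>t - t'\<bar>" for s t t' :: real
  proof -
    have "\<bar>\<bar>s\<bar> powr (p - 2) * s * t\<bar> = \<bar>s\<bar> powr (p - 1) * \<bar>t\<bar>" using abs_powr_minus_two[of s p] by (simp add: abs_mult)
    also have "\<dots> \<le> \<bar>s\<bar> powr (p - 1) * (\<bar>t'\<bar> + \<bar>t - t'\<bar>)" by (intro mult_left_mono) auto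
    finally show ?thesis by (simp add: distrib_left)
  qed
  note * = integral_tendsto_dominated_perturbation[where M = M and F = "\<lambda>i x. \<bar>\<sigma> x\<bar> powr (p - 2) * \<sigma> x * b i x"
      and f = "\<lambda>x. \<bar>\<sigma> x\<bar> powr (p - 2) * \<sigma> x * \<beta> x"
      and g = "\<lambda>x. \<bar>\<sigma> x\<bar> powr (p - 1) * \<bar>\<beta> x\<bar>" and r = r]
  have g: "integrable M (\<lambda>x. \<bar>\<sigma> x\<bar> powr (p - 1) * \<bar>\<beta> x\<bar>)" using B by (intro young_int) auto
  show "integrable M (\<lambda>x. \<bar>\<sigma> x\<bar> powr (p - 2) * \<sigma> x * \<beta> x)"
    by (rule *(1)) (use g rint r0 l1 l2 dom in \<open>auto simp: r_def\<close>)
  show "integrable M (\<lambda>x. \<bar>\<sigma> x\<bar> powr (p - 2) * \<sigma> x * b i x)"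
    by (rule *(2)) (use g rint r0 l1 l2 dom in \<open>auto simp: r_def\<close>)
  show "(\<lambda>i. \<integral>x. \<bar>\<sigma> x\<bar> powr (p - 2) * \<sigma> x * b i x \<partial>M) \<longlonglongrightarrow> (\<integral>x. \<bar>\<sigma> x\<bar> powr (p - 2) * \<sigma> x * \<beta> x \<partial>M)"
    by (rule *(3)) (use g rint r0 l1 l2 dom in \<open>auto simp: r_def\<close>)
qed

text \<open>Fatou's lemma, applied in j to |a k - a j|^p, bounds the distance from a k to the a.e.
  limit by the Cauchy tolerance. Nonnegative integrals are used until integrability of the limit is
  known.\<close>

lemma Lp_tendsto_Cauchy:
  fixes a :: "nat \<Rightarrow> 'b \<Rightarrow> real"
  assumes [measurable]: "\<And>i. a i \<in> borel_measurable M" "\<alpha> \<in> borel_measurable M"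
    and "p > 0" and int: "\<And>i. integrable M (\<lambda>x. \<bar>a i x\<bar> powr p)"
    and Cauchy: "\<And>e. e > 0 \<Longrightarrow> \<exists>N. \<forall>j\<ge>N. \<forall>k\<ge>N. (\<integral>x. \<bar>a j x - a k x\<bar> powr p \<partial>M) < e"
    and lim: "AE x in M. (\<lambda>i. a i x) \<longlonglongrightarrow> \<alpha> x"
  shows "Lp_tendsto p M a \<alpha>"
proof -
  have intd: "integrable M (\<lambda>x. \<bar>a j x - a k x\<bar> powr p)" for j k
    using integrable_powr_add[of "a j" M "\<lambda>x. - a k x" p] int \<open>p > 0\<close> by simp
  have tail: "\<exists>N. \<forall>k\<ge>N. (\<integral>\<^sup>+x. ennreal (\<bar>a k x - \<alpha> x\<bar> powr p) \<partial>M) \<le> ennreal e" if "e > 0" for e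
  proof -
    obtain N where N: "\<And>j k. j \<ge> N \<Longrightarrow> k \<ge> N \<Longrightarrow> (\<integral>x. \<bar>a j x - a k x\<bar> powr p \<partial>M) < e"
      using Cauchy[OF \<open>e > 0\<close>] by blast
    have "(\<integral>\<^sup>+x. ennreal (\<bar>a k x - \<alpha> x\<bar> powr p) \<partial>M) \<le> ennreal e" if "k \<ge> N" for k
    proof -
      have "(\<integral>\<^sup>+x. ennreal (\<bar>a k x - \<alpha> x\<bar> powr p) \<partial>M) =
            (\<integral>\<^sup>+x. liminf (\<lambda>j. ennreal (\<bar>a k x - a j x\<bar> powr p)) \<partial>M)"
      proof (rule nn_integral_cong_AE)
        show "AE x in M. ennreal (\<bar>a k x - \<alpha> x\<bar> powr p) = liminf (\<lambda>j. ennreal (\<bar>a k x - a j x\<bar> powr p))"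
          using lim
        proof eventually_elim
          case (elim x)
          have "(\<lambda>j. ennreal (\<bar>a k x - a j x\<bar> powr p)) \<longlonglongrightarrow> ennreal (\<bar>a k x - \<alpha> x\<bar> powr p)"
            using \<open>p > 0\<close> elim by (intro tendsto_ennrealI tendsto_powr' tendsto_intros) auto
          then show ?case by (intro lim_imp_Liminf[symmetric]) auto
        qed
      qed
      also have "\<dots> \<le> liminf (\<lambda>j. \<integral>\<^sup>+x. ennreal (\<bar>a k x - a j x\<bar> powr p) \<partial>M)"
        by (rule nn_integral_liminf) measurable
      also have "\<dots> \<le> ennreal e"
      proof (rule Liminf_le)
        have "(\<integral>\<^sup>+x. ennreal (\<bar>a k x - a j x\<bar> powr p) \<partial>M) \<le> ennreal e" if "j \<ge> N" for j
          using intd[of k j] N[OF \<open>k \<ge> N\<close> that]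
          by (subst nn_integral_eq_integral) (auto intro!: ennreal_leI)
        then show "\<forall>\<^sub>F j in sequentially. (\<integral>\<^sup>+x. ennreal (\<bar>a k x - a j x\<bar> powr p) \<partial>M) \<le> ennreal e"
          by (auto simp: eventually_sequentially)
      qed simp
      finally show ?thesis .
    qed
    then show ?thesis by blast
  qed
  have tail_int: "integrable M (\<lambda>x. \<bar>a k x - \<alpha> x\<bar> powr p)"
    if "(\<integral>\<^sup>+x. ennreal (\<bar>a k x - \<alpha> x\<bar> powr p) \<partial>M) \<le> ennreal e" for k e
  proof (rule integrableI_bounded)
    show "(\<integral>\<^sup>+x. ennreal (norm (\<bar>a k x - \<alpha> x\<bar> powr p)) \<partial>M) < \<infinity>"
      using that by (simp add: le_less_trans[OF _ ennreal_less_top])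
  qed measurable
  obtain N where "\<forall>k\<ge>N. (\<integral>\<^sup>+x. ennreal (\<bar>a k x - \<alpha> x\<bar> powr p) \<partial>M) \<le> ennreal 1"
    using tail[OF zero_less_one] by blast
  then have "(\<integral>\<^sup>+x. ennreal (\<bar>a N x - \<alpha> x\<bar> powr p) \<partial>M) \<le> ennreal 1" by blast
  from tail_int[OF this] have intN: "integrable M (\<lambda>x. \<bar>a i x - \<alpha> x\<bar> powr p)" for i
    using integrable_powr_add[of "\<lambda>x. a i x - a N x" M "\<lambda>x. a N x - \<alpha> x" p] intd[of i N] \<open>p > 0\<close> by simp
  then have "integrable M (\<lambda>x. \<bar>\<alpha> x\<bar> powr p)"
    using integrable_powr_add[of "a 0" M "\<lambda>x. \<alpha> x - a 0 x" p] int \<open>p > 0\<close>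
    by (simp add: abs_minus_commute)
  moreover have "(\<lambda>i. \<integral>x. \<bar>a i x - \<alpha> x\<bar> powr p \<partial>M) \<longlonglongrightarrow> 0"
  proof (rule LIMSEQ_I)
    fix e :: real assume "e > 0"
    then obtain N where N: "\<And>k. k \<ge> N \<Longrightarrow> (\<integral>\<^sup>+x. ennreal (\<bar>a k x - \<alpha> x\<bar> powr p) \<partial>M) \<le> ennreal (e / 2)"
      using tail[of "e / 2"] by auto
    have "norm ((\<integral>x. \<bar>a k x - \<alpha> x\<bar> powr p \<partial>M) - 0) < e" if "k \<ge> N" for k
    proof -
      have "(\<integral>x. \<bar>a k x - \<alpha> x\<bar> powr p \<partial>M) \<le> e / 2"
        using N[OF that] intN[of k] \<open>e > 0\<close> by (subst (asm) nn_integral_eq_integral) auto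
      then show ?thesis using \<open>e > 0\<close> by (simp add: abs_of_nonneg Bochner_Integration.integral_nonneg)
    qed
    then show "\<exists>N. \<forall>k\<ge>N. norm ((\<integral>x. \<bar>a k x - \<alpha> x\<bar> powr p \<partial>M) - 0) < e" by blast
  qed
  ultimately show ?thesis using intN lim by (simp add: Lp_tendsto_def)
qed

section \<open>Integrability of the kernels\<close>

lemma cball_borel [measurable]: "cball c r \<in> sets borel"
  by (simp add: borel_closed)

text \<open>A substitute for polar coordinates: f is dominated by the sum of c k times the indicator
  of the ball of radius R k, whose volume is a constant times R k to the power of the
  dimension.\<close>

lemma nn_integral_finite_radial:
  fixes f :: "'a::euclidean_space \<Rightarrow> ennreal"
  assumes f: "\<And>z. f z \<noteq> 0 \<Longrightarrow> \<exists>k. norm z \<le> R k \<and> f z \<le> ennreal (c k)"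
    and nonneg: "\<And>k. c k \<ge> 0" "\<And>k. R k \<ge> 0" and sum: "summable (\<lambda>k. c k * R k ^ DIM('a))"
  shows "(\<integral>\<^sup>+z. f z \<partial>lborel) < \<infinity>"
proof -
  let ?V = "unit_ball_vol (real DIM('a))"
  have "(\<integral>\<^sup>+z. f z \<partial>lborel) \<le> (\<integral>\<^sup>+z. (\<Sum>k. ennreal (c k) * indicator (cball 0 (R k)) (z::'a)) \<partial>lborel)"
  proof (rule nn_integral_mono)
    fix z :: 'a
    show "f z \<le> (\<Sum>k. ennreal (c k) * indicator (cball 0 (R k)) z)"
    proof (cases "f z = 0")
      case False
      then obtain k where "norm z \<le> R k" "f z \<le> ennreal (c k)" using f by blast
      then have "f z \<le> (\<Sum>j\<in>{k}. ennreal (c j) * indicator (cball 0 (R j)) z)" by simp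
      also have "\<dots> \<le> (\<Sum>k. ennreal (c k) * indicator (cball 0 (R k)) z)"
        by (intro sum_le_suminf) auto
      finally show ?thesis .
    qed simp
  qed
  also have "\<dots> = (\<Sum>k. \<integral>\<^sup>+z. ennreal (c k) * indicator (cball 0 (R k)) (z::'a) \<partial>lborel)"
    by (intro nn_integral_suminf) measurable
  also have "\<dots> = (\<Sum>k. ennreal (?V * (c k * R k ^ DIM('a))))"
    using nonneg
    by (intro suminf_cong) (simp add: nn_integral_cmult_indicator emeasure_cball ennreal_mult' mult_ac)
  also have "\<dots> < \<infinity>"
  proof -
    have "(\<Sum>k. ennreal (?V * (c k * R k ^ DIM('a)))) \<noteq> top"
      using nonneg by (intro ennreal_suminf_neq_top summable_mult[OF sum]) simp
    then show ?thesis by (simp add: less_top)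
  qed
  finally show ?thesis .
qed

text \<open>Dyadic shells: with norm z = 2^(-L) and k the integer part of L, norm z powr e differs
  from 2^(-k e) by at most the factor 2^|e|, whatever the sign of e. The resulting series is
  geometric with ratio 2^(-(e + n)) < 1.\<close>

lemma nn_integral_powr_near_finite:
  assumes "e + real DIM('a::euclidean_space) > 0" "A \<ge> 0"
  shows "(\<integral>\<^sup>+z. ennreal (A * norm (z::'a) powr e) * indicator (cball 0 1) z \<partial>lborel) < \<infinity>"
proof (rule nn_integral_finite_radial)
  let ?c = "\<lambda>k::nat. A * (2 powr \<bar>e\<bar> * 2 powr (- (real k * e)))"
  let ?R = "\<lambda>k::nat. 2 powr (- real k)"
  fix z :: 'a
  assume nz: "ennreal (A * norm z powr e) * indicator (cball 0 1) z \<noteq> 0"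
  then have z: "norm z > 0" "norm z \<le> 1" by (auto split: split_indicator_asm)
  define L where "L = - log 2 (norm z)"
  have L: "L \<ge> 0" "norm z = 2 powr (- L)" using z by (auto simp: L_def)
  define k where "k = nat \<lfloor>L\<rfloor>"
  have k: "real k \<le> L" "L \<le> real k + 1" using L(1) by (auto simp: k_def)
  have "- (L * e) \<le> \<bar>e\<bar> - real k * e"
  proof (cases "e \<ge> 0")
    case True
    then show ?thesis using mult_right_mono[OF k(1), of e] by simp
  next
    case False
    then show ?thesis using mult_right_mono[OF k(2), of "- e"] by (simp add: algebra_simps)
  qed
  then have "norm z powr e \<le> 2 powr \<bar>e\<bar> * 2 powr (- (real k * e))"
    by (simp add: L(2) powr_powr flip: powr_add)
  then have "ennreal (A * norm z powr e) \<le> ennreal (?c k)"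
    using \<open>A \<ge> 0\<close> by (intro ennreal_leI mult_left_mono) auto
  moreover have "norm z \<le> ?R k" using k by (simp add: L(2))
  ultimately show "\<exists>k. norm z \<le> ?R k \<and> ennreal (A * norm z powr e) * indicator (cball 0 1) z \<le> ennreal (?c k)"
    using z by (intro exI[of _ k]) simp
next
  have "2 powr (- (e + real DIM('a))) < (2::real) powr 0" using assms by (intro powr_less_mono) auto
  then have "summable (\<lambda>k. (A * 2 powr \<bar>e\<bar>) * (2 powr (- (e + real DIM('a)))) ^ k)"
    by (intro summable_mult summable_geometric) auto
  moreover have "A * (2 powr \<bar>e\<bar> * 2 powr (- (real k * e))) * (2 powr (- real k)) ^ DIM('a) =
      (A * 2 powr \<bar>e\<bar>) * (2 powr (- (e + real DIM('a)))) ^ k" for k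
    by (simp add: powr_powr powr_add[symmetric] powr_realpow[symmetric] algebra_simps)
  ultimately show "summable (\<lambda>k. A * (2 powr \<bar>e\<bar> * 2 powr (- (real k * e))) * (2 powr (- real k)) ^ DIM('a))"
    by (simp only:)
qed (use assms in auto)

text \<open>The same dyadic decomposition with growing balls. The volume factor cancels the
  dimension in the exponent and leaves the geometric ratio 2^(-t).\<close>

lemma nn_integral_powr_far_finite:
  assumes "t > 0" "B \<ge> 0"
  shows "(\<integral>\<^sup>+z. ennreal (B * norm (z::'a::euclidean_space) powr (- (real DIM('a) + t))) * indicator (- cball 0 1) z \<partial>lborel) < \<infinity>"
proof (rule nn_integral_finite_radial)
  let ?e = "real DIM('a) + t"
  let ?c = "\<lambda>k::nat. B * 2 powr (- (real k * ?e))"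
  let ?R = "\<lambda>k::nat. 2 powr (real k + 1)"
  fix z :: 'a
  assume nz: "ennreal (B * norm z powr (- ?e)) * indicator (- cball 0 1) z \<noteq> 0"
  then have z: "norm z > 1" by (auto split: split_indicator_asm)
  define L where "L = log 2 (norm z)"
  have "norm z > 0" using z by linarith
  then have L: "L \<ge> 0" "norm z = 2 powr L" using z by (auto simp: L_def)
  define k where "k = nat \<lfloor>L\<rfloor>"
  have k: "real k \<le> L" "L \<le> real k + 1" using L(1) by (auto simp: k_def)
  have "real k * ?e \<le> L * ?e" using k \<open>t > 0\<close> by (intro mult_right_mono) auto
  then have "norm z powr (- ?e) \<le> 2 powr (- (real k * ?e))"
    unfolding L(2) powr_powr by (intro powr_mono) (auto simp: algebra_simps)
  then have "ennreal (B * norm z powr (- ?e)) \<le> ennreal (?c k)"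
    using \<open>B \<ge> 0\<close> by (intro ennreal_leI mult_left_mono) auto
  moreover have "norm z \<le> ?R k" using k by (simp add: L(2))
  ultimately show "\<exists>k. norm z \<le> ?R k \<and> ennreal (B * norm z powr (- ?e)) * indicator (- cball 0 1) z \<le> ennreal (?c k)"
    using z by (intro exI[of _ k]) simp
next
  have "2 powr (- t) < (2::real) powr 0" using assms by (intro powr_less_mono) auto
  then have "summable (\<lambda>k. (B * 2 powr real DIM('a)) * (2 powr (- t)) ^ k)"
    by (intro summable_mult summable_geometric) auto
  moreover have "B * 2 powr (- (real k * (real DIM('a) + t))) * (2 powr (real k + 1)) ^ DIM('a) =
      (B * 2 powr real DIM('a)) * (2 powr (- t)) ^ k" for k
    by (simp add: powr_powr powr_add[symmetric] powr_realpow[symmetric] algebra_simps)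
  ultimately show "summable (\<lambda>k. B * 2 powr (- (real k * (real DIM('a) + t))) * (2 powr (real k + 1)) ^ DIM('a))"
    by (simp only:)
qed (use assms in auto)

text \<open>Near 0 the first entry of the minimum, a Lipschitz bound, leaves the exponent p - n - p
  \<alpha>, integrable because \<alpha> < 1. Far away the second entry, a sup bound, leaves -n - p
  \<alpha>, integrable because p \<alpha> > 0.\<close>

lemma nn_integral_min_kernel_finite:
  fixes p \<alpha> :: real
  assumes "p > 0" "0 < \<alpha>" "\<alpha> < 1" "A \<ge> 0" "B \<ge> 0"
  shows "(\<integral>\<^sup>+z. ennreal (min (A * norm (z::'a::euclidean_space) powr p) B / norm z powr (real DIM('a) + p * \<alpha>)) \<partial>lborel) < \<infinity>"
proof -
  let ?d = "real DIM('a) + p * \<alpha>"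
  have "p * \<alpha> < p" "p * \<alpha> > 0" using assms by auto
  have near: "(\<integral>\<^sup>+z. ennreal (A * norm (z::'a) powr (p - ?d)) * indicator (cball 0 1) z \<partial>lborel) < \<infinity>"
    by (rule nn_integral_powr_near_finite) (use \<open>p * \<alpha> < p\<close> assms in auto)
  have far: "(\<integral>\<^sup>+z. ennreal (B * norm (z::'a) powr (- ?d)) * indicator (- cball 0 1) z \<partial>lborel) < \<infinity>"
    by (rule nn_integral_powr_far_finite) (use \<open>p * \<alpha> > 0\<close> assms in auto)
  have "(\<integral>\<^sup>+z. ennreal (min (A * norm (z::'a) powr p) B / norm z powr ?d) \<partial>lborel) \<le>
    (\<integral>\<^sup>+z. ennreal (A * norm (z::'a) powr (p - ?d)) * indicator (cball 0 1) z +
       ennreal (B * norm z powr (- ?d)) * indicator (- cball 0 1) z \<partial>lborel)"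
  proof (rule nn_integral_mono)
    fix z :: 'a
    have "min (A * norm z powr p) B / norm z powr ?d \<le> A * norm z powr p / norm z powr ?d"
      "min (A * norm z powr p) B / norm z powr ?d \<le> B / norm z powr ?d"
      by (intro divide_right_mono; simp)+
    then show "ennreal (min (A * norm z powr p) B / norm z powr ?d) \<le>
      ennreal (A * norm z powr (p - ?d)) * indicator (cball 0 1) z +
       ennreal (B * norm z powr (- ?d)) * indicator (- cball 0 1) z"
      unfolding powr_diff powr_minus_divide
      by (cases "z \<in> cball 0 1") (simp_all add: ennreal_leI del: mem_cball mem_cball_0)
  qed
  also have "\<dots> = (\<integral>\<^sup>+z. ennreal (A * norm (z::'a) powr (p - ?d)) * indicator (cball 0 1) z \<partial>lborel) +
      (\<integral>\<^sup>+z. ennreal (B * norm (z::'a) powr (- ?d)) * indicator (- cball 0 1) z \<partial>lborel)"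
    by (rule nn_integral_add) measurable
  also have "\<dots> < \<infinity>"
    using near far by (simp only: infinity_ennreal_def ennreal_add_less_top)
  finally show ?thesis .
qed

text \<open>The singularity has order s below the dimension; outside the unit ball the kernel is at
  most B on a set of finite measure.\<close>

lemma nn_integral_hardy_kernel_finite:
  fixes s R B :: real
  assumes "s < real DIM('a::euclidean_space)" "0 \<le> s" "B \<ge> 0"
  shows "(\<integral>\<^sup>+z. ennreal (B / norm (z::'a) powr s) * indicator (cball 0 R) z \<partial>lborel) < \<infinity>"
proof -
  have near: "(\<integral>\<^sup>+z. ennreal (B * norm (z::'a) powr (- s)) * indicator (cball 0 1) z \<partial>lborel) < \<infinity>"
    using assms by (intro nn_integral_powr_near_finite) auto
  have "(\<integral>\<^sup>+z. ennreal (B / norm (z::'a) powr s) * indicator (cball 0 R) z \<partial>lborel) \<le>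
    (\<integral>\<^sup>+z. ennreal (B * norm (z::'a) powr (- s)) * indicator (cball 0 1) z + ennreal B * indicator (cball 0 R) z \<partial>lborel)"
  proof (rule nn_integral_mono)
    fix z :: 'a
    have "B / norm z powr s \<le> B" if "norm z > 1"
      using that assms ge_one_powr_ge_zero[of "norm z" s]
      by (simp add: divide_le_eq mult_left_le mult_le_cancel_left1)
    then show "ennreal (B / norm z powr s) * indicator (cball 0 R) z \<le>
       ennreal (B * norm z powr (- s)) * indicator (cball 0 1) z + ennreal B * indicator (cball 0 R) z"
      by (auto simp: powr_minus_divide intro!: ennreal_leI split: split_indicator)
  qed
  also have "\<dots> = (\<integral>\<^sup>+z. ennreal (B * norm (z::'a) powr (- s)) * indicator (cball 0 1) z \<partial>lborel) +
      (\<integral>\<^sup>+z. ennreal B * indicator (cball 0 R) (z::'a) \<partial>lborel)"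
    by (rule nn_integral_add) measurable
  also have "(\<integral>\<^sup>+z. ennreal B * indicator (cball 0 R) (z::'a) \<partial>lborel) = ennreal B * emeasure lborel (cball 0 R :: 'a set)"
    by (rule nn_integral_cmult_indicator) simp
  also have "(\<integral>\<^sup>+z. ennreal (B * norm (z::'a) powr (- s)) * indicator (cball 0 1) z \<partial>lborel) +
      ennreal B * emeasure lborel (cball 0 R :: 'a set) < \<infinity>"
    using near emeasure_bounded_finite[of "cball 0 R :: 'a set"]
    by (simp only: infinity_ennreal_def ennreal_add_less_top ennreal_mult_less_top) simp
  finally show ?thesis .
qed

lemma nn_integral_lborel_diff:
  fixes f :: "'a::euclidean_space \<Rightarrow> ennreal"
  assumes [measurable]: "f \<in> borel_measurable borel"
  shows "(\<integral>\<^sup>+y. f (y - x) \<partial>lborel) = (\<integral>\<^sup>+z. f z \<partial>lborel)"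
proof -
  have "(\<integral>\<^sup>+z. f z \<partial>lborel) = (\<integral>\<^sup>+z. f z \<partial>distr lborel borel ((+) (- x)))"
    by (simp only: lborel_distr_plus)
  also have "\<dots> = (\<integral>\<^sup>+y. f (- x + y) \<partial>lborel)" by (rule nn_integral_distr) measurable
  finally show ?thesis by simp
qed

text \<open>A pair contributes only if one of its points lies in the ball carrying \<phi>.
  Integrating over the other point first gives, by translation invariance, the same finite kernel
  integral for each position.\<close>

lemma nn_integral_energy_finite:
  fixes \<phi> :: "'a::euclidean_space \<Rightarrow> real"
  assumes p: "p > 0" "0 < \<alpha>" "\<alpha> < 1"
    and [measurable]: "\<phi> \<in> borel_measurable borel"
    and lip: "\<And>x y. \<bar>\<phi> x - \<phi> y\<bar> \<le> L * norm (x - y)" and bdd: "\<And>x. \<bar>\<phi> x\<bar> \<le> B"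
    and supp: "\<And>x. x \<notin> cball 0 R \<Longrightarrow> \<phi> x = 0" and "L \<ge> 0"
  shows "(\<integral>\<^sup>+z. ennreal (\<bar>\<phi> (fst z) - \<phi> (snd z)\<bar> powr p / norm (fst z - snd z) powr (real DIM('a) + p * \<alpha>)) \<partial>lborel) < \<infinity>"
proof -
  define K :: "'a \<Rightarrow> ennreal" where
    "K z = ennreal (min (L powr p * norm z powr p) ((2 * B) powr p) / norm z powr (real DIM('a) + p * \<alpha>))" for z
  have [measurable]: "K \<in> borel_measurable borel" unfolding K_def by measurable
  define I :: "'a \<Rightarrow> ennreal" where "I = indicator (cball 0 R)"
  have [measurable]: "I \<in> borel_measurable borel" unfolding I_def
    by (intro borel_measurable_indicator) simp
  have K: "(\<integral>\<^sup>+z. K z \<partial>lborel) < \<infinity>"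
    unfolding K_def using p by (intro nn_integral_min_kernel_finite) auto
  have Ksym: "K (x - y) = K (y - x)" for x y by (simp add: K_def norm_minus_commute)
  have "(\<integral>\<^sup>+z. ennreal (\<bar>\<phi> (fst z) - \<phi> (snd z)\<bar> powr p / norm (fst z - snd z) powr (real DIM('a) + p * \<alpha>)) \<partial>lborel) \<le>
     (\<integral>\<^sup>+z. I (fst z) * K (snd z - fst z) + I (snd z) * K (fst z - snd z) \<partial>(lborel \<Otimes>\<^sub>M lborel))"
    unfolding lborel_prod
  proof (rule nn_integral_mono)
    fix z :: "'a \<times> 'a"
    obtain x y where z: "z = (x, y)" by force
    have "\<bar>\<phi> x - \<phi> y\<bar> powr p \<le> (L * norm (x - y)) powr p" using lip p by (intro powr_mono2) auto
    moreover have "\<bar>\<phi> x - \<phi> y\<bar> \<le> 2 * B" using bdd[of x] bdd[of y] by linarith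
    then have "\<bar>\<phi> x - \<phi> y\<bar> powr p \<le> (2 * B) powr p" using p by (intro powr_mono2) auto
    ultimately have *: "ennreal (\<bar>\<phi> x - \<phi> y\<bar> powr p / norm (x - y) powr (real DIM('a) + p * \<alpha>)) \<le> K (x - y)"
      unfolding K_def using \<open>L \<ge> 0\<close> by (intro ennreal_leI divide_right_mono) (auto simp: powr_mult)
    consider "x \<in> cball 0 R" | "y \<in> cball 0 R" | "\<phi> x = 0" "\<phi> y = 0" using supp by blast
    then show "ennreal (\<bar>\<phi> (fst z) - \<phi> (snd z)\<bar> powr p / norm (fst z - snd z) powr (real DIM('a) + p * \<alpha>)) \<le>
       I (fst z) * K (snd z - fst z) + I (snd z) * K (fst z - snd z)"
    proof cases
      case 1
      have le: "K (x - y) \<le> I x * K (y - x) + I y * K (x - y)"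
        using 1 by (simp add: Ksym[of y x] I_def)
      show ?thesis unfolding z fst_conv snd_conv by (rule order_trans[OF * le])
    next
      case 2
      have le: "K (x - y) \<le> I x * K (y - x) + I y * K (x - y)"
        using 2 by (simp add: I_def)
      show ?thesis unfolding z fst_conv snd_conv by (rule order_trans[OF * le])
    next
      case 3
      then show ?thesis by (simp add: z)
    qed
  qed
  also have "\<dots> = (\<integral>\<^sup>+z. I (fst z) * K (snd z - fst z) \<partial>(lborel \<Otimes>\<^sub>M lborel)) +
     (\<integral>\<^sup>+z. I (snd z) * K (fst z - snd z) \<partial>(lborel \<Otimes>\<^sub>M lborel))"
    by (rule nn_integral_add) measurable
  also have "(\<integral>\<^sup>+z. I (fst z) * K (snd z - fst z) \<partial>(lborel \<Otimes>\<^sub>M lborel)) =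
     (\<integral>\<^sup>+x. \<integral>\<^sup>+y. I x * K (y - x) \<partial>lborel \<partial>lborel)"
    by (subst lborel.nn_integral_fst[symmetric]) simp_all
  also have "\<dots> = (\<integral>\<^sup>+x. I x * (\<integral>\<^sup>+z. K z \<partial>lborel) \<partial>(lborel :: 'a measure))"
    by (simp add: nn_integral_cmult nn_integral_lborel_diff)
  also have "(\<integral>\<^sup>+z. I (snd z) * K (fst z - snd z) \<partial>(lborel \<Otimes>\<^sub>M lborel)) =
     (\<integral>\<^sup>+y. \<integral>\<^sup>+x. I y * K (x - y) \<partial>lborel \<partial>lborel)"
    by (subst lborel_pair.nn_integral_snd[symmetric]) simp_all
  also have "\<dots> = (\<integral>\<^sup>+x. I x * (\<integral>\<^sup>+z. K z \<partial>lborel) \<partial>(lborel :: 'a measure))"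
    by (simp add: nn_integral_cmult nn_integral_lborel_diff)
  also have "(\<integral>\<^sup>+x. I x * (\<integral>\<^sup>+z. K z \<partial>lborel) \<partial>(lborel :: 'a measure)) =
      (\<integral>\<^sup>+x. I x \<partial>lborel) * (\<integral>\<^sup>+z. K z \<partial>lborel)"
    by (rule nn_integral_multc) measurable
  also have "(\<integral>\<^sup>+x. I x \<partial>lborel) = emeasure lborel (cball 0 R :: 'a set)"
    unfolding I_def by (rule nn_integral_indicator) (simp add: borel_closed)
  also have "emeasure lborel (cball 0 R :: 'a set) * (\<integral>\<^sup>+z. K z \<partial>lborel) +
      emeasure lborel (cball 0 R :: 'a set) * (\<integral>\<^sup>+z. K z \<partial>lborel) < \<infinity>"
    using K emeasure_bounded_finite[of "cball 0 R :: 'a set"]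
    by (simp add: ennreal_mult_less_top ennreal_add_less_top)
  finally show ?thesis .
qed

text \<open>Partial derivatives are bounded on the compact set K by continuity and are zero outside
  it, hence bounded everywhere. The mean value inequality then applies on the whole space, which is
  convex although K may not be.\<close>

lemma C_c_inf_props:
  fixes \<phi> :: "'a::euclidean_space \<Rightarrow> real"
  assumes "\<phi> \<in> C_c_inf U"
  obtains L B R where "L \<ge> 0" "\<And>x y. \<bar>\<phi> x - \<phi> y\<bar> \<le> L * norm (x - y)" "\<And>x. \<bar>\<phi> x\<bar> \<le> B"
    "\<And>x. x \<notin> cball 0 R \<Longrightarrow> \<phi> x = 0"
proof -
  define K where "K = closure {x. \<phi> x \<noteq> 0}"
  have smooth: "C_k k \<phi>" for k using assms unfolding C_c_inf_def by blast
  have K: "compact K" using assms unfolding C_c_inf_def K_def by blast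
  have \<phi>0: "\<phi> x = 0" if "x \<notin> K" for x
    using contra_subsetD[OF closure_subset that[unfolded K_def]] by simp
  define D where "D x = frechet_derivative \<phi> (at x)" for x
  note D = C_k_SucD[OF smooth[of "Suc 0"], folded D_def]
  have D0: "D x = (\<lambda>h. 0)" if "x \<notin> K" for x
  proof -
    have "open (- K)" using K by (simp add: compact_imp_closed open_Compl)
    have "(\<phi> has_derivative (\<lambda>h. 0)) (at x)"
    proof (rule has_derivative_transform_within_open)
      show "((\<lambda>x. 0) has_derivative (\<lambda>h. 0)) (at x)" by simp
      show "open (- K)" "x \<in> - K" using \<open>open (- K)\<close> that by simp_all
      show "0 = \<phi> y" if "y \<in> - K" for y using \<phi>0[of y] that by simp
    qed
    then show ?thesis unfolding D_def by (rule frechet_derivative_at[symmetric])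
  qed
  have "\<exists>B. \<forall>x. \<bar>D x b\<bar> \<le> B" if "b \<in> Basis" for b
  proof -
    have "continuous_on K (\<lambda>x. D x b)" using D(2)[OF that] by (simp add: continuous_on_subset[OF _ subset_UNIV])
    then have "bounded ((\<lambda>x. D x b) ` K)" using K by (intro compact_imp_bounded compact_continuous_image)
    then obtain C where C: "\<And>x. x \<in> K \<Longrightarrow> \<bar>D x b\<bar> \<le> C" by (auto simp: bounded_iff)
    have "\<bar>D x b\<bar> \<le> max C 0" for x using C[of x] D0[of x] by (cases "x \<in> K") auto
    then show ?thesis by blast
  qed
  then obtain C where C: "\<And>b x. b \<in> Basis \<Longrightarrow> \<bar>D x b\<bar> \<le> C b" by metis
  define L where "L = (\<Sum>b\<in>Basis. C b)"
  have C0: "C b \<ge> 0" if "b \<in> Basis" for b using C[OF that, of 0] by linarith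
  then have "L \<ge> 0" unfolding L_def by (intro sum_nonneg)
  have onorm: "onorm (D x) \<le> L" for x
  proof (rule onorm_bound[OF \<open>L \<ge> 0\<close>])
    fix h :: 'a
    interpret bounded_linear "D x" using D(1) by (rule has_derivative_bounded_linear)
    have "D x h = D x (\<Sum>b\<in>Basis. (h \<bullet> b) *\<^sub>R b)" by (simp add: euclidean_representation)
    also have "\<dots> = (\<Sum>b\<in>Basis. (h \<bullet> b) * D x b)" by (simp add: sum scaleR)
    finally have "norm (D x h) \<le> (\<Sum>b\<in>Basis. \<bar>(h \<bullet> b) * D x b\<bar>)" by (simp add: sum_abs)
    also have "\<dots> \<le> (\<Sum>b\<in>Basis. norm h * C b)"
      using C C0 by (intro sum_mono) (auto simp: abs_mult intro!: mult_mono Basis_le_norm)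
    finally show "norm (D x h) \<le> L * norm h" by (simp add: L_def sum_distrib_left mult.commute)
  qed
  have lip: "\<bar>\<phi> x - \<phi> y\<bar> \<le> L * norm (x - y)" for x y
    using differentiable_bound[of UNIV \<phi> D L x y] D(1) onorm by simp
  have "continuous_on K \<phi>" using smooth[of 0] by (simp add: continuous_on_subset[OF _ subset_UNIV])
  then have "bounded (\<phi> ` K)"
    using K by (intro compact_imp_bounded compact_continuous_image)
  then obtain B where B: "\<And>x. x \<in> K \<Longrightarrow> \<bar>\<phi> x\<bar> \<le> B" by (auto simp: bounded_iff)
  have "\<bar>\<phi> x\<bar> \<le> max B 0" for x using B[of x] \<phi>0[of x] by (cases "x \<in> K") auto
  moreover obtain R where "K \<subseteq> cball 0 R"
  proof -
    obtain R where "\<forall>x\<in>K. norm x \<le> R" using compact_imp_bounded[OF K] unfolding bounded_iff by blast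
    then show thesis by (intro that[of R]) (simp add: subset_iff)
  qed
  ultimately show thesis using that[OF \<open>L \<ge> 0\<close> lip] \<phi>0 by blast
qed

lemma C_c_inf_borel: "\<phi> \<in> C_c_inf U \<Longrightarrow> \<phi> \<in> borel_measurable borel"
  by (auto simp: C_c_inf_def intro!: borel_measurable_continuous_onI dest: spec[of _ 0])

section \<open>The energy and Hardy measures\<close>

text \<open>The exceptional set is enlarged to a Borel null set N; the strips N \<times> UNIV and
  UNIV \<times> N are null for the product measure, whose completion is \<open>lebesgue\<close> on
  pairs.\<close>

lemma AE_lebesgue_prod:
  assumes "AE x in lebesgue. P (x::'a::euclidean_space)"
  shows "AE z in lebesgue. P (fst z) \<and> P (snd (z :: 'a \<times> 'a))"
proof -
  have "AE x in lborel. P x" using assms by (simp add: AE_completion_iff)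
  then obtain N where N: "N \<in> null_sets lborel" "{x. \<not> P x} \<subseteq> N" by (auto simp: eventually_ae_filter)
  have "N \<times> (UNIV::'a set) \<in> null_sets (lborel \<Otimes>\<^sub>M lborel)"
    using N by (intro lborel.times_in_null_sets1) auto
  moreover have "(UNIV::'a set) \<times> N \<in> null_sets (lborel \<Otimes>\<^sub>M lborel)"
    using N by (intro lborel.times_in_null_sets2) auto
  ultimately have "N \<times> UNIV \<union> UNIV \<times> N \<in> null_sets (lborel :: ('a \<times> 'a) measure)"
    unfolding lborel_prod by (rule null_sets.Un)
  moreover have "{z. \<not> (P (fst z) \<and> P (snd z))} \<subseteq> N \<times> UNIV \<union> UNIV \<times> N"
    using N(2) by force
  ultimately have "AE z in lborel. P (fst z) \<and> P (snd (z :: 'a \<times> 'a))"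
    by (intro AE_I'[of "N \<times> UNIV \<union> UNIV \<times> N"]) auto
  then show ?thesis by (rule AE_completion)
qed

text \<open>Composition with a projection is unproblematic for a Borel representative of u; the
  representative differs from u on a set that lifts to a null set of pairs.\<close>

lemma borel_measurable_lebesgue_proj:
  fixes u :: "'a::euclidean_space \<Rightarrow> real"
  assumes "u \<in> borel_measurable lebesgue"
  shows "(\<lambda>z::'a \<times> 'a. u (fst z)) \<in> borel_measurable lebesgue"
    and "(\<lambda>z::'a \<times> 'a. u (snd z)) \<in> borel_measurable lebesgue"
proof -
  obtain u' where [measurable]: "u' \<in> borel_measurable borel" and "AE x in lborel. u x = u' x"
    using completion_ex_borel_measurable_real[OF assms] by auto
  then have ae: "AE z in lebesgue. u (fst z) = u' (fst z) \<and> u (snd z) = u' (snd (z :: 'a \<times> 'a))"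
    by (intro AE_lebesgue_prod AE_completion)
  have m: "(\<lambda>z::'a \<times> 'a. u' (fst z)) \<in> borel_measurable borel" "(\<lambda>z::'a \<times> 'a. u' (snd z)) \<in> borel_measurable borel"
    by (simp_all add: borel_prod[symmetric])
  show "(\<lambda>z::'a \<times> 'a. u (fst z)) \<in> borel_measurable lebesgue"
    by (rule borel_measurable_AE[of "\<lambda>z. u' (fst z)"]) (use m ae in \<open>auto intro: measurable_completion\<close>)
  show "(\<lambda>z::'a \<times> 'a. u (snd z)) \<in> borel_measurable lebesgue"
    by (rule borel_measurable_AE[of "\<lambda>z. u' (snd z)"]) (use m ae in \<open>auto intro: measurable_completion\<close>)
qed

definition incr :: "('a \<Rightarrow> real) \<Rightarrow> 'a \<times> 'a \<Rightarrow> real" where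
  "incr u z = u (fst z) - u (snd z)"

lemma incr_measurable:
  "u \<in> borel_measurable lebesgue \<Longrightarrow> incr (u :: 'a::euclidean_space \<Rightarrow> real) \<in> borel_measurable lebesgue"
  unfolding incr_def[abs_def] by (intro borel_measurable_diff borel_measurable_lebesgue_proj)

definition energy_weight :: "real \<Rightarrow> real \<Rightarrow> 'a::euclidean_space set \<Rightarrow> 'a \<times> 'a \<Rightarrow> real" where
  "energy_weight p \<alpha> \<Omega> z = indicator (Q_set \<Omega>) z / norm (fst z - snd z) powr (real DIM('a) + p * \<alpha>)"

text \<open>Moving kernel and domain into a density turns the energy of u into the p-th power of the
  L^p norm of \<open>incr u\<close>. The map from u to \<open>incr u\<close> is linear, so all facts
  about \<open>Lp_tendsto\<close> apply to the energy; \<open>hardy_measure\<close> serves the same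
  purpose for the Hardy term.\<close>

definition energy_measure :: "real \<Rightarrow> real \<Rightarrow> 'a::euclidean_space set \<Rightarrow> ('a \<times> 'a) measure" where
  "energy_measure p \<alpha> \<Omega> = density lebesgue (\<lambda>z. ennreal (energy_weight p \<alpha> \<Omega> z))"

definition hardy_weight :: "real \<Rightarrow> real \<Rightarrow> 'a::euclidean_space set \<Rightarrow> 'a \<Rightarrow> real" where
  "hardy_weight p \<alpha> \<Omega> x = indicator \<Omega> x / norm x powr (p * \<alpha>)"

definition hardy_measure :: "real \<Rightarrow> real \<Rightarrow> 'a::euclidean_space set \<Rightarrow> 'a measure" where
  "hardy_measure p \<alpha> \<Omega> = density lebesgue (\<lambda>x. ennreal (hardy_weight p \<alpha> \<Omega> x))"

lemma Q_set_borel: "open \<Omega> \<Longrightarrow> Q_set (\<Omega> :: 'a::euclidean_space set) \<in> sets borel"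
  unfolding Q_set_def Diff_UNIV
  by (intro borel_open open_Diff open_UNIV closed_Times) (auto simp: closed_def Diff_Diff_Int)

lemma weight_nonneg: "energy_weight p \<alpha> \<Omega> z \<ge> 0" "hardy_weight p \<alpha> \<Omega> x \<ge> 0"
  by (simp_all add: energy_weight_def hardy_weight_def)

lemma weight_measurable:
  assumes "open (\<Omega> :: 'a::euclidean_space set)"
  shows "energy_weight p \<alpha> \<Omega> \<in> borel_measurable lebesgue" "hardy_weight p \<alpha> \<Omega> \<in> borel_measurable lebesgue"
proof -
  have [measurable]: "Q_set \<Omega> \<in> sets borel" "\<Omega> \<in> sets borel"
    using assms Q_set_borel by (auto intro: borel_open)
  have "(\<lambda>z::'a \<times> 'a. norm (fst z - snd z) powr (real DIM('a) + p * \<alpha>)) \<in> borel_measurable borel"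
    by (simp add: borel_prod[symmetric])
  then have "energy_weight p \<alpha> \<Omega> \<in> borel_measurable borel"
    unfolding energy_weight_def[abs_def] by measurable
  then show "energy_weight p \<alpha> \<Omega> \<in> borel_measurable lebesgue" by (auto intro: measurable_completion)
  have "hardy_weight p \<alpha> \<Omega> \<in> borel_measurable borel"
    unfolding hardy_weight_def[abs_def] by measurable
  then show "hardy_weight p \<alpha> \<Omega> \<in> borel_measurable lebesgue" by (auto intro: measurable_completion)
qed

lemma energy_measure_integral:
  fixes \<Omega> :: "'a::euclidean_space set" and F :: "'a \<times> 'a \<Rightarrow> real"
  assumes "open \<Omega>" and F: "F \<in> borel_measurable lebesgue"
  shows "(\<integral>z. F z \<partial>energy_measure p \<alpha> \<Omega>) =
        (LINT (x, y):Q_set \<Omega>|lebesgue. F (x, y) / norm (x - y) powr (real DIM('a) + p * \<alpha>))"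
  unfolding energy_measure_def set_lebesgue_integral_def
  by (subst integral_density[OF F weight_measurable(1)[OF assms(1)]])
    (auto simp: weight_nonneg energy_weight_def split_beta intro!: Bochner_Integration.integral_cong)

lemma hardy_measure_integral:
  fixes \<Omega> :: "'a::euclidean_space set" and f :: "'a \<Rightarrow> real"
  assumes "open \<Omega>" and f: "f \<in> borel_measurable lebesgue"
  shows "(\<integral>x. f x \<partial>hardy_measure p \<alpha> \<Omega>) = (LINT x:\<Omega>|lebesgue. f x / norm x powr (p * \<alpha>))"
  unfolding hardy_measure_def set_lebesgue_integral_def
  by (subst integral_density[OF f weight_measurable(2)[OF assms(1)]])
    (auto simp: weight_nonneg hardy_weight_def intro!: Bochner_Integration.integral_cong)

lemma AE_energy_measure:
  assumes "open \<Omega>" and "AE x in lebesgue. P (x::'a::euclidean_space)"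
  shows "AE z in energy_measure p \<alpha> \<Omega>. P (fst z) \<and> P (snd z)"
  unfolding energy_measure_def
  using AE_lebesgue_prod[OF assms(2)] weight_measurable(1)[OF assms(1), of p \<alpha>]
  by (subst AE_density) (auto elim: eventually_mono)

lemma AE_hardy_measure:
  assumes "open \<Omega>" and "AE x in lebesgue. P (x::'a::euclidean_space)"
  shows "AE x in hardy_measure p \<alpha> \<Omega>. P x"
  unfolding hardy_measure_def
  using assms(2) weight_measurable(2)[OF assms(1), of p \<alpha>]
  by (subst AE_density) (auto elim: eventually_mono)

lemma measurable_energy_measure [simp]:
  "borel_measurable (energy_measure p \<alpha> \<Omega>) = borel_measurable lebesgue"
  by (intro measurable_cong_sets) (simp_all add: energy_measure_def)

lemma measurable_hardy_measure [simp]: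
  "borel_measurable (hardy_measure p \<alpha> \<Omega>) = borel_measurable lebesgue"
  by (intro measurable_cong_sets) (simp_all add: hardy_measure_def)

lemma frac_energy_eq:
  assumes "open \<Omega>" "u \<in> borel_measurable lebesgue"
  shows "frac_energy p \<alpha> \<Omega> u = (\<integral>z. \<bar>incr u z\<bar> powr p \<partial>energy_measure p \<alpha> \<Omega>)"
proof -
  have [measurable]: "incr u \<in> borel_measurable lebesgue" using assms(2) by (rule incr_measurable)
  have "(\<lambda>z. \<bar>incr u z\<bar> powr p) \<in> borel_measurable lebesgue" by measurable
  from energy_measure_integral[OF assms(1) this] show ?thesis
    by (simp add: frac_energy_def incr_def)
qed

lemma hardy_integral_eq:
  assumes "open \<Omega>" "u \<in> borel_measurable lebesgue"
  shows "hardy_integral p \<alpha> \<Omega> u = (\<integral>x. \<bar>u x\<bar> powr p \<partial>hardy_measure p \<alpha> \<Omega>)"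
proof -
  have [measurable]: "u \<in> borel_measurable lebesgue" by (rule assms(2))
  have "(\<lambda>x. \<bar>u x\<bar> powr p) \<in> borel_measurable lebesgue" by measurable
  from hardy_measure_integral[OF assms(1) this] show ?thesis
    by (simp add: hardy_integral_def)
qed

section \<open>Core functions and the space \<open>X0\<close>\<close>

lemma X0_core_D:
  assumes "\<phi> \<in> X0_core \<Omega>"
  shows "C_k k \<phi>" "compact (closure {x. \<phi> x \<noteq> 0})" "\<phi> \<in> C_c_inf UNIV" "x \<notin> \<Omega> \<Longrightarrow> \<phi> x = 0"
    and "\<phi> \<in> borel_measurable borel" "\<phi> \<in> borel_measurable lebesgue"
proof -
  show "C_k k \<phi>" "compact (closure {x. \<phi> x \<noteq> 0})" and *: "\<phi> \<in> C_c_inf UNIV" and "x \<notin> \<Omega> \<Longrightarrow> \<phi> x = 0"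
    using assms unfolding X0_core_def C_c_inf_def by blast+
  show "\<phi> \<in> borel_measurable borel" using C_c_inf_borel[OF *] .
  then show "\<phi> \<in> borel_measurable lebesgue" by (auto intro: measurable_completion)
qed

lemma closure_support_subset:
  assumes "\<And>x. f x \<noteq> (0::real) \<Longrightarrow> x \<in> K" "compact (K :: 'a::euclidean_space set)"
  shows "compact (closure {x. f x \<noteq> 0})" "closure {x. f x \<noteq> 0} \<subseteq> K"
proof -
  show sub: "closure {x. f x \<noteq> 0} \<subseteq> K"
    using assms by (intro closure_minimal) (auto simp: compact_imp_closed)
  show "compact (closure {x. f x \<noteq> 0})"
    using compact_Int_closed[OF assms(2), of "closure {x. f x \<noteq> 0}"] sub by (simp add: Int_absorb1)
qed

text \<open>Made for functions of the form f (\<phi>1 x) (\<phi>2 x) with f 0 0 = 0: they vanish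
  outside the union of two compact supports and outside \<Omega>.\<close>

lemma X0_core_I:
  assumes "\<And>k. C_k k \<psi>" and "\<phi>1 \<in> X0_core \<Omega>" and "\<phi>2 \<in> X0_core \<Omega>"
    and zero: "\<And>x. \<phi>1 x = 0 \<Longrightarrow> \<phi>2 x = 0 \<Longrightarrow> \<psi> x = 0"
  shows "\<psi> \<in> X0_core \<Omega>"
proof -
  let ?K = "closure {x. \<phi>1 x \<noteq> 0} \<union> closure {x. \<phi>2 x \<noteq> 0}"
  have "x \<in> ?K" if "\<psi> x \<noteq> 0" for x
    using zero[of x] that closure_subset[of "{x. \<phi>1 x \<noteq> 0}"] closure_subset[of "{x. \<phi>2 x \<noteq> 0}"] by auto
  moreover have "compact ?K" using assms X0_core_D(2) by (intro compact_Un)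
  ultimately have "compact (closure {x. \<psi> x \<noteq> 0})" by (rule closure_support_subset(1))
  moreover have "\<psi> x = 0" if "x \<notin> \<Omega>" for x
    using zero[of x] X0_core_D(4)[OF assms(2) that] X0_core_D(4)[OF assms(3) that] by simp
  ultimately show ?thesis using assms(1) unfolding X0_core_def C_c_inf_def by simp
qed

lemma X0_core_diff: "\<phi> \<in> X0_core \<Omega> \<Longrightarrow> \<psi> \<in> X0_core \<Omega> \<Longrightarrow> (\<lambda>x. \<phi> x - \<psi> x) \<in> X0_core \<Omega>"
  by (rule X0_core_I[of _ \<phi> _ \<psi>]) (auto intro: C_k_diff X0_core_D(1))

locale fractional_setting =
  fixes p \<alpha> :: real and \<Omega> :: "'a::euclidean_space set"
  assumes p: "2 \<le> p" and \<alpha>: "0 < \<alpha>" "\<alpha> < 1" and dim: "p * \<alpha> < real DIM('a)" and \<Omega>: "open \<Omega>"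
begin

abbreviation "E \<equiv> energy_measure p \<alpha> \<Omega>"
abbreviation "H \<equiv> hardy_measure p \<alpha> \<Omega>"

lemmas frac_eq = frac_energy_eq[OF \<Omega>, of _ p \<alpha>]
lemmas hardy_eq = hardy_integral_eq[OF \<Omega>, of _ p \<alpha>]

text \<open>\<open>frac_energy\<close> and \<open>hardy_integral\<close> return 0 on non-integrable
  integrands. Integrability on the core, which is closed under differences, is what gives the Cauchy
  condition in \<open>X0\<close> its intended meaning.\<close>

lemma core_integrable:
  assumes "\<phi> \<in> X0_core \<Omega>"
  shows "integrable E (\<lambda>z. \<bar>incr \<phi> z\<bar> powr p)" and "integrable H (\<lambda>x. \<bar>\<phi> x\<bar> powr p)"
proof -
  obtain L B R where \<phi>: "L \<ge> 0" "\<And>x y. \<bar>\<phi> x - \<phi> y\<bar> \<le> L * norm (x - y)" "\<And>x. \<bar>\<phi> x\<bar> \<le> B"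
    "\<And>x. x \<notin> cball 0 R \<Longrightarrow> \<phi> x = 0"
    using C_c_inf_props[OF X0_core_D(3)[OF assms]] by metis
  have [measurable]: "\<phi> \<in> borel_measurable borel" using X0_core_D(5)[OF assms] .
  have B: "B \<ge> 0" using \<phi>(3)[of 0] by linarith
  have m: "incr \<phi> \<in> borel_measurable lebesgue" using X0_core_D(6)[OF assms] by (rule incr_measurable)
  show "integrable E (\<lambda>z. \<bar>incr \<phi> z\<bar> powr p)"
    unfolding energy_measure_def
  proof (subst integrable_density)
    show "integrable lebesgue (\<lambda>z. energy_weight p \<alpha> \<Omega> z *\<^sub>R \<bar>incr \<phi> z\<bar> powr p)"
    proof (rule integrableI_bounded)
      have "(\<integral>\<^sup>+z. ennreal (norm (energy_weight p \<alpha> \<Omega> z *\<^sub>R \<bar>incr \<phi> z\<bar> powr p)) \<partial>lebesgue) \<le>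
         (\<integral>\<^sup>+z. ennreal (\<bar>\<phi> (fst z) - \<phi> (snd z)\<bar> powr p / norm (fst z - snd z) powr (real DIM('a) + p * \<alpha>)) \<partial>lebesgue)"
        by (intro nn_integral_mono ennreal_leI) (simp add: energy_weight_def incr_def indicator_def)
      also have "\<dots> < \<infinity>"
        unfolding nn_integral_completion
        using p \<alpha> \<phi> by (intro nn_integral_energy_finite[of _ _ _ L B R]) auto
      finally show "(\<integral>\<^sup>+z. ennreal (norm (energy_weight p \<alpha> \<Omega> z *\<^sub>R \<bar>incr \<phi> z\<bar> powr p)) \<partial>lebesgue) < \<infinity>" .
    qed (use m weight_measurable(1)[OF \<Omega>] in measurable)
    show "AE z in lebesgue. 0 \<le> energy_weight p \<alpha> \<Omega> z" by (intro AE_I2 weight_nonneg)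
  qed (use m weight_measurable(1)[OF \<Omega>] in simp_all)
  have m': "\<phi> \<in> borel_measurable lebesgue" using X0_core_D(6)[OF assms] .
  show "integrable H (\<lambda>x. \<bar>\<phi> x\<bar> powr p)"
    unfolding hardy_measure_def
  proof (subst integrable_density)
    show "integrable lebesgue (\<lambda>x. hardy_weight p \<alpha> \<Omega> x *\<^sub>R \<bar>\<phi> x\<bar> powr p)"
    proof (rule integrableI_bounded)
      have "(\<integral>\<^sup>+x. ennreal (norm (hardy_weight p \<alpha> \<Omega> x *\<^sub>R \<bar>\<phi> x\<bar> powr p)) \<partial>lebesgue) \<le>
         (\<integral>\<^sup>+x. ennreal (B powr p / norm (x::'a) powr (p * \<alpha>)) * indicator (cball 0 R) x \<partial>lebesgue)"
      proof (rule nn_integral_mono)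
        fix x :: 'a
        have "hardy_weight p \<alpha> \<Omega> x *\<^sub>R \<bar>\<phi> x\<bar> powr p \<le> B powr p / norm x powr (p * \<alpha>)"
          using powr_mono2[of p "\<bar>\<phi> x\<bar>" B] \<phi>(3)[of x] p
          by (simp add: hardy_weight_def indicator_def divide_right_mono)
        then show "ennreal (norm (hardy_weight p \<alpha> \<Omega> x *\<^sub>R \<bar>\<phi> x\<bar> powr p)) \<le>
            ennreal (B powr p / norm x powr (p * \<alpha>)) * indicator (cball 0 R) x"
          using \<phi>(4)[of x] weight_nonneg(2)[of p \<alpha> \<Omega> x]
          by (cases "x \<in> cball 0 R") (simp_all add: ennreal_leI abs_mult del: mem_cball mem_cball_0)
      qed
      also have "\<dots> < \<infinity>"
        unfolding nn_integral_completion
        using p \<alpha> dim by (intro nn_integral_hardy_kernel_finite) auto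
      finally show "(\<integral>\<^sup>+x. ennreal (norm (hardy_weight p \<alpha> \<Omega> x *\<^sub>R \<bar>\<phi> x\<bar> powr p)) \<partial>lebesgue) < \<infinity>" .
    qed (use m' weight_measurable(2)[OF \<Omega>] in measurable)
    show "AE z in lebesgue. 0 \<le> hardy_weight p \<alpha> \<Omega> z" by (intro AE_I2 weight_nonneg)
  qed (use m' weight_measurable(2)[OF \<Omega>] in simp_all)
qed

text \<open>Pairs outside \<open>Q_set\<close> \<Omega> and points outside \<Omega> contribute 0, so
  the Hardy inequality on the whole space can be used on \<Omega>.\<close>

lemma core_integrals_UNIV:
  assumes "\<phi> \<in> X0_core \<Omega>"
  shows "frac_energy p \<alpha> UNIV \<phi> = frac_energy p \<alpha> \<Omega> \<phi>" "hardy_integral p \<alpha> UNIV \<phi> = hardy_integral p \<alpha> \<Omega> \<phi>"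
proof -
  have z: "\<phi> x = 0" if "x \<notin> \<Omega>" for x using X0_core_D(4)[OF assms that] .
  show "frac_energy p \<alpha> UNIV \<phi> = frac_energy p \<alpha> \<Omega> \<phi>"
    unfolding frac_energy_def set_lebesgue_integral_def
    by (intro Bochner_Integration.integral_cong refl) (auto simp: Q_set_def indicator_def z)
  show "hardy_integral p \<alpha> UNIV \<phi> = hardy_integral p \<alpha> \<Omega> \<phi>"
    unfolding hardy_integral_def set_lebesgue_integral_def
    by (intro Bochner_Integration.integral_cong refl) (auto simp: indicator_def z)
qed

text \<open>A sequence convergent in L^p is Cauchy there, and the L^p norm of increments is
  \<open>X0_norm\<close>. Membership in \<open>X0\<close> thus reduces to \<open>Lp_tendsto\<close>
  of increments.\<close>

lemma X0_I:
  assumes \<phi>: "\<And>k. \<phi> k \<in> X0_core \<Omega>" and w: "w \<in> borel_measurable lebesgue"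
    and lim: "AE x in lebesgue. (\<lambda>k. \<phi> k x) \<longlonglongrightarrow> w x"
    and Lp: "Lp_tendsto p E (\<lambda>k. incr (\<phi> k)) (incr w)"
  shows "w \<in> X0 p \<alpha> \<Omega>"
proof -
  have "\<exists>N. \<forall>j\<ge>N. \<forall>k\<ge>N. X0_norm p \<alpha> \<Omega> (\<lambda>x. \<phi> j x - \<phi> k x) < \<epsilon>" if "\<epsilon> > 0" for \<epsilon>
  proof -
    \<comment> \<open>Two errors below e, amplified by the 2^p of \<open>powr_add_le\<close>, stay
      below \<epsilon>^p.\<close>
    define e where "e = \<epsilon> powr p / (2 * 2 powr p)"
    have "e > 0" using that by (simp add: e_def)
    have lim0: "(\<lambda>i. \<integral>z. \<bar>incr (\<phi> i) z - incr w z\<bar> powr p \<partial>E) \<longlonglongrightarrow> 0"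
      and int: "\<And>i. integrable E (\<lambda>z. \<bar>incr (\<phi> i) z - incr w z\<bar> powr p)"
      using Lp unfolding Lp_tendsto_def by blast+
    obtain N where N0: "\<And>i. i \<ge> N \<Longrightarrow> norm ((\<integral>z. \<bar>incr (\<phi> i) z - incr w z\<bar> powr p \<partial>E) - 0) < e"
      using LIMSEQ_D[OF lim0 \<open>e > 0\<close>] by blast
    have N: "(\<integral>z. \<bar>incr (\<phi> i) z - incr w z\<bar> powr p \<partial>E) < e" if "i \<ge> N" for i
      using N0[OF that] by (simp only: real_norm_def diff_zero abs_less_iff)
    have "X0_norm p \<alpha> \<Omega> (\<lambda>x. \<phi> j x - \<phi> k x) < \<epsilon>" if "j \<ge> N" "k \<ge> N" for j k
    proof -
      have core: "(\<lambda>x. \<phi> j x - \<phi> k x) \<in> X0_core \<Omega>" using \<phi> by (intro X0_core_diff)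
      have "frac_energy p \<alpha> \<Omega> (\<lambda>x. \<phi> j x - \<phi> k x) = (\<integral>z. \<bar>incr (\<lambda>x. \<phi> j x - \<phi> k x) z\<bar> powr p \<partial>E)"
        using X0_core_D(6)[OF core] by (rule frac_eq)
      also have "\<dots> \<le> (\<integral>z. 2 powr p * (\<bar>incr (\<phi> j) z - incr w z\<bar> powr p + \<bar>incr (\<phi> k) z - incr w z\<bar> powr p) \<partial>E)"
      proof (rule integral_mono)
        fix z
        have "\<bar>incr (\<lambda>x. \<phi> j x - \<phi> k x) z\<bar> powr p \<le> (\<bar>incr (\<phi> j) z - incr w z\<bar> + \<bar>incr (\<phi> k) z - incr w z\<bar>) powr p"
          using p by (intro powr_mono2) (auto simp: incr_def)
        also have "\<dots> \<le> 2 powr p * (\<bar>incr (\<phi> j) z - incr w z\<bar> powr p + \<bar>incr (\<phi> k) z - incr w z\<bar> powr p)"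
          using p by (intro powr_add_le) auto
        finally show "\<bar>incr (\<lambda>x. \<phi> j x - \<phi> k x) z\<bar> powr p \<le>
          2 powr p * (\<bar>incr (\<phi> j) z - incr w z\<bar> powr p + \<bar>incr (\<phi> k) z - incr w z\<bar> powr p)" .
      qed (use int core_integrable(1)[OF core] in auto)
      also have "\<dots> = 2 powr p * ((\<integral>z. \<bar>incr (\<phi> j) z - incr w z\<bar> powr p \<partial>E) + (\<integral>z. \<bar>incr (\<phi> k) z - incr w z\<bar> powr p \<partial>E))"
        using int by simp
      also have "\<dots> < 2 powr p * (e + e)"
        using N[OF that(1)] N[OF that(2)] by (intro mult_strict_left_mono add_strict_mono) auto
      also have "\<dots> = \<epsilon> powr p" by (simp add: e_def)
      finally have lt: "frac_energy p \<alpha> \<Omega> (\<lambda>x. \<phi> j x - \<phi> k x) < \<epsilon> powr p" .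
      have "frac_energy p \<alpha> \<Omega> (\<lambda>x. \<phi> j x - \<phi> k x) \<ge> 0"
        unfolding frac_eq[OF X0_core_D(6)[OF core]] by simp
      then have "X0_norm p \<alpha> \<Omega> (\<lambda>x. \<phi> j x - \<phi> k x) < (\<epsilon> powr p) powr (1 / p)"
        unfolding X0_norm_def using lt p by (intro powr_less_mono2) auto
      then show ?thesis using p \<open>\<epsilon> > 0\<close> by (simp add: powr_powr)
    qed
    then show ?thesis by blast
  qed
  then show ?thesis using \<phi> w lim unfolding X0_def by blast
qed

end

text \<open>C is some positive constant admissible in the Hardy inequality rather than the supremum,
  so that attainment of the supremum is not an issue.\<close>

locale hardy_setting = fractional_setting +
  fixes C :: real
  assumes C: "C > 0"
    and hardy: "\<And>\<phi>. \<phi> \<in> C_c_inf UNIV \<Longrightarrow> C * hardy_integral p \<alpha> UNIV \<phi> \<le> frac_energy p \<alpha> (UNIV :: 'a set) \<phi>"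
begin

lemma hardy_core:
  assumes "\<phi> \<in> X0_core \<Omega>"
  shows "C * (\<integral>x. \<bar>\<phi> x\<bar> powr p \<partial>H) \<le> (\<integral>z. \<bar>incr \<phi> z\<bar> powr p \<partial>E)"
  using hardy[OF X0_core_D(3)[OF assms]]
  unfolding core_integrals_UNIV[OF assms] frac_eq[OF X0_core_D(6)[OF assms]] hardy_eq[OF X0_core_D(6)[OF assms]] .

text \<open>Cauchy in \<open>X0_norm\<close> means Cauchy increments in L^p of E, and the Hardy
  inequality applied to differences makes the functions themselves Cauchy in L^p of H. The given
  a.e. limit identifies both L^p limits.\<close>

lemma X0_D:
  assumes "u \<in> X0 p \<alpha> \<Omega>"
  obtains \<phi> where "\<And>k. \<phi> k \<in> X0_core \<Omega>" "AE x in lebesgue. (\<lambda>k. \<phi> k x) \<longlonglongrightarrow> u x"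
    "Lp_tendsto p E (\<lambda>k. incr (\<phi> k)) (incr u)" "Lp_tendsto p H \<phi> u" "u \<in> borel_measurable lebesgue"
proof -
  obtain \<phi> where \<phi>: "\<And>k. \<phi> k \<in> X0_core \<Omega>" and lim: "AE x in lebesgue. (\<lambda>k. \<phi> k x) \<longlonglongrightarrow> u x"
    and u: "u \<in> borel_measurable lebesgue"
    and Cau: "\<And>\<epsilon>. \<epsilon> > 0 \<Longrightarrow> \<exists>N. \<forall>j\<ge>N. \<forall>k\<ge>N. X0_norm p \<alpha> \<Omega> (\<lambda>x. \<phi> j x - \<phi> k x) < \<epsilon>"
    using assms unfolding X0_def by blast
  have eq: "incr (\<lambda>x. \<phi> j x - \<phi> k x) z = incr (\<phi> j) z - incr (\<phi> k) z" for j k z by (simp add: incr_def)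
  have m: "\<phi> k \<in> borel_measurable lebesgue" for k using X0_core_D(6)[OF \<phi>] .
  have small: "\<exists>N. \<forall>j\<ge>N. \<forall>k\<ge>N. (\<integral>z. \<bar>incr (\<phi> j) z - incr (\<phi> k) z\<bar> powr p \<partial>E) < e" if "e > 0" for e
  proof -
    obtain N where N: "\<And>j k. j \<ge> N \<Longrightarrow> k \<ge> N \<Longrightarrow> X0_norm p \<alpha> \<Omega> (\<lambda>x. \<phi> j x - \<phi> k x) < e powr (1 / p)"
      using Cau[of "e powr (1 / p)"] \<open>e > 0\<close> by auto
    have "(\<integral>z. \<bar>incr (\<phi> j) z - incr (\<phi> k) z\<bar> powr p \<partial>E) < e" if "j \<ge> N" "k \<ge> N" for j k
    proof (rule ccontr)
      assume "\<not> ?thesis"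
      then have "e \<le> frac_energy p \<alpha> \<Omega> (\<lambda>x. \<phi> j x - \<phi> k x)"
        using frac_eq[OF X0_core_D(6)[OF X0_core_diff[OF \<phi> \<phi>]], of j k] by (simp add: eq)
      then have "e powr (1 / p) \<le> X0_norm p \<alpha> \<Omega> (\<lambda>x. \<phi> j x - \<phi> k x)"
        unfolding X0_norm_def using p \<open>e > 0\<close> by (intro powr_mono2) auto
      then show False using N[OF that] by simp
    qed
    then show ?thesis by blast
  qed
  have "Lp_tendsto p E (\<lambda>k. incr (\<phi> k)) (incr u)"
  proof (rule Lp_tendsto_Cauchy)
    show "AE z in E. (\<lambda>k. incr (\<phi> k) z) \<longlonglongrightarrow> incr u z"
      using AE_energy_measure[OF \<Omega> lim, of p \<alpha>]
      by eventually_elim (auto simp: incr_def intro: tendsto_diff)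
  qed (use small m u p core_integrable(1)[OF \<phi>] in \<open>auto intro: incr_measurable\<close>)
  moreover have "Lp_tendsto p H \<phi> u"
  proof (rule Lp_tendsto_Cauchy)
    show "\<exists>N. \<forall>j\<ge>N. \<forall>k\<ge>N. (\<integral>x. \<bar>\<phi> j x - \<phi> k x\<bar> powr p \<partial>H) < e" if "e > 0" for e
    proof -
      obtain N where N: "\<And>j k. j \<ge> N \<Longrightarrow> k \<ge> N \<Longrightarrow> (\<integral>z. \<bar>incr (\<phi> j) z - incr (\<phi> k) z\<bar> powr p \<partial>E) < C * e"
        using small[of "C * e"] C \<open>e > 0\<close> by auto
      have "(\<integral>x. \<bar>\<phi> j x - \<phi> k x\<bar> powr p \<partial>H) < e" if "j \<ge> N" "k \<ge> N" for j k
      proof -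
        have "C * (\<integral>x. \<bar>\<phi> j x - \<phi> k x\<bar> powr p \<partial>H) < C * e"
          using hardy_core[OF X0_core_diff[OF \<phi> \<phi>], of j k] N[OF that] unfolding eq by linarith
        then show ?thesis using C by simp
      qed
      then show ?thesis by blast
    qed
    show "AE x in H. (\<lambda>k. \<phi> k x) \<longlonglongrightarrow> u x" using lim by (rule AE_hardy_measure[OF \<Omega>])
  qed (use m u p core_integrable(2)[OF \<phi>] in auto)
  ultimately show thesis using that \<phi> lim u by blast
qed

lemma X0_zero_outside:
  assumes "u \<in> X0 p \<alpha> \<Omega>"
  shows "AE x in lebesgue. x \<notin> \<Omega> \<longrightarrow> u x = 0"
proof -
  obtain \<phi> where \<phi>: "\<And>k. \<phi> k \<in> X0_core \<Omega>" "AE x in lebesgue. (\<lambda>k. \<phi> k x) \<longlonglongrightarrow> u x"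
    using X0_D[OF assms] by metis
  show ?thesis using \<phi>(2)
  proof eventually_elim
    case (elim x)
    show ?case
    proof
      assume "x \<notin> \<Omega>"
      then have "\<phi> k x = 0" for k using X0_core_D(4)[OF \<phi>(1)] by simp
      then show "u x = 0" using elim LIMSEQ_const_iff[of 0 "u x"] by simp
    qed
  qed
qed

lemma X0_integrable:
  assumes "u \<in> X0 p \<alpha> \<Omega>"
  shows "integrable E (\<lambda>z. \<bar>incr u z\<bar> powr p)" "integrable H (\<lambda>x. \<bar>u x\<bar> powr p)"
    "u \<in> borel_measurable lebesgue"
  using X0_D[OF assms] unfolding Lp_tendsto_def by blast+

lemma hardy_X0:
  assumes "u \<in> X0 p \<alpha> \<Omega>"
  shows "C * hardy_integral p \<alpha> \<Omega> u \<le> frac_energy p \<alpha> \<Omega> u"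
proof -
  obtain \<phi> where \<phi>: "\<And>k. \<phi> k \<in> X0_core \<Omega>" "Lp_tendsto p E (\<lambda>k. incr (\<phi> k)) (incr u)" "Lp_tendsto p H \<phi> u"
    and u: "u \<in> borel_measurable lebesgue"
    using X0_D[OF assms] by metis
  have "(\<lambda>k. \<integral>z. \<bar>incr (\<phi> k) z\<bar> powr p \<partial>E) \<longlonglongrightarrow> (\<integral>z. \<bar>incr u z\<bar> powr p \<partial>E)"
    and "(\<lambda>k. C * (\<integral>x. \<bar>\<phi> k x\<bar> powr p \<partial>H)) \<longlonglongrightarrow> C * (\<integral>x. \<bar>u x\<bar> powr p \<partial>H)"
    using Lp_tendsto_integral(2)[OF \<phi>(2)] Lp_tendsto_integral(2)[OF \<phi>(3)] p by (auto intro: tendsto_mult_left)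
  then have "C * (\<integral>x. \<bar>u x\<bar> powr p \<partial>H) \<le> (\<integral>z. \<bar>incr u z\<bar> powr p \<partial>E)"
    using hardy_core[OF \<phi>(1)] by (intro LIMSEQ_le) auto
  then show ?thesis using frac_eq[OF u] hardy_eq[OF u] by simp
qed

lemma J_nonneg:
  assumes "u \<in> X0 p \<alpha> \<Omega>" "0 \<le> \<mu>" "\<mu> \<le> C"
  shows "J p \<alpha> \<mu> \<Omega> u \<ge> 0"
proof -
  have "hardy_integral p \<alpha> \<Omega> u \<ge> 0" using hardy_eq[OF X0_integrable(3)[OF assms(1)]] by simp
  then have "\<mu> * hardy_integral p \<alpha> \<Omega> u \<le> C * hardy_integral p \<alpha> \<Omega> u" using assms by (intro mult_right_mono)
  then show ?thesis using hardy_X0[OF assms(1)] by (simp add: J_def)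
qed

end

section \<open>Strict convexity of the power norm on the plane\<close>

text \<open>A zero argument is treated apart, through s powr q <= s for 0 < s < 1.\<close>

lemma powr_convex_nonneg:
  assumes "q \<ge> 1" "0 \<le> x" "0 \<le> y" "0 < t" "t < (1::real)"
  shows "(t * x + (1 - t) * y) powr q \<le> t * x powr q + (1 - t) * y powr q"
proof -
  have one: "(s * z) powr q \<le> s * z powr q" if "0 < s" "s < 1" "z \<ge> 0" for s z :: real
  proof -
    have "s powr q \<le> s powr 1" using that assms(1) by (intro powr_mono') auto
    then have "s powr q * z powr q \<le> s * z powr q" using that by (intro mult_right_mono) auto
    then show ?thesis using that by (simp add: powr_mult)
  qed
  consider "x = 0" | "y = 0" | "x > 0" "y > 0" using assms by linarith
  then show ?thesis
  proof cases
    case 1 then show ?thesis using one[of "1 - t" y] assms by simp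
  next
    case 2 then show ?thesis using one[of t x] assms by simp
  next
    case 3
    have "((1 - t) *\<^sub>R y + t *\<^sub>R x) powr q \<le> (1 - t) * y powr q + t * x powr q"
      using 3 assms by (intro convex_onD[OF powr_convex[OF assms(1)]]) auto
    then show ?thesis by (simp add: add.commute)
  qed
qed

lemma abs_powr_eq_square_powr: "\<bar>z\<bar> powr p = (z\<^sup>2) powr (p / 2)" for z :: real
proof (cases "z = 0")
  case False
  then have "z\<^sup>2 = \<bar>z\<bar> powr 2" using powr_numeral[of "\<bar>z\<bar>"] by simp
  then have "(z\<^sup>2) powr (p / 2) = \<bar>z\<bar> powr (2 * (p / 2))" by (simp only: powr_powr)
  then show ?thesis by simp
qed simp

text \<open>Strictness comes from the square: the convexity defect of z^2 is exactly t (1 - t) (x -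
  y)^2. The power p / 2 >= 1 is then strictly increasing and convex on the nonnegative
  reals.\<close>

lemma abs_powr_strict_convex:
  assumes "p \<ge> 2" "0 < t" "t < (1::real)" "x \<noteq> y"
  shows "\<bar>t * x + (1 - t) * y\<bar> powr p < t * \<bar>x\<bar> powr p + (1 - t) * \<bar>y\<bar> powr p"
proof -
  note sq = abs_powr_eq_square_powr
  have "t * x\<^sup>2 + (1 - t) * y\<^sup>2 - (t * x + (1 - t) * y)\<^sup>2 = t * (1 - t) * (x - y)\<^sup>2" by algebra
  moreover have "t * (1 - t) * (x - y)\<^sup>2 > 0" using assms by (intro mult_pos_pos) auto
  ultimately have "(t * x + (1 - t) * y)\<^sup>2 < t * x\<^sup>2 + (1 - t) * y\<^sup>2" by linarith
  then have "((t * x + (1 - t) * y)\<^sup>2) powr (p / 2) < (t * x\<^sup>2 + (1 - t) * y\<^sup>2) powr (p / 2)"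
    using assms by (intro powr_less_mono2) auto
  also have "\<dots> \<le> t * (x\<^sup>2) powr (p / 2) + (1 - t) * (y\<^sup>2) powr (p / 2)"
    using assms by (intro powr_convex_nonneg) auto
  finally show ?thesis unfolding sq .
qed

lemma abs_powr_convex:
  assumes "p \<ge> 2" "0 < t" "t < (1::real)"
  shows "\<bar>t * x + (1 - t) * y\<bar> powr p \<le> t * \<bar>x\<bar> powr p + (1 - t) * \<bar>y\<bar> powr p"
proof (cases "x = y")
  case True
  have "t * z + (1 - t) * z = z" for z by (simp add: algebra_simps)
  then show ?thesis using True by simp
qed (use abs_powr_strict_convex[OF assms] in \<open>simp add: less_imp_le\<close>)

definition pnorm :: "real \<Rightarrow> real \<Rightarrow> real \<Rightarrow> real" where
  "pnorm p a b = (\<bar>a\<bar> powr p + \<bar>b\<bar> powr p) powr (1 / p)"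

lemma pnorm_nonneg: "pnorm p a b \<ge> 0"
  by (simp add: pnorm_def)

lemma pnorm_powr: "p > 0 \<Longrightarrow> pnorm p a b powr p = \<bar>a\<bar> powr p + \<bar>b\<bar> powr p"
  by (simp add: pnorm_def powr_powr)

lemma pnorm_eq_0: "p > 0 \<Longrightarrow> pnorm p a b = 0 \<longleftrightarrow> a = 0 \<and> b = 0"
  by (simp add: pnorm_def add_nonneg_eq_0_iff)

lemma pnorm_axis: "p > 0 \<Longrightarrow> pnorm p a 0 = \<bar>a\<bar>" "p > 0 \<Longrightarrow> pnorm p 0 a = \<bar>a\<bar>"
  by (simp_all add: pnorm_def powr_powr)

text \<open>After division by s + t the sum becomes a convex combination of two vectors of norm 1,
  with weight \<theta> = s / (s + t); convexity of |z|^p in each coordinate bounds its norm by 1. If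
  a d and b c differ, the unit vectors differ in some coordinate, and there the convexity is
  strict.\<close>

lemma pnorm_add:
  assumes "p \<ge> 2"
  shows "pnorm p (a + c) (b + d) \<le> pnorm p a b + pnorm p c d"
    and "a * d \<noteq> b * c \<Longrightarrow> pnorm p (a + c) (b + d) < pnorm p a b + pnorm p c d"
proof -
  define s t where "s = pnorm p a b" and "t = pnorm p c d"
  have "pnorm p (a + c) (b + d) \<le> s + t \<and> (a * d \<noteq> b * c \<longrightarrow> pnorm p (a + c) (b + d) < s + t)"
  proof (cases "s = 0 \<or> t = 0")
    case True
    then show ?thesis using assms by (auto simp: s_def t_def pnorm_eq_0 pnorm_nonneg)
  next
    case False
    then have st: "s > 0" "t > 0" using pnorm_nonneg[of p a b] pnorm_nonneg[of p c d] by (auto simp: s_def t_def)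
    define \<theta> where "\<theta> = s / (s + t)"
    have \<theta>: "0 < \<theta>" "\<theta> < 1" using st by (auto simp: \<theta>_def)
    have split: "(x + y) / (s + t) = \<theta> * (x / s) + (1 - \<theta>) * (y / t)" for x y
    proof -
      have "1 - \<theta> = t / (s + t)" using st by (simp add: \<theta>_def field_simps)
      then show ?thesis using st by (simp add: \<theta>_def add_divide_distrib)
    qed
    have unit: "\<bar>a / s\<bar> powr p + \<bar>b / s\<bar> powr p = 1" "\<bar>c / t\<bar> powr p + \<bar>d / t\<bar> powr p = 1"
    proof -
      have *: "\<bar>x / r\<bar> powr p + \<bar>y / r\<bar> powr p = (\<bar>x\<bar> powr p + \<bar>y\<bar> powr p) / r powr p" if "r > 0" for x y r
        using that by (simp add: powr_divide add_divide_distrib)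
      show "\<bar>a / s\<bar> powr p + \<bar>b / s\<bar> powr p = 1"
        unfolding *[OF st(1)] using assms st pnorm_powr[of p a b, folded s_def, symmetric] by simp
      show "\<bar>c / t\<bar> powr p + \<bar>d / t\<bar> powr p = 1"
        unfolding *[OF st(2)] using assms st pnorm_powr[of p c d, folded t_def, symmetric] by simp
    qed
    have sum: "\<theta> * \<bar>a / s\<bar> powr p + (1 - \<theta>) * \<bar>c / t\<bar> powr p + (\<theta> * \<bar>b / s\<bar> powr p + (1 - \<theta>) * \<bar>d / t\<bar> powr p) = 1"
    proof -
      have "\<theta> * \<bar>a / s\<bar> powr p + (1 - \<theta>) * \<bar>c / t\<bar> powr p + (\<theta> * \<bar>b / s\<bar> powr p + (1 - \<theta>) * \<bar>d / t\<bar> powr p) =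
        \<theta> * (\<bar>a / s\<bar> powr p + \<bar>b / s\<bar> powr p) + (1 - \<theta>) * (\<bar>c / t\<bar> powr p + \<bar>d / t\<bar> powr p)"
        by (simp only: distrib_left add_ac)
      then show ?thesis unfolding unit by simp
    qed
    have scale: "\<bar>(x + y) / (s + t)\<bar> powr p = \<bar>x + y\<bar> powr p / (s + t) powr p" for x y
      using st by (simp add: powr_divide)
    have le: "\<bar>(x + y) / (s + t)\<bar> powr p \<le> \<theta> * \<bar>x / s\<bar> powr p + (1 - \<theta>) * \<bar>y / t\<bar> powr p" for x y
      unfolding split by (rule abs_powr_convex[OF assms \<theta>])
    have lt: "\<bar>(x + y) / (s + t)\<bar> powr p < \<theta> * \<bar>x / s\<bar> powr p + (1 - \<theta>) * \<bar>y / t\<bar> powr p" if "x / s \<noteq> y / t" for x y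
      unfolding split by (rule abs_powr_strict_convex[OF assms \<theta> that])
    have le1: "\<bar>a + c\<bar> powr p / (s + t) powr p + \<bar>b + d\<bar> powr p / (s + t) powr p \<le> 1"
      using le[of a c] le[of b d] sum unfolding scale by linarith
    have lt1: "\<bar>a + c\<bar> powr p / (s + t) powr p + \<bar>b + d\<bar> powr p / (s + t) powr p < 1" if "a * d \<noteq> b * c"
    proof (cases "a / s = c / t")
      case True
      have "b / s \<noteq> d / t"
      proof
        assume "b / s = d / t"
        then have "(a / s) * (d / t) = (b / s) * (c / t)" using True by simp
        then show False using that st by (simp add: field_simps)
      qed
      then show ?thesis using le[of a c] lt[of b d] sum unfolding scale by linarith
    next
      case False
      then show ?thesis using lt[of a c] le[of b d] sum unfolding scale by linarith
    qed
    have pos: "(s + t) powr p > 0" using st by simp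
    have root: "pnorm p (a + c) (b + d) = (\<bar>a + c\<bar> powr p + \<bar>b + d\<bar> powr p) powr (1 / p)"
      "s + t = ((s + t) powr p) powr (1 / p)"
      using st assms by (simp_all add: pnorm_def powr_powr)
    show ?thesis
    proof (intro conjI impI)
      have "\<bar>a + c\<bar> powr p + \<bar>b + d\<bar> powr p \<le> (s + t) powr p"
        using le1 pos by (simp add: divide_simps flip: add_divide_distrib)
      then show "pnorm p (a + c) (b + d) \<le> s + t"
        by (subst root(1), subst root(2), intro powr_mono2) (use assms in auto)
      assume "a * d \<noteq> b * c"
      then have "\<bar>a + c\<bar> powr p + \<bar>b + d\<bar> powr p < (s + t) powr p"
        using lt1 pos by (simp add: divide_simps flip: add_divide_distrib)
      then show "pnorm p (a + c) (b + d) < s + t"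
        by (subst root(1), subst root(2), intro powr_less_mono2) (use assms in auto)
    qed
  qed
  then show "pnorm p (a + c) (b + d) \<le> pnorm p a b + pnorm p c d"
    and "a * d \<noteq> b * c \<Longrightarrow> pnorm p (a + c) (b + d) < pnorm p a b + pnorm p c d"
    by (simp_all add: s_def t_def)
qed

text \<open>The reverse triangle inequality: (a, b) is (a', b') plus the difference, and conversely.
  Up to sign, the determinant of either vector with the difference equals a b' - a' b, so the strict
  case carries over.\<close>

lemma pnorm_diff:
  assumes "p \<ge> 2"
  shows "\<bar>pnorm p a b - pnorm p a' b'\<bar> \<le> pnorm p (a - a') (b - b')"
    and "a * b' \<noteq> a' * b \<Longrightarrow> \<bar>pnorm p a b - pnorm p a' b'\<bar> < pnorm p (a - a') (b - b')"
proof -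
  have sym: "pnorm p (a' - a) (b' - b) = pnorm p (a - a') (b - b')"
    by (simp add: pnorm_def abs_minus_commute)
  have *: "pnorm p a b \<le> pnorm p a' b' + pnorm p (a - a') (b - b')"
    "pnorm p a' b' \<le> pnorm p a b + pnorm p (a - a') (b - b')"
    using pnorm_add(1)[OF assms, of a' "a - a'" b' "b - b'"] pnorm_add(1)[OF assms, of a "a' - a" b "b' - b"]
    by (simp_all add: sym)
  then show "\<bar>pnorm p a b - pnorm p a' b'\<bar> \<le> pnorm p (a - a') (b - b')" by (simp add: abs_le_iff)
  assume ne: "a * b' \<noteq> a' * b"
  have "a' * (b - b') \<noteq> b' * (a - a')" "a * (b' - b) \<noteq> b * (a' - a)"
    using ne by (auto simp: right_diff_distrib mult.commute)
  then have "pnorm p a b < pnorm p a' b' + pnorm p (a - a') (b - b')"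
    "pnorm p a' b' < pnorm p a b + pnorm p (a - a') (b - b')"
    using pnorm_add(2)[OF assms, of a' "b - b'" b' "a - a'"] pnorm_add(2)[OF assms, of a "b' - b" b "a' - a"]
    by (simp_all add: sym)
  then show "\<bar>pnorm p a b - pnorm p a' b'\<bar> < pnorm p (a - a') (b - b')" by (simp add: abs_less_iff)
qed

lemma pnorm_le_sum: "p \<ge> 2 \<Longrightarrow> pnorm p a b \<le> \<bar>a\<bar> + \<bar>b\<bar>"
  using pnorm_add(1)[of p a 0 0 b] by (simp add: pnorm_axis)

lemma pnorm_diff_powr:
  assumes "p \<ge> 2"
  shows "\<bar>pnorm p a b - pnorm p a' b'\<bar> powr p \<le> \<bar>a - a'\<bar> powr p + \<bar>b - b'\<bar> powr p"
    and "a * b' \<noteq> a' * b \<Longrightarrow> \<bar>pnorm p a b - pnorm p a' b'\<bar> powr p < \<bar>a - a'\<bar> powr p + \<bar>b - b'\<bar> powr p"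
proof -
  have eq: "\<bar>a - a'\<bar> powr p + \<bar>b - b'\<bar> powr p = pnorm p (a - a') (b - b') powr p"
    using assms by (simp add: pnorm_powr)
  show "\<bar>pnorm p a b - pnorm p a' b'\<bar> powr p \<le> \<bar>a - a'\<bar> powr p + \<bar>b - b'\<bar> powr p"
    unfolding eq using pnorm_diff(1)[OF assms] assms by (intro powr_mono2) auto
  assume "a * b' \<noteq> a' * b"
  then show "\<bar>pnorm p a b - pnorm p a' b'\<bar> powr p < \<bar>a - a'\<bar> powr p + \<bar>b - b'\<bar> powr p"
    unfolding eq using pnorm_diff(2)[OF assms] assms by (intro powr_less_mono2) auto
qed

text \<open>A smooth approximation of \<open>pnorm\<close> that keeps its Lipschitz bound, so that approximating
  \<open>pnorm p (u x) (v x)\<close> by core functions needs no mollifier.\<close>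

definition smooth_pnorm :: "real \<Rightarrow> real \<Rightarrow> real \<Rightarrow> real \<Rightarrow> real" where
  "smooth_pnorm p \<epsilon> a b =
     ((a\<^sup>2 + \<epsilon>) powr (p / 2) + (b\<^sup>2 + \<epsilon>) powr (p / 2)) powr (1 / p) - (2 * \<epsilon> powr (p / 2)) powr (1 / p)"

lemma C_k_smooth_pnorm:
  assumes "\<epsilon> > 0" "C_k k f" "C_k k g"
  shows "C_k k (\<lambda>x. smooth_pnorm p \<epsilon> (f x) (g x))"
  unfolding smooth_pnorm_def using assms
  by (intro C_k_diff C_k_powr C_k_add C_k_power2 C_k_const)
    (simp_all add: add_nonneg_pos add_pos_pos powr_gt_zero less_imp_neq[THEN not_sym])

lemma smooth_pnorm_0: "smooth_pnorm p \<epsilon> 0 0 = 0"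
  by (simp add: smooth_pnorm_def)

text \<open>The square roots are moduli of a + i e and b + i e, so this is the reverse triangle
  inequality in the complex plane.\<close>

lemma sqrt_lipschitz: "\<bar>sqrt (a\<^sup>2 + e\<^sup>2) - sqrt (b\<^sup>2 + e\<^sup>2)\<bar> \<le> \<bar>a - b\<bar>"
  using norm_triangle_ineq3[of "Complex a e" "Complex b e"] by (simp add: cmod_def)

text \<open>Up to an additive constant, the approximation is \<open>pnorm\<close> applied to sqrt
  (a^2 + \<epsilon>) and sqrt (b^2 + \<epsilon>), and both operations do not increase distances
  measured by the sum of coordinates.\<close>

lemma smooth_pnorm_lipschitz:
  assumes "p \<ge> 2" "\<epsilon> > 0"
  shows "\<bar>smooth_pnorm p \<epsilon> a b - smooth_pnorm p \<epsilon> a' b'\<bar> \<le> \<bar>a - a'\<bar> + \<bar>b - b'\<bar>"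
proof -
  have eq: "smooth_pnorm p \<epsilon> a b = pnorm p (sqrt (a\<^sup>2 + \<epsilon>)) (sqrt (b\<^sup>2 + \<epsilon>)) - (2 * \<epsilon> powr (p / 2)) powr (1 / p)" for a b
  proof -
    have "(a\<^sup>2 + \<epsilon>) powr (p / 2) = \<bar>sqrt (a\<^sup>2 + \<epsilon>)\<bar> powr p" for a :: real
      using assms by (simp add: powr_half_sqrt[symmetric] powr_powr add_nonneg_pos)
    then show ?thesis by (simp add: smooth_pnorm_def pnorm_def)
  qed
  have "\<bar>sqrt (a\<^sup>2 + \<epsilon>) - sqrt (a'\<^sup>2 + \<epsilon>)\<bar> \<le> \<bar>a - a'\<bar>" for a a' :: real
    using sqrt_lipschitz[of a "sqrt \<epsilon>" a'] assms by simp
  then have "pnorm p (sqrt (a\<^sup>2 + \<epsilon>) - sqrt (a'\<^sup>2 + \<epsilon>)) (sqrt (b\<^sup>2 + \<epsilon>) - sqrt (b'\<^sup>2 + \<epsilon>)) \<le> \<bar>a - a'\<bar> + \<bar>b - b'\<bar>"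
    using pnorm_le_sum[OF assms(1)] by (intro order_trans[OF pnorm_le_sum[OF assms(1)]] add_mono)
  from order_trans[OF pnorm_diff(1)[OF assms(1)] this] show ?thesis unfolding eq by simp
qed

lemma smooth_pnorm_tendsto:
  assumes "p \<ge> 2" "f \<longlonglongrightarrow> a" "g \<longlonglongrightarrow> b"
  shows "(\<lambda>k. smooth_pnorm p (1 / real (Suc k)) (f k) (g k)) \<longlonglongrightarrow> pnorm p a b"
proof -
  note sq = abs_powr_eq_square_powr
  have e: "(\<lambda>k. 1 / real (Suc k)) \<longlonglongrightarrow> 0" by (rule LIMSEQ_Suc[OF lim_1_over_n])
  have base: "(\<lambda>k. (h k ^ 2 + 1 / real (Suc k)) powr (p / 2)) \<longlonglongrightarrow> (c\<^sup>2 + 0) powr (p / 2)" if "h \<longlonglongrightarrow> c" for h c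
    using assms(1) by (intro tendsto_powr' tendsto_add tendsto_power that e tendsto_const) auto
  have "(\<lambda>k. ((f k)\<^sup>2 + 1 / real (Suc k)) powr (p / 2) + ((g k)\<^sup>2 + 1 / real (Suc k)) powr (p / 2))
     \<longlonglongrightarrow> \<bar>a\<bar> powr p + \<bar>b\<bar> powr p"
    using tendsto_add[OF base[OF assms(2)] base[OF assms(3)]] by (simp add: sq)
  then have 1: "(\<lambda>k. (((f k)\<^sup>2 + 1 / real (Suc k)) powr (p / 2) + ((g k)\<^sup>2 + 1 / real (Suc k)) powr (p / 2)) powr (1 / p))
     \<longlonglongrightarrow> pnorm p a b"
    unfolding pnorm_def using assms(1) by (intro tendsto_powr' tendsto_const) auto
  have "(\<lambda>k. (1 / real (Suc k)) powr (p / 2)) \<longlonglongrightarrow> 0 powr (p / 2)"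
    using assms(1) by (intro tendsto_powr' e tendsto_const) auto
  then have "(\<lambda>k. 2 * (1 / real (Suc k)) powr (p / 2)) \<longlonglongrightarrow> 0"
    by (intro tendsto_mult_right_zero) simp
  then have "(\<lambda>k. (2 * (1 / real (Suc k)) powr (p / 2)) powr (1 / p)) \<longlonglongrightarrow> 0 powr (1 / p)"
    using assms(1) by (intro tendsto_powr' tendsto_const) auto
  from tendsto_diff[OF 1 this] show ?thesis by (simp add: smooth_pnorm_def)
qed

context hardy_setting
begin

text \<open>This makes \<open>pnorm\<close> of u and v a competitor for \<open>lambda1\<close>. The
  approximants vanish where \<phi> k and \<psi> k both do, hence lie in the core, and their
  increments are dominated by those of \<phi> k and \<psi> k, so a.e. convergence upgrades to
  convergence in energy.\<close>

lemma pnorm_X0: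
  assumes u: "u \<in> X0 p \<alpha> \<Omega>" and v: "v \<in> X0 p \<alpha> \<Omega>"
  shows "(\<lambda>x. pnorm p (u x) (v x)) \<in> X0 p \<alpha> \<Omega>"
proof -
  obtain \<phi> where \<phi>: "\<And>k. \<phi> k \<in> X0_core \<Omega>" "AE x in lebesgue. (\<lambda>k. \<phi> k x) \<longlonglongrightarrow> u x"
    "Lp_tendsto p E (\<lambda>k. incr (\<phi> k)) (incr u)" and mu: "u \<in> borel_measurable lebesgue"
    using X0_D[OF u] by blast
  obtain \<psi> where \<psi>: "\<And>k. \<psi> k \<in> X0_core \<Omega>" "AE x in lebesgue. (\<lambda>k. \<psi> k x) \<longlonglongrightarrow> v x"
    "Lp_tendsto p E (\<lambda>k. incr (\<psi> k)) (incr v)" and mv: "v \<in> borel_measurable lebesgue"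
    using X0_D[OF v] by blast
  define w where "w = (\<lambda>x. pnorm p (u x) (v x))"
  define W where "W k x = smooth_pnorm p (1 / real (Suc k)) (\<phi> k x) (\<psi> k x)" for k x
  have W: "W k \<in> X0_core \<Omega>" for k
  proof (rule X0_core_I[OF _ \<phi>(1)[of k] \<psi>(1)[of k]])
    show "C_k j (W k)" for j
      unfolding W_def[abs_def] by (intro C_k_smooth_pnorm X0_core_D(1)[OF \<phi>(1)] X0_core_D(1)[OF \<psi>(1)]) simp
    show "W k x = 0" if "\<phi> k x = 0" "\<psi> k x = 0" for x using that by (simp add: W_def smooth_pnorm_0)
  qed
  have w: "w \<in> borel_measurable lebesgue" unfolding w_def pnorm_def using mu mv by measurable
  have lim: "AE x in lebesgue. (\<lambda>k. W k x) \<longlonglongrightarrow> w x"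
    using \<phi>(2) \<psi>(2)
  proof eventually_elim
    case (elim x)
    then show ?case unfolding W_def w_def using p by (intro smooth_pnorm_tendsto) auto
  qed
  have "Lp_tendsto p E (\<lambda>k. incr (W k)) (incr w)"
  proof (rule Lp_tendsto_dominated[OF \<phi>(3) \<psi>(3), where c = 1])
    show "AE z in E. (\<lambda>k. incr (W k) z) \<longlonglongrightarrow> incr w z"
      using AE_energy_measure[OF \<Omega> lim, of p \<alpha>]
      by eventually_elim (simp add: incr_def tendsto_diff)
    show "AE z in E. \<bar>incr (W k) z\<bar> \<le> 1 * (\<bar>incr (\<phi> k) z\<bar> + \<bar>incr (\<psi> k) z\<bar>)" for k
      using smooth_pnorm_lipschitz[OF p, of "1 / real (Suc k)"]
      by (intro AE_I2) (simp add: incr_def W_def)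
    show "incr w \<in> borel_measurable E" using incr_measurable[OF w] by simp
    show "incr (W k) \<in> borel_measurable E" for k using incr_measurable[OF X0_core_D(6)[OF W]] by simp
  qed (use p in auto)
  from X0_I[OF W w lim this] show ?thesis by (simp add: w_def)
qed

end

section \<open>Testing the equation with the solution\<close>

text \<open>\<open>L1_loc\<close> speaks of V on compact subsets only. Truncations along a compact
  exhaustion converge pointwise; the indicator discards the arbitrary values of V outside
  \<Omega>.\<close>

lemma L1_loc_measurable:
  assumes "L1_loc \<Omega> V" and "open (\<Omega> :: 'a::euclidean_space set)"
  shows "(\<lambda>x. indicator \<Omega> x * V x) \<in> borel_measurable lebesgue"
proof -
  obtain K :: "nat \<Rightarrow> 'a set" where K: "\<And>n. compact (K n)" "\<And>n. K n \<subseteq> \<Omega>"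
    "\<And>n. K n \<subseteq> interior (K (Suc n))" "\<Union> (range K) = \<Omega>"
    using open_Union_compact_subsets[OF assms(2)] by metis
  have mono: "K m \<subseteq> K n" if "m \<le> n" for m n
    by (rule lift_Suc_mono_le[OF _ that]) (use K(3) interior_subset in blast)
  show ?thesis
  proof (rule borel_measurable_LIMSEQ_real)
    fix x
    show "(\<lambda>n. indicator (K n) x * V x) \<longlonglongrightarrow> indicator \<Omega> x * V x"
    proof (cases "x \<in> \<Omega>")
      case True
      then obtain N where "x \<in> K N" using K(4) by blast
      then have "\<And>n. n \<ge> N \<Longrightarrow> x \<in> K n" using mono by blast
      then have "eventually (\<lambda>n. indicator (K n) x * V x = indicator \<Omega> x * V x) sequentially"
        using True by (intro eventually_sequentiallyI[of N]) simp
      then show ?thesis by (rule tendsto_eventually)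
    next
      case False
      then have "x \<notin> K n" for n using K(2) by blast
      then show ?thesis using False by simp
    qed
  next
    fix n
    have "set_integrable lebesgue (K n) V" using assms(1) K(1,2) by (simp add: L1_loc_def)
    then show "(\<lambda>x. indicator (K n) x * V x) \<in> borel_measurable lebesgue"
      unfolding set_integrable_def by (simp add: borel_measurable_integrable)
  qed
qed

text \<open>The support of a core function may touch the boundary of \<Omega>, but for N > 0 the set
  where |\<phi>| >= 1/N is closed, lies in the support and avoids the complement of \<Omega>. This
  is why small values are cut off.\<close>

lemma core_superlevel_compact:
  fixes \<phi> :: "'a::euclidean_space \<Rightarrow> real"
  assumes \<phi>: "\<phi> \<in> X0_core \<Omega>"
  obtains K where "compact K" "K \<subseteq> \<Omega>" "\<And>x. x \<notin> K \<Longrightarrow> N * \<bar>\<phi> x\<bar> \<le> 1"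
proof -
  define K where "K = {x. 1 \<le> N * \<bar>\<phi> x\<bar>}"
  have "continuous_on UNIV \<phi>" using X0_core_D(1)[OF \<phi>, of 0] by simp
  then have "closed K" unfolding K_def
    by (intro closed_Collect_le continuous_on_mult continuous_on_const continuous_on_rabs)
  moreover have "K \<subseteq> closure {x. \<phi> x \<noteq> 0}"
    using closure_subset[of "{x. \<phi> x \<noteq> 0}"] by (auto simp: K_def)
  ultimately have "compact K"
    using compact_Int_closed[OF X0_core_D(2)[OF \<phi>], of K] by (simp add: Int_absorb1)
  moreover have "K \<subseteq> \<Omega>" using X0_core_D(4)[OF \<phi>] by (force simp: K_def)
  ultimately show thesis by (rule that) (simp add: K_def)
qed

lemma C_c_inf_I:
  fixes \<psi> \<phi> :: "'a::euclidean_space \<Rightarrow> real"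
  assumes smooth: "\<And>k. C_k k \<psi>" and \<phi>: "\<phi> \<in> X0_core \<Omega>"
    and zero: "\<And>x. N * \<bar>\<phi> x\<bar> \<le> 1 \<Longrightarrow> \<psi> x = 0"
  shows "\<psi> \<in> C_c_inf \<Omega>"
proof -
  obtain K where K: "compact K" "K \<subseteq> \<Omega>" "\<And>x. x \<notin> K \<Longrightarrow> N * \<bar>\<phi> x\<bar> \<le> 1"
    using core_superlevel_compact[OF \<phi>] by blast
  have "x \<in> K" if "\<psi> x \<noteq> 0" for x using zero K(3) that by blast
  note closure_support_subset[of \<psi> K, OF this K(1)]
  then show ?thesis using smooth K(2) unfolding C_c_inf_def by blast
qed

lemma damp_tendsto:
  assumes "\<delta> > 0" "g \<longlonglongrightarrow> b"
  shows "(\<lambda>j. damp \<delta> a (g j)) \<longlonglongrightarrow> damp \<delta> a b"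
proof -
  have "a\<^sup>2 + b\<^sup>2 + \<delta> > 0" using assms(1) by (simp add: add_nonneg_pos)
  then show ?thesis unfolding damp_def using assms(2) by (intro tendsto_intros) auto
qed

lemma damp_cutoff_tendsto:
  assumes "f \<longlonglongrightarrow> t"
  shows "(\<lambda>k. damp (1 / real (Suc k)) (cutoff (real (Suc k)) (f k)) t) \<longlonglongrightarrow> t / 2"
proof (cases "t = 0")
  case True
  then show ?thesis by (simp add: damp_def)
next
  case False
  have e: "(\<lambda>k. 1 / real (Suc k)) \<longlonglongrightarrow> 0" by (rule LIMSEQ_Suc[OF lim_1_over_n])
  have "(\<lambda>k. damp (1 / real (Suc k)) (cutoff (real (Suc k)) (f k)) t) \<longlonglongrightarrow> t\<^sup>2 * t / (t\<^sup>2 + t\<^sup>2 + 0)"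
    unfolding damp_def using False by (intro tendsto_intros cutoff_tendsto[OF assms] e) auto
  moreover have "t\<^sup>2 * t / (t\<^sup>2 + t\<^sup>2 + 0) = t / 2" using False by (simp add: field_simps)
  ultimately show ?thesis by (simp only:)
qed

context hardy_setting
begin

text \<open>Formally the equation is tested with u. The identity A - \<mu> B = \<kappa> D, linear in
  the test function, is extended from smooth functions by two successive limits until it holds for u
  / 2.\<close>

lemma eigenfunction_energy:
  assumes V: "L1_loc \<Omega> V" and eig: "eigenfunction p \<alpha> \<mu> \<Omega> V \<kappa> u"
  shows "J p \<alpha> \<mu> \<Omega> u = \<kappa> * (LINT x:\<Omega>|lebesgue. V x * \<bar>u x\<bar> powr p)"
proof -
  have uX: "u \<in> X0 p \<alpha> \<Omega>" and weak: "weak_solution p \<alpha> \<mu> \<Omega> V \<kappa> u"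
    and Vint: "set_integrable lebesgue \<Omega> (\<lambda>x. \<bar>V x\<bar> * \<bar>u x\<bar> powr p)"
    using eig unfolding eigenfunction_def by blast+
  obtain \<phi> where \<phi>: "\<And>k. \<phi> k \<in> X0_core \<Omega>" and lim: "AE x in lebesgue. (\<lambda>k. \<phi> k x) \<longlonglongrightarrow> u x"
    and \<phi>E: "Lp_tendsto p E (\<lambda>k. incr (\<phi> k)) (incr u)" and \<phi>H: "Lp_tendsto p H \<phi> u"
    and mu [measurable]: "u \<in> borel_measurable lebesgue"
    using X0_D[OF uX] by blast
  note uint = X0_integrable(1,2)[OF uX]
  have p0: "p > 0" "p > 1" using p by auto
  have [measurable]: "incr u \<in> borel_measurable lebesgue" by (rule incr_measurable) fact
  define VO where "VO x = indicator \<Omega> x * V x" for x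
  have mV [measurable]: "VO \<in> borel_measurable lebesgue"
    unfolding VO_def[abs_def] by (rule L1_loc_measurable[OF V \<Omega>])
  have m\<phi> [measurable]: "\<phi> k \<in> borel_measurable lebesgue" for k using X0_core_D(6)[OF \<phi>] .
  define A where "A \<tau> = (\<integral>z. \<bar>incr u z\<bar> powr (p - 2) * incr u z * incr \<tau> z \<partial>E)" for \<tau>
  define B where "B \<tau> = (\<integral>x. \<bar>u x\<bar> powr (p - 2) * u x * \<tau> x \<partial>H)" for \<tau>
  define D where "D \<tau> = (\<integral>x. VO x * (\<bar>u x\<bar> powr (p - 2) * u x) * \<tau> x \<partial>lebesgue)" for \<tau>
  have test: "A \<tau> - \<mu> * B \<tau> = \<kappa> * D \<tau>" if "\<tau> \<in> C_c_inf \<Omega>" for \<tau>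
  proof -
    have [measurable]: "\<tau> \<in> borel_measurable lebesgue"
      by (rule measurable_completion) (simp add: C_c_inf_borel[OF that])
    have [measurable]: "incr \<tau> \<in> borel_measurable lebesgue" by (rule incr_measurable) fact
    have "(\<lambda>z. \<bar>incr u z\<bar> powr (p - 2) * incr u z * incr \<tau> z) \<in> borel_measurable lebesgue" by measurable
    note A' = energy_measure_integral[OF \<Omega> this, of p \<alpha>]
    have "(\<lambda>x. \<bar>u x\<bar> powr (p - 2) * u x * \<tau> x) \<in> borel_measurable lebesgue" by measurable
    note B' = hardy_measure_integral[OF \<Omega> this, of p \<alpha>]
    have D': "D \<tau> = (LINT x:\<Omega>|lebesgue. V x * \<bar>u x\<bar> powr (p - 2) * u x * \<tau> x)"
      unfolding D_def VO_def set_lebesgue_integral_def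
      by (intro Bochner_Integration.integral_cong refl) (simp add: mult.assoc)
    show ?thesis
      using weak that unfolding weak_solution_def A_def B_def A' B' D' by (simp add: incr_def)
  qed
  \<comment> \<open>Both limits use this passage, with different majorants G. Only the term with V
    needs G; the other two follow from L^p convergence in E and H.\<close>
  have limit: "A \<tau> - \<mu> * B \<tau> = \<kappa> * D \<tau>"
    if eq: "\<And>i. A (\<sigma> i) - \<mu> * B (\<sigma> i) = \<kappa> * D (\<sigma> i)"
      and E': "Lp_tendsto p E (\<lambda>i. incr (\<sigma> i)) (incr \<tau>)" and H': "Lp_tendsto p H \<sigma> \<tau>"
      and lim': "AE x in lebesgue. (\<lambda>i. \<sigma> i x) \<longlonglongrightarrow> \<tau> x"
      and bound: "\<And>i. AE x in lebesgue. \<bar>\<sigma> i x\<bar> \<le> G x"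
      and G: "integrable lebesgue (\<lambda>x. \<bar>VO x\<bar> * \<bar>u x\<bar> powr (p - 1) * G x)"
    for \<sigma> :: "nat \<Rightarrow> 'a \<Rightarrow> real" and \<tau> G
  proof -
    have [measurable]: "\<tau> \<in> borel_measurable lebesgue" "\<And>i. \<sigma> i \<in> borel_measurable lebesgue"
      using H' by (simp_all add: Lp_tendsto_def)
    have A: "(\<lambda>i. A (\<sigma> i)) \<longlonglongrightarrow> A \<tau>"
      unfolding A_def by (rule Lp_tendsto_weak(3)[OF E' p0(2) _ uint(1)]) simp
    have B: "(\<lambda>i. B (\<sigma> i)) \<longlonglongrightarrow> B \<tau>"
      unfolding B_def by (rule Lp_tendsto_weak(3)[OF H' p0(2) _ uint(2)]) simp
    have "(\<lambda>i. D (\<sigma> i)) \<longlonglongrightarrow> D \<tau>"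
      unfolding D_def
    proof (rule integral_dominated_convergence[OF _ _ G])
      show "AE x in lebesgue. (\<lambda>i. VO x * (\<bar>u x\<bar> powr (p - 2) * u x) * \<sigma> i x)
          \<longlonglongrightarrow> VO x * (\<bar>u x\<bar> powr (p - 2) * u x) * \<tau> x"
        using lim' by eventually_elim (rule tendsto_mult_left)
      show "AE x in lebesgue. norm (VO x * (\<bar>u x\<bar> powr (p - 2) * u x) * \<sigma> i x) \<le>
          \<bar>VO x\<bar> * \<bar>u x\<bar> powr (p - 1) * G x" for i
        using bound[of i]
      proof eventually_elim
        case (elim x)
        have "norm (VO x * (\<bar>u x\<bar> powr (p - 2) * u x) * \<sigma> i x) = \<bar>VO x\<bar> * \<bar>u x\<bar> powr (p - 1) * \<bar>\<sigma> i x\<bar>"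
          unfolding real_norm_def abs_mult[of "VO x * _"] abs_mult[of "VO x"] abs_powr_minus_two ..
        also have "\<dots> \<le> \<bar>VO x\<bar> * \<bar>u x\<bar> powr (p - 1) * G x"
          using elim by (intro mult_left_mono) auto
        finally show ?case .
      qed
    qed measurable
    then have "(\<lambda>i. \<kappa> * D (\<sigma> i)) \<longlonglongrightarrow> \<kappa> * D \<tau>" by (rule tendsto_mult_left)
    moreover have "(\<lambda>i. A (\<sigma> i) - \<mu> * B (\<sigma> i)) \<longlonglongrightarrow> A \<tau> - \<mu> * B \<tau>"
      using A B by (intro tendsto_diff tendsto_mult_left)
    ultimately show ?thesis unfolding eq by (rule LIMSEQ_unique[rotated])
  qed
  have intu: "integrable lebesgue (\<lambda>x. \<bar>VO x\<bar> * \<bar>u x\<bar> powr p)"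
    using Vint unfolding set_integrable_def VO_def by (simp add: abs_mult mult.assoc)
  \<comment> \<open>First j tends to infinity with k fixed: the cut-off of \<phi> k confines all T k
    j to one compact set and bounds them. Then k tends to infinity, where |U k| <= |u| provides the
    majorant |V| |u|^p.\<close>
  define T where "T k j x = damp (1 / real (Suc k)) (cutoff (real (Suc k)) (\<phi> k x)) (\<phi> j x)" for k j x
  define U where "U k x = damp (1 / real (Suc k)) (cutoff (real (Suc k)) (\<phi> k x)) (u x)" for k x
  have pos: "1 / real (Suc k) > 0" for k by simp
  have Tlim: "AE x in lebesgue. (\<lambda>j. T k j x) \<longlonglongrightarrow> U k x" for k
    using lim unfolding T_def U_def by eventually_elim (rule damp_tendsto[OF pos])
  have Ulim: "AE x in lebesgue. (\<lambda>k. U k x) \<longlonglongrightarrow> u x / 2"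
    using lim unfolding U_def by eventually_elim (rule damp_cutoff_tendsto)
  have Tsmooth: "C_k i (T k j)" for i k j
    unfolding T_def[abs_def] by (intro C_k_damp[OF pos] C_k_cutoff X0_core_D(1)[OF \<phi>])
  have Tzero: "T k j x = 0" if "real (Suc k) * \<bar>\<phi> k x\<bar> \<le> 1" for k j x
    using cutoff_eq_0[OF _ that] by (simp add: T_def damp_def)
  have Ttest: "T k j \<in> C_c_inf \<Omega>" for k j
    by (rule C_c_inf_I[OF Tsmooth \<phi>[of k] Tzero])
  have mT [measurable]: "T k j \<in> borel_measurable lebesgue" for k j
    by (rule measurable_completion) (simp add: C_c_inf_borel[OF Ttest])
  have [measurable]: "(\<lambda>x. cutoff (real (Suc k)) (\<phi> k x)) \<in> borel_measurable lebesgue" for k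
  proof -
    have "(\<lambda>x. cutoff (real (Suc k)) (\<phi> k x)) \<in> borel_measurable borel"
      using C_k_cutoff[OF X0_core_D(1)[OF \<phi>[of k], of 0], of "real (Suc k)"]
      by (intro borel_measurable_continuous_onI) simp
    then show ?thesis by (intro measurable_completion) simp
  qed
  have mU [measurable]: "U k \<in> borel_measurable lebesgue" for k
    unfolding U_def[abs_def] damp_def by measurable
  have P_U: "A (U k) - \<mu> * B (U k) = \<kappa> * D (U k)" for k
  proof (rule limit[where \<sigma> = "T k" and G = "\<lambda>x. \<bar>cutoff (real (Suc k)) (\<phi> k x)\<bar>"])
    show "A (T k j) - \<mu> * B (T k j) = \<kappa> * D (T k j)" for j by (rule test[OF Ttest])
    show "Lp_tendsto p E (\<lambda>j. incr (T k j)) (incr (U k))"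
    \<comment> \<open>The first dominating sequence is constant in j, since only the second argument
      of \<open>damp\<close> moves; 7 is the Lipschitz constant of \<open>cutoff\<close>.\<close>
    proof (rule Lp_tendsto_dominated[OF Lp_tendsto_const \<phi>E p0(1), where c = 7])
      show "incr (\<phi> k) \<in> borel_measurable E" using incr_measurable[OF m\<phi>] by simp
      show "integrable E (\<lambda>z. \<bar>incr (\<phi> k) z\<bar> powr p)" by (rule core_integrable(1)[OF \<phi>])
      show "incr (U k) \<in> borel_measurable E" using incr_measurable[OF mU] by simp
      show "incr (T k j) \<in> borel_measurable E" for j using incr_measurable[OF mT] by simp
      show "AE z in E. (\<lambda>j. incr (T k j) z) \<longlonglongrightarrow> incr (U k) z"
        using AE_energy_measure[OF \<Omega> Tlim[of k], of p \<alpha>] by eventually_elim (simp add: incr_def tendsto_diff)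
      show "AE z in E. \<bar>incr (T k j) z\<bar> \<le> 7 * (\<bar>incr (\<phi> k) z\<bar> + \<bar>incr (\<phi> j) z\<bar>)" for j
      proof (rule AE_I2)
        fix z
        have "\<bar>incr (T k j) z\<bar> \<le> \<bar>cutoff (real (Suc k)) (\<phi> k (fst z)) - cutoff (real (Suc k)) (\<phi> k (snd z))\<bar> + \<bar>incr (\<phi> j) z\<bar>"
          unfolding incr_def T_def by (rule damp_lipschitz[OF pos])
        also have "\<dots> \<le> 7 * \<bar>incr (\<phi> k) z\<bar> + 7 * \<bar>incr (\<phi> j) z\<bar>"
          unfolding incr_def by (intro add_mono cutoff_lipschitz) simp
        finally show "\<bar>incr (T k j) z\<bar> \<le> 7 * (\<bar>incr (\<phi> k) z\<bar> + \<bar>incr (\<phi> j) z\<bar>)"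
          by (simp only: distrib_left)
      qed
    qed simp
    show "Lp_tendsto p H (T k) (U k)"
    proof (rule Lp_tendsto_dominated[OF \<phi>H \<phi>H p0(1), where c = 1])
      show "AE x in H. (\<lambda>j. T k j x) \<longlonglongrightarrow> U k x" by (rule AE_hardy_measure[OF \<Omega> Tlim])
      show "AE x in H. \<bar>T k j x\<bar> \<le> 1 * (\<bar>\<phi> j x\<bar> + \<bar>\<phi> j x\<bar>)" for j
      proof (rule AE_I2)
        fix x
        have "\<bar>T k j x\<bar> \<le> \<bar>\<phi> j x\<bar>" unfolding T_def by (rule abs_damp_le2[OF pos])
        then show "\<bar>T k j x\<bar> \<le> 1 * (\<bar>\<phi> j x\<bar> + \<bar>\<phi> j x\<bar>)" by simp
      qed
    qed simp_all
    show "AE x in lebesgue. (\<lambda>j. T k j x) \<longlonglongrightarrow> U k x" by (rule Tlim)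
    show "AE x in lebesgue. \<bar>T k j x\<bar> \<le> \<bar>cutoff (real (Suc k)) (\<phi> k x)\<bar>" for j
      using abs_damp_le1[OF pos[of k]] by (intro AE_I2) (simp add: T_def)
    \<comment> \<open>Off K the cut-off vanishes. On K it is at most b, and |u|^(p - 1) <= 1 + |u|^p
      splits the product into |V| on a compact set and |V| |u|^p, both integrable.\<close>
    show "integrable lebesgue (\<lambda>x. \<bar>VO x\<bar> * \<bar>u x\<bar> powr (p - 1) * \<bar>cutoff (real (Suc k)) (\<phi> k x)\<bar>)"
    proof -
      obtain K where K: "compact K" "K \<subseteq> \<Omega>" "\<And>x. x \<notin> K \<Longrightarrow> real (Suc k) * \<bar>\<phi> k x\<bar> \<le> 1"
        using core_superlevel_compact[OF \<phi>[of k]] by blast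
      obtain b where b: "\<And>x. \<bar>\<phi> k x\<bar> \<le> b"
        by (rule C_c_inf_props[OF X0_core_D(3)[OF \<phi>[of k]]]) (rule that)
      have b0: "b \<ge> 0" using b[of 0] by linarith
      have iK: "integrable lebesgue (\<lambda>x. \<bar>indicator K x * V x\<bar>)"
        using V K(1,2) unfolding L1_loc_def set_integrable_def by (intro integrable_abs) simp
      show ?thesis
      proof (rule Bochner_Integration.integrable_bound)
        show "integrable lebesgue (\<lambda>x. b * (\<bar>indicator K x * V x\<bar> + \<bar>VO x\<bar> * \<bar>u x\<bar> powr p))"
          using iK intu by simp
        show "(\<lambda>x. \<bar>VO x\<bar> * \<bar>u x\<bar> powr (p - 1) * \<bar>cutoff (real (Suc k)) (\<phi> k x)\<bar>) \<in> borel_measurable lebesgue"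
          by measurable
        show "AE x in lebesgue. norm (\<bar>VO x\<bar> * \<bar>u x\<bar> powr (p - 1) * \<bar>cutoff (real (Suc k)) (\<phi> k x)\<bar>) \<le>
            norm (b * (\<bar>indicator K x * V x\<bar> + \<bar>VO x\<bar> * \<bar>u x\<bar> powr p))"
        proof (rule AE_I2)
          fix x
          have "\<bar>VO x\<bar> * \<bar>u x\<bar> powr (p - 1) * \<bar>cutoff (real (Suc k)) (\<phi> k x)\<bar> \<le>
            b * (\<bar>indicator K x * V x\<bar> + \<bar>VO x\<bar> * \<bar>u x\<bar> powr p)"
          proof (cases "x \<in> K")
            case False
            then have "cutoff (real (Suc k)) (\<phi> k x) = 0" using K(3) by (intro cutoff_eq_0) auto
            then show ?thesis using b0 by simp
          next
            case True
            then have VO: "\<bar>VO x\<bar> = \<bar>V x\<bar>" using K(2) by (auto simp: VO_def)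
            have le: "\<bar>u x\<bar> powr (p - 1) \<le> 1 + \<bar>u x\<bar> powr p"
            proof (cases "\<bar>u x\<bar> \<le> 1")
              case True
              then have "\<bar>u x\<bar> powr (p - 1) \<le> 1" using p by (intro powr_le1) auto
              then show ?thesis by (simp add: add_increasing2)
            next
              case False
              then have "\<bar>u x\<bar> powr (p - 1) \<le> \<bar>u x\<bar> powr p" using p by (intro powr_mono) auto
              then show ?thesis by simp
            qed
            have "\<bar>VO x\<bar> * \<bar>u x\<bar> powr (p - 1) * \<bar>cutoff (real (Suc k)) (\<phi> k x)\<bar> \<le> \<bar>VO x\<bar> * (1 + \<bar>u x\<bar> powr p) * b"
              using le order_trans[OF abs_cutoff_le b] b0 by (intro mult_mono) auto
            also have "\<dots> = b * (\<bar>indicator K x * V x\<bar> + \<bar>VO x\<bar> * \<bar>u x\<bar> powr p)"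
              using True unfolding VO by (simp add: algebra_simps)
            finally show ?thesis .
          qed
          then show "norm (\<bar>VO x\<bar> * \<bar>u x\<bar> powr (p - 1) * \<bar>cutoff (real (Suc k)) (\<phi> k x)\<bar>) \<le>
            norm (b * (\<bar>indicator K x * V x\<bar> + \<bar>VO x\<bar> * \<bar>u x\<bar> powr p))"
            using b0 by (simp add: abs_mult)
        qed
      qed
    qed
  qed
  have half: "incr (\<lambda>x. u x / 2) z = incr u z / 2" for z by (simp add: incr_def diff_divide_distrib)
  have "A (\<lambda>x. u x / 2) - \<mu> * B (\<lambda>x. u x / 2) = \<kappa> * D (\<lambda>x. u x / 2)"
  proof (rule limit[where \<sigma> = U and G = "\<lambda>x. \<bar>u x\<bar>"])
    show "A (U k) - \<mu> * B (U k) = \<kappa> * D (U k)" for k by (rule P_U)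
    show "Lp_tendsto p E (\<lambda>k. incr (U k)) (incr (\<lambda>x. u x / 2))"
    proof (rule Lp_tendsto_dominated[OF \<phi>E Lp_tendsto_const p0(1), where c = 7])
      show "incr u \<in> borel_measurable E" by simp
      show "integrable E (\<lambda>z. \<bar>incr u z\<bar> powr p)" by (rule uint(1))
      show "incr (\<lambda>x. u x / 2) \<in> borel_measurable E" unfolding half by simp
      show "incr (U k) \<in> borel_measurable E" for k using incr_measurable[OF mU] by simp
      show "AE z in E. (\<lambda>k. incr (U k) z) \<longlonglongrightarrow> incr (\<lambda>x. u x / 2) z"
        using AE_energy_measure[OF \<Omega> Ulim, of p \<alpha>] by eventually_elim (simp add: incr_def tendsto_diff)
      show "AE z in E. \<bar>incr (U k) z\<bar> \<le> 7 * (\<bar>incr (\<phi> k) z\<bar> + \<bar>incr u z\<bar>)" for k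
      proof (rule AE_I2)
        fix z
        have "\<bar>incr (U k) z\<bar> \<le> \<bar>cutoff (real (Suc k)) (\<phi> k (fst z)) - cutoff (real (Suc k)) (\<phi> k (snd z))\<bar> + \<bar>incr u z\<bar>"
          unfolding incr_def U_def by (rule damp_lipschitz[OF pos])
        also have "\<dots> \<le> 7 * \<bar>incr (\<phi> k) z\<bar> + 7 * \<bar>incr u z\<bar>"
          unfolding incr_def by (intro add_mono cutoff_lipschitz) simp
        finally show "\<bar>incr (U k) z\<bar> \<le> 7 * (\<bar>incr (\<phi> k) z\<bar> + \<bar>incr u z\<bar>)"
          by (simp only: distrib_left)
      qed
    qed simp
    have uH: "Lp_tendsto p H (\<lambda>i. u) u" by (rule Lp_tendsto_const) (use uint(2) in simp_all)
    show "Lp_tendsto p H U (\<lambda>x. u x / 2)"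
    proof (rule Lp_tendsto_dominated[OF uH uH p0(1), where c = 1])
      show "AE x in H. (\<lambda>k. U k x) \<longlonglongrightarrow> u x / 2" by (rule AE_hardy_measure[OF \<Omega> Ulim])
      show "AE x in H. \<bar>U k x\<bar> \<le> 1 * (\<bar>u x\<bar> + \<bar>u x\<bar>)" for k
      proof (rule AE_I2)
        fix x
        have "\<bar>U k x\<bar> \<le> \<bar>u x\<bar>" unfolding U_def by (rule abs_damp_le2[OF pos])
        then show "\<bar>U k x\<bar> \<le> 1 * (\<bar>u x\<bar> + \<bar>u x\<bar>)" by simp
      qed
    qed simp_all
    show "AE x in lebesgue. (\<lambda>k. U k x) \<longlonglongrightarrow> u x / 2" by (rule Ulim)
    show "AE x in lebesgue. \<bar>U k x\<bar> \<le> \<bar>u x\<bar>" for k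
      using abs_damp_le2[OF pos[of k]] by (intro AE_I2) (simp add: U_def)
    have "\<bar>u x\<bar> powr (p - 1) * \<bar>u x\<bar> = \<bar>u x\<bar> powr p" for x
      by (cases "u x = 0") (auto simp: powr_diff)
    then show "integrable lebesgue (\<lambda>x. \<bar>VO x\<bar> * \<bar>u x\<bar> powr (p - 1) * \<bar>u x\<bar>)"
      using intu by (simp add: mult.assoc)
  qed
  moreover have sq: "\<bar>s\<bar> powr (p - 2) * s * (s / 2) = \<bar>s\<bar> powr p / 2" for s :: real
    by (cases "s = 0") (auto simp: powr_diff power2_eq_square)
  have "A (\<lambda>x. u x / 2) = frac_energy p \<alpha> \<Omega> u / 2"
    unfolding A_def half sq frac_eq[OF mu] by simp
  moreover have "B (\<lambda>x. u x / 2) = hardy_integral p \<alpha> \<Omega> u / 2"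
    unfolding B_def sq hardy_eq[OF mu] by simp
  moreover have "D (\<lambda>x. u x / 2) = (LINT x:\<Omega>|lebesgue. V x * \<bar>u x\<bar> powr p) / 2"
  proof -
    have "VO x * (\<bar>u x\<bar> powr (p - 2) * u x) * (u x / 2) = (indicator \<Omega> x *\<^sub>R (V x * \<bar>u x\<bar> powr p)) / 2" for x
      using sq[of "u x"] by (simp add: VO_def mult.assoc)
    then show ?thesis unfolding D_def set_lebesgue_integral_def by simp
  qed
  ultimately show ?thesis by (simp add: J_def field_simps)
qed

end

section \<open>Admissible functions and the first eigenvalue\<close>

text \<open>A finite sum b of flat bumps is positive on T, hence at least some d > 0 there by
  compactness. The map s / (1 + s), applied to a large multiple of b, keeps the zero set, stays
  below 1 and comes close to 1 on T.\<close>

lemma smooth_bump: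
  fixes T :: "'a::euclidean_space set"
  assumes "compact T" "\<rho> > 0" "\<eta> > 0"
  obtains \<phi> where "\<And>k. C_k k \<phi>" "\<And>x. 0 \<le> \<phi> x" "\<And>x. \<phi> x \<le> (1::real)" "\<And>x. x \<in> T \<Longrightarrow> 1 - \<eta> \<le> \<phi> x"
    "\<And>x. \<phi> x \<noteq> 0 \<Longrightarrow> \<exists>c\<in>T. dist c x < \<rho>"
proof -
  obtain F where F: "F \<subseteq> T" "finite F" "T \<subseteq> (\<Union>c\<in>F. ball c \<rho>)"
    using compactE_image[OF assms(1), of T "\<lambda>c. ball c \<rho>"] assms(2) by force
  define b where "b x = (\<Sum>c\<in>F. flat 0 (\<rho>\<^sup>2 - (x - c) \<bullet> (x - c)))" for x
  have pos: "\<rho>\<^sup>2 - (x - c) \<bullet> (x - c) > 0 \<longleftrightarrow> dist c x < \<rho>" for x c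
  proof -
    have "(x - c) \<bullet> (x - c) = (dist c x)\<^sup>2" by (simp only: dist_norm norm_minus_commute[of c x] power2_norm_eq_inner)
    moreover have "(dist c x)\<^sup>2 < \<rho>\<^sup>2 \<longleftrightarrow> dist c x < \<rho>"
      using assms(2) power_strict_mono[of "dist c x" \<rho> 2] power2_less_imp_less[of "dist c x" \<rho>] by auto
    ultimately show ?thesis by (simp only: diff_gt_0_iff_gt)
  qed
  have b0: "b x \<ge> 0" for x unfolding b_def by (intro sum_nonneg flat_nonneg)
  have Csum: "finite G \<Longrightarrow> C_k k (\<lambda>x. \<Sum>c\<in>G. flat 0 (\<rho>\<^sup>2 - (x - c) \<bullet> (x - c)))" for G :: "'a set" and k
    by (induction G rule: finite_induct)
      (simp_all add: C_k_const C_k_add C_k_flat C_k_diff C_k_norm_diff_square)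
  have Cb: "C_k k b" for k unfolding b_def[abs_def] by (rule Csum[OF F(2)])
  have bT: "b x > 0" if xT: "x \<in> T" for x
  proof -
    obtain c where "c \<in> F" "dist c x < \<rho>" using F(3) xT by auto
    then show ?thesis unfolding b_def using F(2) pos[of x c]
      by (intro sum_pos2[of _ c]) (simp_all add: flat_nonneg flat_pos_iff)
  qed
  have "\<exists>d>0. \<forall>x\<in>T. d \<le> b x"
  proof (cases "T = {}")
    case False
    have "continuous_on T b" using Cb[of 0] by (simp add: continuous_on_subset[OF _ subset_UNIV])
    then obtain x0 where "x0 \<in> T" "\<forall>x\<in>T. b x0 \<le> b x"
      using continuous_attains_inf[OF assms(1) False] by blast
    then show ?thesis using bT by blast
  qed (auto intro: exI[of _ 1])
  then obtain d where d: "d > 0" "\<And>x. x \<in> T \<Longrightarrow> d \<le> b x" by blast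
  \<comment> \<open>On T this makes M * b x >= 1 / \<eta>, which implies M b / (1 + M b) >= 1 -
    \<eta>.\<close>
  define M where "M = 1 / (\<eta> * d)"
  have M: "M > 0" using d assms(3) by (simp add: M_def)
  define \<phi> where "\<phi> x = M * b x * inverse (1 + M * b x)" for x
  have den: "1 + M * b x > 0" for x using M b0[of x] by (simp add: add_pos_nonneg)
  show thesis
  proof (rule that)
    show "C_k k \<phi>" for k unfolding \<phi>_def[abs_def]
      by (intro C_k_mult C_k_const Cb C_k_inverse den C_k_add)
    show "0 \<le> \<phi> x" for x unfolding \<phi>_def using M b0[of x] den[of x] by simp
    show "\<phi> x \<le> 1" for x unfolding \<phi>_def using den[of x] by (simp add: divide_inverse[symmetric] pos_divide_le_eq)
    show "1 - \<eta> \<le> \<phi> x" if "x \<in> T" for x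
    proof -
      have "1 / \<eta> \<le> M * b x"
        using mult_left_mono[OF d(2)[OF that], of M] M d assms(3) by (simp add: M_def)
      then have "1 \<le> \<eta> * (M * b x)" using assms(3) by (simp add: field_simps)
      then have "1 \<le> \<eta> * (1 + M * b x)" using assms(3) by (simp add: distrib_left)
      then have "(1 - \<eta>) * (1 + M * b x) \<le> M * b x" by (simp add: left_diff_distrib)
      then show ?thesis unfolding \<phi>_def using den[of x] by (simp add: divide_inverse[symmetric] pos_le_divide_eq)
    qed
    show "\<exists>c\<in>T. dist c x < \<rho>" if "\<phi> x \<noteq> 0" for x
    proof (rule ccontr)
      assume neg: "\<not> ?thesis"
      have "flat 0 (\<rho>\<^sup>2 - (x - c) \<bullet> (x - c)) = 0" if "c \<in> F" for c
        using neg F(1) that pos[of x c] flat_pos_iff[of 0 "\<rho>\<^sup>2 - (x - c) \<bullet> (x - c)"]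
          flat_nonneg[of 0 "\<rho>\<^sup>2 - (x - c) \<bullet> (x - c)"] by force
      then have "b x = 0" by (simp add: b_def)
      then show False using that by (simp add: \<phi>_def)
    qed
  qed
qed

text \<open>The set where V > 0 has positive measure, already within some ball. Inner regularity
  gives a compact subset that is not null, and the integral of a positive function over it is
  positive.\<close>

lemma positive_part_compact:
  fixes \<Omega> :: "'a::euclidean_space set"
  assumes V: "L1_loc \<Omega> V" and \<Omega>: "open \<Omega>" and pos: "\<not> (AE x in lebesgue. x \<in> \<Omega> \<longrightarrow> max (V x) 0 = 0)"
  obtains T where "compact T" "T \<subseteq> \<Omega>" "(LINT x:T|lebesgue. V x) > 0"
proof -
  define S where "S = {x. indicator \<Omega> x * V x > 0}"
  have [measurable]: "(\<lambda>x. indicator \<Omega> x * V x) \<in> borel_measurable lebesgue" by (rule L1_loc_measurable[OF V \<Omega>])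
  have "{x \<in> space lebesgue. indicator \<Omega> x * V x > 0} \<in> sets lebesgue" by measurable
  then have S: "S \<in> sets lebesgue" by (simp add: S_def)
  have S_iff: "x \<in> S \<longleftrightarrow> x \<in> \<Omega> \<and> V x > 0" for x by (auto simp: S_def indicator_def)
  have notnull: "S \<notin> null_sets lebesgue"
  proof
    assume "S \<in> null_sets lebesgue"
    then have "AE x in lebesgue. x \<notin> S" by (rule AE_not_in)
    then have "AE x in lebesgue. x \<in> \<Omega> \<longrightarrow> max (V x) 0 = 0"
      by eventually_elim (auto simp: S_iff)
    then show False using pos by blast
  qed
  have "\<exists>n::nat. S \<inter> cball 0 (real n) \<notin> null_sets lebesgue"
  proof (rule ccontr)
    assume "\<not> ?thesis"
    then have "(\<Union>n. S \<inter> cball 0 (real n)) \<in> null_sets lebesgue" by (intro null_sets_UN) auto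
    moreover have "(\<Union>n. S \<inter> cball 0 (real n)) = S" using real_arch_simple by (auto simp: dist_norm)
    ultimately show False using notnull by simp
  qed
  then obtain n where n: "S \<inter> cball 0 (real n) \<notin> null_sets lebesgue" by blast
  define S' where "S' = S \<inter> cball 0 (real n)"
  have S': "S' \<in> sets lebesgue" unfolding S'_def using S by (intro sets.Int) auto
  have "bounded S'" unfolding S'_def by (rule bounded_subset[OF bounded_cball]) blast
  then have lm: "S' \<in> lmeasurable" using S' by (rule bounded_set_imp_lmeasurable)
  define e where "e = measure lebesgue S'"
  have eS: "emeasure lebesgue S' = ennreal e" unfolding e_def using lm by (simp add: emeasure_eq_measure2 fmeasurableD2 emeasure_eq_ennreal_measure)
  have "emeasure lebesgue S' \<noteq> 0" using n S' by (auto simp: null_sets_def S'_def)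
  then have "e > 0" using eS by (cases "e > 0") (auto simp: ennreal_neg)
  \<comment> \<open>The part left out has measure less than the measure e of S', so T cannot be
    null.\<close>
  obtain T where T: "closed T" "T \<subseteq> S'" "emeasure lebesgue (S' - T) < ennreal e"
    using sets_lebesgue_inner_closed[OF S' \<open>e > 0\<close>] by metis
  have cT: "compact T" using T(1,2) \<open>bounded S'\<close> by (auto simp: compact_eq_bounded_closed intro: bounded_subset)
  have T\<Omega>: "T \<subseteq> \<Omega>" "\<And>x. x \<in> T \<Longrightarrow> V x > 0" using T(2) by (auto simp: S'_def S_iff)
  have mT: "T \<in> sets lebesgue" using T(1) by (simp add: borel_closed)
  have Tpos: "T \<notin> null_sets lebesgue"
  proof
    assume "T \<in> null_sets lebesgue"
    then have "emeasure lebesgue (S' - T) = emeasure lebesgue S'" by (rule emeasure_Diff_null_set[OF _ S'])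
    then show False using T(3) eS by simp
  qed
  have int: "integrable lebesgue (\<lambda>x. indicator T x *\<^sub>R V x)"
    using V cT T\<Omega>(1) unfolding L1_loc_def set_integrable_def by blast
  have nn: "AE x in lebesgue. 0 \<le> indicator T x *\<^sub>R V x"
    using T\<Omega>(2) by (intro AE_I2) (auto simp: indicator_def less_imp_le)
  have "(LINT x:T|lebesgue. V x) \<noteq> 0"
  proof
    assume "(LINT x:T|lebesgue. V x) = 0"
    then have "AE x in lebesgue. indicator T x *\<^sub>R V x = 0"
      unfolding set_lebesgue_integral_def using integral_nonneg_eq_0_iff_AE[OF int nn] by simp
    then have "AE x in lebesgue. x \<notin> T"
      by eventually_elim (use T\<Omega>(2) in \<open>force simp: indicator_def\<close>)
    then show False using Tpos mT AE_iff_null_sets[OF mT] by simp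
  qed
  moreover have "(LINT x:T|lebesgue. V x) \<ge> 0"
    unfolding set_lebesgue_integral_def by (rule integral_nonneg_AE[OF nn])
  ultimately show thesis using that[OF cT T\<Omega>(1)] by linarith
qed

text \<open>Bumps around T shrink to the indicator of T, so their weighted integrals tend to the
  positive integral of V over T. Rescaled, such a bump shows that the set in \<open>lambda1\<close>
  is nonempty.\<close>

lemma admissible_core_function:
  fixes \<Omega> :: "'a::euclidean_space set"
  assumes V: "L1_loc \<Omega> V" and \<Omega>: "open \<Omega>" and pos: "\<not> (AE x in lebesgue. x \<in> \<Omega> \<longrightarrow> max (V x) 0 = 0)"
    and "p > 0"
  obtains \<phi> where "\<phi> \<in> X0_core \<Omega>" "set_integrable lebesgue \<Omega> (\<lambda>x. V x * \<bar>\<phi> x\<bar> powr p)"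
    "(LINT x:\<Omega>|lebesgue. V x * \<bar>\<phi> x\<bar> powr p) > 0"
proof -
  obtain T where T: "compact T" "T \<subseteq> \<Omega>" "(LINT x:T|lebesgue. V x) > 0"
    using positive_part_compact[OF V \<Omega> pos] by blast
  obtain r where r: "r > 0" "(\<Union>x\<in>T. cball x r) \<subseteq> \<Omega>"
    using compact_subset_open_imp_cball_epsilon_subset[OF T(1) \<Omega> T(2)] by blast
  \<comment> \<open>The closed r-neighbourhood of T lies in \<Omega> and contains the supports of
    all bumps, so |V| on L is a common integrable majorant.\<close>
  define L where "L = {x + y | x y. x \<in> T \<and> y \<in> cball 0 r}"
  have L: "compact L" unfolding L_def by (intro compact_sums T(1) compact_cball)
  have inL: "x \<in> L" if "c \<in> T" "dist c x \<le> r" for c x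
    unfolding L_def using that by (intro CollectI exI[of _ c] exI[of _ "x - c"]) (simp add: dist_norm norm_minus_commute)
  have L\<Omega>: "L \<subseteq> \<Omega>" using r(2) unfolding L_def by (force simp: dist_norm)
  have "\<exists>\<phi>. (\<forall>k. C_k k \<phi>) \<and> (\<forall>x. 0 \<le> \<phi> x \<and> \<phi> x \<le> (1::real)) \<and> (\<forall>x\<in>T. 1 - 1 / real (Suc m) \<le> \<phi> x) \<and>
      (\<forall>x. \<phi> x \<noteq> 0 \<longrightarrow> (\<exists>c\<in>T. dist c x < r / real (Suc m)))" for m
    by (rule smooth_bump[OF T(1), of "r / real (Suc m)" "1 / real (Suc m)"]) (use r in \<open>simp_all, blast\<close>)
  then obtain \<phi> where \<phi>: "\<And>m k. C_k k (\<phi> m)" "\<And>m x. 0 \<le> \<phi> m x \<and> \<phi> m x \<le> 1"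
    "\<And>m x. x \<in> T \<Longrightarrow> 1 - 1 / real (Suc m) \<le> \<phi> m x" "\<And>m x. \<phi> m x \<noteq> 0 \<Longrightarrow> \<exists>c\<in>T. dist c x < r / real (Suc m)"
    by metis
  have supp: "x \<in> L" if nz: "\<phi> m x \<noteq> 0" for m x
  proof -
    obtain c where "c \<in> T" "dist c x < r / real (Suc m)" using \<phi>(4)[OF nz] by blast
    moreover have "r / real (Suc m) \<le> r" using r(1) by (simp add: divide_le_eq mult_left_le)
    ultimately show ?thesis by (intro inL[of c]) auto
  qed
  have core: "\<phi> m \<in> X0_core \<Omega>" for m
    using \<phi>(1) closure_support_subset(1)[of "\<phi> m" L, OF supp[where m = m] L] supp L\<Omega>
    unfolding X0_core_def C_c_inf_def by blast
  have intL: "integrable lebesgue (\<lambda>x. indicator L x *\<^sub>R V x)"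
    using V L L\<Omega> unfolding L1_loc_def set_integrable_def by blast
  have intT: "integrable lebesgue (\<lambda>x. indicator T x *\<^sub>R V x)"
    using V T unfolding L1_loc_def set_integrable_def by blast
  have [measurable]: "(\<lambda>x. indicator \<Omega> x * V x) \<in> borel_measurable lebesgue" by (rule L1_loc_measurable[OF V \<Omega>])
  have [measurable]: "\<phi> m \<in> borel_measurable lebesgue" for m using X0_core_D(6)[OF core] .
  \<comment> \<open>On T the bumps are within 1 / (m + 1) of 1; at a point off the closed set T they
    are eventually 0, because their supports shrink to T.\<close>
  have lim: "(\<lambda>m. \<bar>\<phi> m x\<bar> powr p) \<longlonglongrightarrow> indicator T x" for x
  proof (cases "x \<in> T")
    case True
    have "(\<lambda>m. \<phi> m x) \<longlonglongrightarrow> 1"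
    proof (rule tendsto_sandwich)
      show "(\<lambda>m. 1 - 1 / real (Suc m)) \<longlonglongrightarrow> 1"
        using tendsto_diff[OF tendsto_const LIMSEQ_Suc[OF lim_1_over_n], of "1::real"] by simp
      show "\<forall>\<^sub>F m in sequentially. 1 - 1 / real (Suc m) \<le> \<phi> m x"
        by (rule always_eventually) (use \<phi>(3)[OF True] in blast)
      show "\<forall>\<^sub>F m in sequentially. \<phi> m x \<le> 1" by (rule always_eventually) (use \<phi>(2) in blast)
    qed simp
    then have "(\<lambda>m. \<bar>\<phi> m x\<bar> powr p) \<longlonglongrightarrow> \<bar>1\<bar> powr p" by (intro tendsto_powr tendsto_rabs tendsto_const) auto
    then show ?thesis using True by simp
  next
    case False
    have "open (- T)" using T(1) by (simp add: compact_imp_closed open_Compl)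
    then obtain \<delta> where \<delta>: "\<delta> > 0" "ball x \<delta> \<subseteq> - T" using False open_contains_ball by (metis ComplI)
    have "(\<lambda>m. r / real (Suc m)) \<longlonglongrightarrow> 0" by (rule LIMSEQ_Suc[OF lim_const_over_n])
    then have "eventually (\<lambda>m. r / real (Suc m) < \<delta>) sequentially" using \<delta>(1) by (rule order_tendstoD(2))
    then have "eventually (\<lambda>m. \<bar>\<phi> m x\<bar> powr p = 0) sequentially"
    proof eventually_elim
      case (elim m)
      have "\<phi> m x = 0"
      proof (rule ccontr)
        assume "\<phi> m x \<noteq> 0"
        then obtain c where c: "c \<in> T" "dist c x < r / real (Suc m)" using \<phi>(4) by blast
        then have "c \<in> ball x \<delta>" using elim by (simp add: dist_commute)
        then show False using \<delta>(2) c(1) by blast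
      qed
      then show ?case by simp
    qed
    then show ?thesis using False by (simp add: tendsto_eventually)
  qed
  have eq: "indicator \<Omega> x *\<^sub>R (V x * \<bar>\<phi> m x\<bar> powr p) = (indicator \<Omega> x * V x) * \<bar>\<phi> m x\<bar> powr p" for m x
    by simp
  have bound: "norm ((indicator \<Omega> x * V x) * \<bar>\<phi> m x\<bar> powr p) \<le> norm (indicator L x *\<^sub>R V x)" for m x
  proof (cases "\<phi> m x = 0")
    case False
    then have "x \<in> L" by (rule supp)
    moreover have "\<bar>\<phi> m x\<bar> powr p \<le> 1" using \<phi>(2)[of m x] \<open>p > 0\<close> by (intro powr_le1) auto
    ultimately show ?thesis using L\<Omega> by (auto simp: abs_mult mult_left_le)
  qed simp
  have int: "integrable lebesgue (\<lambda>x. (indicator \<Omega> x * V x) * \<bar>\<phi> m x\<bar> powr p)" for m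
    by (rule Bochner_Integration.integrable_bound[OF intL _ AE_I2[OF bound]]) measurable
  have "(\<lambda>m. \<integral>x. (indicator \<Omega> x * V x) * \<bar>\<phi> m x\<bar> powr p \<partial>lebesgue) \<longlonglongrightarrow> (\<integral>x. indicator T x *\<^sub>R V x \<partial>lebesgue)"
  proof (rule integral_dominated_convergence[where w = "\<lambda>x. norm (indicator L x *\<^sub>R V x)"])
    show "(\<lambda>x. indicator T x *\<^sub>R V x) \<in> borel_measurable lebesgue" using intT by (rule borel_measurable_integrable)
    show "(\<lambda>x. (indicator \<Omega> x * V x) * \<bar>\<phi> m x\<bar> powr p) \<in> borel_measurable lebesgue" for m by measurable
    show "integrable lebesgue (\<lambda>x. norm (indicator L x *\<^sub>R V x))" using intL by (rule integrable_norm)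
    show "AE x in lebesgue. (\<lambda>m. (indicator \<Omega> x * V x) * \<bar>\<phi> m x\<bar> powr p) \<longlonglongrightarrow> indicator T x *\<^sub>R V x"
    proof (rule AE_I2)
      fix x
      have "(\<lambda>m. (indicator \<Omega> x * V x) * \<bar>\<phi> m x\<bar> powr p) \<longlonglongrightarrow> (indicator \<Omega> x * V x) * indicator T x"
        by (intro tendsto_mult_left lim)
      moreover have "(indicator \<Omega> x * V x) * indicator T x = indicator T x *\<^sub>R V x"
        using T(2) by (auto simp: indicator_def)
      ultimately show "(\<lambda>m. (indicator \<Omega> x * V x) * \<bar>\<phi> m x\<bar> powr p) \<longlonglongrightarrow> indicator T x *\<^sub>R V x" by simp
    qed
    show "AE x in lebesgue. norm ((indicator \<Omega> x * V x) * \<bar>\<phi> m x\<bar> powr p) \<le> norm (indicator L x *\<^sub>R V x)" for m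
      by (intro AE_I2 bound)
  qed
  then have "eventually (\<lambda>m. (\<integral>x. (indicator \<Omega> x * V x) * \<bar>\<phi> m x\<bar> powr p \<partial>lebesgue) > 0) sequentially"
    using T(3) unfolding set_lebesgue_integral_def by (rule order_tendstoD(1))
  then obtain m where m: "(\<integral>x. (indicator \<Omega> x * V x) * \<bar>\<phi> m x\<bar> powr p \<partial>lebesgue) > 0"
    by (auto simp: eventually_sequentially)
  show thesis
    by (rule that[OF core[of m]]) (use int[of m] m in \<open>simp_all only: set_integrable_def set_lebesgue_integral_def eq\<close>)
qed

context hardy_setting
begin

lemma X0_scale:
  assumes "u \<in> X0 p \<alpha> \<Omega>"
  shows "(\<lambda>x. t * u x) \<in> X0 p \<alpha> \<Omega>" and "J p \<alpha> \<mu> \<Omega> (\<lambda>x. t * u x) = \<bar>t\<bar> powr p * J p \<alpha> \<mu> \<Omega> u"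
proof -
  obtain \<phi> where \<phi>: "\<And>k. \<phi> k \<in> X0_core \<Omega>" and lim: "AE x in lebesgue. (\<lambda>k. \<phi> k x) \<longlonglongrightarrow> u x"
    and \<phi>E: "Lp_tendsto p E (\<lambda>k. incr (\<phi> k)) (incr u)" and mu [measurable]: "u \<in> borel_measurable lebesgue"
    using X0_D[OF assms] by blast
  have core: "(\<lambda>x. t * \<phi> k x) \<in> X0_core \<Omega>" for k
    by (rule X0_core_I[OF C_k_cmult[OF X0_core_D(1)[OF \<phi>]] \<phi>[of k] \<phi>[of k]]) simp
  have eq: "incr (\<lambda>x. t * w x) z = t * incr w z" for w z by (simp add: incr_def right_diff_distrib)
  have m: "(\<lambda>x. t * u x) \<in> borel_measurable lebesgue" by measurable
  show "(\<lambda>x. t * u x) \<in> X0 p \<alpha> \<Omega>"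
  proof (rule X0_I[OF core m])
    show "AE x in lebesgue. (\<lambda>k. t * \<phi> k x) \<longlonglongrightarrow> t * u x" using lim by eventually_elim (rule tendsto_mult_left)
    show "Lp_tendsto p E (\<lambda>k. incr (\<lambda>x. t * \<phi> k x)) (incr (\<lambda>x. t * u x))"
    proof (rule Lp_tendsto_dominated[OF \<phi>E \<phi>E, where c = "\<bar>t\<bar>"])
      show "incr (\<lambda>x. t * u x) \<in> borel_measurable E" using incr_measurable[OF m] by simp
      show "incr (\<lambda>x. t * \<phi> k x) \<in> borel_measurable E" for k using incr_measurable[OF X0_core_D(6)[OF core]] by simp
      show "AE z in E. (\<lambda>k. incr (\<lambda>x. t * \<phi> k x) z) \<longlonglongrightarrow> incr (\<lambda>x. t * u x) z"
      proof -
        have "AE z in E. (\<lambda>k. incr (\<phi> k) z) \<longlonglongrightarrow> incr u z" using \<phi>E unfolding Lp_tendsto_def by blast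
        then show ?thesis unfolding eq by eventually_elim (rule tendsto_mult_left)
      qed
      show "AE z in E. \<bar>incr (\<lambda>x. t * \<phi> k x) z\<bar> \<le> \<bar>t\<bar> * (\<bar>incr (\<phi> k) z\<bar> + \<bar>incr (\<phi> k) z\<bar>)" for k
        by (intro AE_I2) (simp add: eq abs_mult mult_left_mono)
    qed (use p in auto)
  qed
  have "frac_energy p \<alpha> \<Omega> (\<lambda>x. t * u x) = \<bar>t\<bar> powr p * frac_energy p \<alpha> \<Omega> u"
    unfolding frac_eq[OF m] frac_eq[OF mu] eq by (simp add: abs_mult powr_mult)
  moreover have "hardy_integral p \<alpha> \<Omega> (\<lambda>x. t * u x) = \<bar>t\<bar> powr p * hardy_integral p \<alpha> \<Omega> u"
    unfolding hardy_eq[OF m] hardy_eq[OF mu] by (simp add: abs_mult powr_mult)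
  ultimately show "J p \<alpha> \<mu> \<Omega> (\<lambda>x. t * u x) = \<bar>t\<bar> powr p * J p \<alpha> \<mu> \<Omega> u"
    by (simp add: J_def algebra_simps)
qed

lemma core_X0: "\<phi> \<in> X0_core \<Omega> \<Longrightarrow> \<phi> \<in> X0 p \<alpha> \<Omega>"
  using X0_I[of "\<lambda>k. \<phi>" \<phi>] Lp_tendsto_const[of "incr \<phi>" E p] core_integrable(1)[of \<phi>]
    X0_core_D(6)[of \<phi> \<Omega>] incr_measurable[of \<phi>] by simp

lemma J_quotient_admissible:
  assumes w: "w \<in> X0 p \<alpha> \<Omega>" and int: "set_integrable lebesgue \<Omega> (\<lambda>x. V x * \<bar>w x\<bar> powr p)"
    and I: "I = (LINT x:\<Omega>|lebesgue. V x * \<bar>w x\<bar> powr p)" "I > 0"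
  shows "J p \<alpha> \<mu> \<Omega> w / I \<in> {J p \<alpha> \<mu> \<Omega> u | u. u \<in> X0 p \<alpha> \<Omega> \<and>
            set_integrable lebesgue \<Omega> (\<lambda>x. V x * \<bar>u x\<bar> powr p) \<and>
            (LINT x:\<Omega>|lebesgue. V x * \<bar>u x\<bar> powr p) = 1}"
proof -
  define t where "t = I powr (- 1 / p)"
  have t: "\<bar>t\<bar> powr p = 1 / I"
  proof -
    have "\<bar>t\<bar> powr p = I powr (- 1 / p * p)" by (simp only: t_def abs_of_nonneg powr_ge_zero powr_powr)
    also have "\<dots> = 1 / I" using I(2) p by (simp add: powr_minus_divide)
    finally show ?thesis .
  qed
  have eq: "V x * \<bar>t * w x\<bar> powr p = (1 / I) * (V x * \<bar>w x\<bar> powr p)" for x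
    unfolding abs_mult powr_mult t by simp
  have "(\<lambda>x. t * w x) \<in> X0 p \<alpha> \<Omega>" by (rule X0_scale(1)[OF w])
  moreover have "set_integrable lebesgue \<Omega> (\<lambda>x. V x * \<bar>t * w x\<bar> powr p)"
    unfolding eq using int by simp
  moreover have "(LINT x:\<Omega>|lebesgue. V x * \<bar>t * w x\<bar> powr p) = 1"
    unfolding eq using I by simp
  moreover have "J p \<alpha> \<mu> \<Omega> w / I = J p \<alpha> \<mu> \<Omega> (\<lambda>x. t * w x)"
    unfolding X0_scale(2)[OF w] t by simp
  ultimately show ?thesis by blast
qed

text \<open>If the weighted integral is positive, w can be normalised to a competitor. Otherwise the
  left side is at most 0, since the infimum over a nonempty set of nonnegative values is
  nonnegative, while the right side is nonnegative by the Hardy inequality.\<close>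

lemma lambda1_le:
  assumes \<mu>: "0 \<le> \<mu>" "\<mu> \<le> C" and V: "L1_loc \<Omega> V"
    and pos: "\<not> (AE x in lebesgue. x \<in> \<Omega> \<longrightarrow> max (V x) 0 = 0)"
    and w: "w \<in> X0 p \<alpha> \<Omega>" and int: "set_integrable lebesgue \<Omega> (\<lambda>x. V x * \<bar>w x\<bar> powr p)"
  shows "lambda1 p \<alpha> \<mu> \<Omega> V * (LINT x:\<Omega>|lebesgue. V x * \<bar>w x\<bar> powr p) \<le> J p \<alpha> \<mu> \<Omega> w"
proof -
  define S where "S = {J p \<alpha> \<mu> \<Omega> u | u. u \<in> X0 p \<alpha> \<Omega> \<and>
            set_integrable lebesgue \<Omega> (\<lambda>x. V x * \<bar>u x\<bar> powr p) \<and>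
            (LINT x:\<Omega>|lebesgue. V x * \<bar>u x\<bar> powr p) = 1}"
  have lam: "lambda1 p \<alpha> \<mu> \<Omega> V = Inf S" by (simp add: lambda1_def S_def)
  have nn: "0 \<le> s" if "s \<in> S" for s using that J_nonneg[OF _ \<mu>] unfolding S_def by blast
  then have bdd: "bdd_below S" by (rule bdd_belowI)
  have p0: "p > 0" using p by simp
  obtain \<phi> where \<phi>: "\<phi> \<in> X0_core \<Omega>" "set_integrable lebesgue \<Omega> (\<lambda>x. V x * \<bar>\<phi> x\<bar> powr p)"
    "(LINT x:\<Omega>|lebesgue. V x * \<bar>\<phi> x\<bar> powr p) > 0"
    using admissible_core_function[OF V \<Omega> pos p0] by blast
  have "S \<noteq> {}" using J_quotient_admissible[OF core_X0[OF \<phi>(1)] \<phi>(2) refl \<phi>(3), of \<mu>] unfolding S_def by blast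
  then have lam0: "Inf S \<ge> 0" using nn by (rule cInf_greatest)
  define I where "I = (LINT x:\<Omega>|lebesgue. V x * \<bar>w x\<bar> powr p)"
  show ?thesis
  proof (cases "I > 0")
    case True
    have "Inf S \<le> J p \<alpha> \<mu> \<Omega> w / I"
      using J_quotient_admissible[OF w int I_def True, of \<mu>] bdd unfolding S_def by (rule cInf_lower)
    then show ?thesis using True unfolding lam I_def[symmetric] by (simp add: pos_le_divide_eq)
  next
    case False
    then have "Inf S * I \<le> 0" using lam0 by (simp add: mult_nonneg_nonpos)
    also have "0 \<le> J p \<alpha> \<mu> \<Omega> w" by (rule J_nonneg[OF w \<mu>])
    finally show ?thesis unfolding lam I_def .
  qed
qed

lemma eigenfunctions_proportional:
  assumes \<mu>: "0 \<le> \<mu>" "\<mu> \<le> C" and V: "L1_loc \<Omega> V"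
    and pos: "\<not> (AE x in lebesgue. x \<in> \<Omega> \<longrightarrow> max (V x) 0 = 0)"
    and u: "eigenfunction p \<alpha> \<mu> \<Omega> V (lambda1 p \<alpha> \<mu> \<Omega> V) u"
    and v: "eigenfunction p \<alpha> \<mu> \<Omega> V (lambda1 p \<alpha> \<mu> \<Omega> V) v"
  shows "AE z in lebesgue. u (fst z) * v (snd z) = u (snd z) * v (fst z)"
proof -
  define w where "w x = pnorm p (u x) (v x)" for x
  have uX: "u \<in> X0 p \<alpha> \<Omega>" and vX: "v \<in> X0 p \<alpha> \<Omega>" using u v by (auto simp: eigenfunction_def)
  have wX: "w \<in> X0 p \<alpha> \<Omega>" unfolding w_def[abs_def] by (rule pnorm_X0[OF uX vX])
  have p0: "p > 0" using p by simp
  have wp: "\<bar>w x\<bar> powr p = \<bar>u x\<bar> powr p + \<bar>v x\<bar> powr p" for x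
    using pnorm_powr[OF p0, of "u x" "v x"] pnorm_nonneg[of p "u x" "v x"] by (simp add: w_def)
  note mu = X0_integrable(3)[OF uX] and mv = X0_integrable(3)[OF vX] and mw = X0_integrable(3)[OF wX]
  have [measurable]: "(\<lambda>x. indicator \<Omega> x * V x) \<in> borel_measurable lebesgue" by (rule L1_loc_measurable[OF V \<Omega>])
  have int: "set_integrable lebesgue \<Omega> (\<lambda>x. V x * \<bar>f x\<bar> powr p)"
    if "set_integrable lebesgue \<Omega> (\<lambda>x. \<bar>V x\<bar> * \<bar>f x\<bar> powr p)" and [measurable]: "f \<in> borel_measurable lebesgue" for f
    unfolding set_integrable_def
  proof (rule Bochner_Integration.integrable_bound[OF that(1)[unfolded set_integrable_def]])
    have "(\<lambda>x. (indicator \<Omega> x * V x) * \<bar>f x\<bar> powr p) \<in> borel_measurable lebesgue" by measurable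
    then show "(\<lambda>x. indicator \<Omega> x *\<^sub>R (V x * \<bar>f x\<bar> powr p)) \<in> borel_measurable lebesgue" by (simp add: mult.assoc)
  qed (intro AE_I2, simp add: abs_mult)
  have intu: "set_integrable lebesgue \<Omega> (\<lambda>x. V x * \<bar>u x\<bar> powr p)"
    and intv: "set_integrable lebesgue \<Omega> (\<lambda>x. V x * \<bar>v x\<bar> powr p)"
    using u v mu mv by (auto simp: eigenfunction_def intro: int)
  have intw: "set_integrable lebesgue \<Omega> (\<lambda>x. V x * \<bar>w x\<bar> powr p)"
    unfolding wp distrib_left using intu intv by (rule set_integral_add(1))
  have Vw: "(LINT x:\<Omega>|lebesgue. V x * \<bar>w x\<bar> powr p) =
      (LINT x:\<Omega>|lebesgue. V x * \<bar>u x\<bar> powr p) + (LINT x:\<Omega>|lebesgue. V x * \<bar>v x\<bar> powr p)"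
    unfolding wp distrib_left using intu intv by (rule set_integral_add(2))
  have "J p \<alpha> \<mu> \<Omega> u + J p \<alpha> \<mu> \<Omega> v = lambda1 p \<alpha> \<mu> \<Omega> V * (LINT x:\<Omega>|lebesgue. V x * \<bar>w x\<bar> powr p)"
    unfolding Vw eigenfunction_energy[OF V u] eigenfunction_energy[OF V v] by (rule distrib_left[symmetric])
  also have "\<dots> \<le> J p \<alpha> \<mu> \<Omega> w" by (rule lambda1_le[OF \<mu> V pos wX intw])
  finally have J: "J p \<alpha> \<mu> \<Omega> u + J p \<alpha> \<mu> \<Omega> v \<le> J p \<alpha> \<mu> \<Omega> w" .
  have "hardy_integral p \<alpha> \<Omega> w = hardy_integral p \<alpha> \<Omega> u + hardy_integral p \<alpha> \<Omega> v"
    unfolding hardy_eq[OF mu] hardy_eq[OF mv] hardy_eq[OF mw] wp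
    using X0_integrable(2)[OF uX] X0_integrable(2)[OF vX] by simp
  with J have en: "frac_energy p \<alpha> \<Omega> u + frac_energy p \<alpha> \<Omega> v \<le> frac_energy p \<alpha> \<Omega> w"
    by (simp add: J_def distrib_left)
  \<comment> \<open>The pointwise deficit of the energy densities is nonnegative; the comparison
    with \<open>lambda1\<close> makes its integral at most 0, so it vanishes a.e.\<close>
  define D where "D z = \<bar>incr u z\<bar> powr p + \<bar>incr v z\<bar> powr p - \<bar>incr w z\<bar> powr p" for z
  have D0: "D z \<ge> 0" for z
    using pnorm_diff_powr(1)[OF p, of "u (fst z)" "v (fst z)" "u (snd z)" "v (snd z)"]
    by (simp add: D_def incr_def w_def)
  note iE = X0_integrable(1)[OF uX] X0_integrable(1)[OF vX] X0_integrable(1)[OF wX]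
  have intD: "integrable E D" unfolding D_def[abs_def] using iE by simp
  have "(\<integral>z. D z \<partial>E) = frac_energy p \<alpha> \<Omega> u + frac_energy p \<alpha> \<Omega> v - frac_energy p \<alpha> \<Omega> w"
    unfolding D_def frac_eq[OF mu] frac_eq[OF mv] frac_eq[OF mw] using iE by simp
  with en have "(\<integral>z. D z \<partial>E) \<le> 0" by simp
  moreover have "(\<integral>z. D z \<partial>E) \<ge> 0" using D0 by (rule Bochner_Integration.integral_nonneg)
  ultimately have "(\<integral>z. D z \<partial>E) = 0" by simp
  then have "AE z in E. D z = 0"
    using integral_nonneg_eq_0_iff_AE[OF intD AE_I2[OF D0]] by simp
  then have "AE z in lebesgue. energy_weight p \<alpha> \<Omega> z > 0 \<longrightarrow> D z = 0"
    unfolding energy_measure_def using weight_measurable(1)[OF \<Omega>, of p \<alpha>] by (subst (asm) AE_density) auto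
  moreover have "AE z in lebesgue. (fst z \<notin> \<Omega> \<longrightarrow> u (fst z) = 0) \<and> (snd z \<notin> \<Omega> \<longrightarrow> u (snd (z :: 'a \<times> 'a)) = 0)"
    using AE_lebesgue_prod[OF X0_zero_outside[OF uX]] .
  moreover have "AE z in lebesgue. (fst z \<notin> \<Omega> \<longrightarrow> v (fst z) = 0) \<and> (snd z \<notin> \<Omega> \<longrightarrow> v (snd (z :: 'a \<times> 'a)) = 0)"
    using AE_lebesgue_prod[OF X0_zero_outside[OF vX]] .
  ultimately show ?thesis
  proof eventually_elim
    case (elim z)
    \<comment> \<open>The weight in E vanishes on the diagonal, where division by zero gives 0, and
      outside \<open>Q_set\<close> \<Omega>. In the first case the relation is trivial, in the
      second all values of u and v involved are 0.\<close>
    consider "fst z = snd z" | "fst z \<notin> \<Omega>" "snd z \<notin> \<Omega>" | "fst z \<noteq> snd z" "z \<in> Q_set \<Omega>"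
      unfolding Q_set_def by (cases z) auto
    then show ?case
    proof cases
      case 3
      then have "energy_weight p \<alpha> \<Omega> z > 0" by (simp add: energy_weight_def)
      then have "D z = 0" using elim(1) by simp
      then show ?thesis
        \<comment> \<open>The premise of this fact comes first, so its variables are instantiated in
          the order a, b', a', b.\<close>
        using pnorm_diff_powr(2)[OF p, of "u (fst z)" "v (snd z)" "u (snd z)" "v (fst z)"]
        by (auto simp: D_def incr_def w_def)
    qed (use elim in simp_all)
  qed
qed

end

theorem theorem3p3:
  fixes p \<alpha> \<mu> :: real
    and \<Omega> :: "'a::euclidean_space set"
    and V u v :: "'a \<Rightarrow> real"
  assumes "p \<ge> 2"
    and "0 < \<alpha>" and "\<alpha> < 1"
    and "real DIM('a) > p * \<alpha>"
    and "0 \<le> \<mu>" and "\<mu> < hardy_const TYPE('a) p \<alpha>"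
    and "lipschitz_domain \<Omega>" and "0 \<in> \<Omega>"
    and "assumption_A p \<alpha> \<Omega> V"
    and "eigenfunction p \<alpha> \<mu> \<Omega> V (lambda1 p \<alpha> \<mu> \<Omega> V) u"
    and "eigenfunction p \<alpha> \<mu> \<Omega> V (lambda1 p \<alpha> \<mu> \<Omega> V) v"
  shows "\<exists>c::real. c \<noteq> 0 \<and> (AE x in lebesgue. u x = c * v x)"
proof -
  define S where "S = {C. \<forall>\<phi> \<in> C_c_inf (UNIV :: 'a set). C * hardy_integral p \<alpha> UNIV \<phi> \<le> frac_energy p \<alpha> UNIV \<phi>}"
  have S: "hardy_const TYPE('a) p \<alpha> = Sup S" by (simp add: hardy_const_def S_def)
  \<comment> \<open>An admissible constant above \<mu> is wanted. If S is bounded above, it comes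
    from \<mu> < \<open>Sup S\<close>; if not, \<open>Sup S\<close> is uninformative, but
    unboundedness itself supplies one.\<close>
  have "\<exists>C\<in>S. \<mu> < C"
  proof (cases "bdd_above S")
    case True
    have "0 \<in> S" by (simp add: S_def frac_energy_def set_lebesgue_integral_def split_beta)
    then show ?thesis using assms(6) less_cSup_iff[OF _ True] unfolding S by blast
  next
    case False
    then show ?thesis unfolding bdd_above_def by (meson not_le)
  qed
  then obtain C where CS: "C \<in> S" "\<mu> < C" by blast
  interpret hardy_setting p \<alpha> \<Omega> C
    using assms CS by unfold_locales (auto simp: lipschitz_domain_def S_def)
  have V: "L1_loc \<Omega> V" "\<not> (AE x in lebesgue. x \<in> \<Omega> \<longrightarrow> max (V x) 0 = 0)"
    using assms(9) unfolding assumption_A_def by blast+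
  \<comment> \<open>Fubini for null sets: for almost every x the relation holds for almost every y.
    As u is not zero a.e., some such x has u x nonzero and can be fixed.\<close>
  have "AE z in lborel \<Otimes>\<^sub>M lborel. u (fst z) * v (snd z) = u (snd z) * v (fst z)"
    unfolding lborel_prod
    using eigenfunctions_proportional[OF assms(5) less_imp_le[OF CS(2)] V assms(10,11)]
    by (simp add: AE_completion_iff)
  then have "AE x in lborel. AE y in lborel. u x * v y = u y * v x"
    by (auto dest: lborel_pair.AE_pair)
  then have "AE x in lebesgue. AE y in lebesgue. u x * v y = u y * v x" by (simp add: AE_completion_iff)
  moreover have nz: "\<not> (AE x in lebesgue. u x = 0)" "\<not> (AE x in lebesgue. v x = 0)"
    using assms(10,11) by (auto simp: eigenfunction_def)
  ultimately have "\<exists>x. u x \<noteq> 0 \<and> (AE y in lebesgue. u x * v y = u y * v x)"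
    by (metis (mono_tags, lifting) eventually_mono)
  then obtain x where x: "u x \<noteq> 0" and ae: "AE y in lebesgue. u x * v y = u y * v x" by blast
  \<comment> \<open>If v x were 0, the relation at x would force v to vanish a.e.\<close>
  have vx: "v x \<noteq> 0"
  proof
    assume "v x = 0"
    then have "AE y in lebesgue. v y = 0" using ae x by simp
    then show False using nz(2) by blast
  qed
  have "AE y in lebesgue. u y = (u x / v x) * v y"
    using ae by eventually_elim (use vx in \<open>simp add: field_simps\<close>)
  then show ?thesis using x vx by (intro exI[of _ "u x / v x"]) simp
qed

end
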